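(* Let $N\ge1$, let $V_N$ be a random matrix distributed according to Haar probability measure on the unitary group $U(N)$, let $Z_N=\det(I_N-V_N)$, and put $\Delta_N=|Z_N|$ and $I_N=\operatorname{Im}\log Z_N$. Let $(\beta_{j,j-1})_{1\le j\le N}$ be independent beta variables of parameters $j$ and $j-1$ respectively (with the convention $\beta_{1,0}\equiv 1$). Let $W_1,\dots,W_N$ be independent random variables, independent of $(\beta_{j,j-1})_{1\le j\le N}$, with $W_j$ having the law $$\sigma_{2(j-1)}(\mathrm{d}v)=\frac{2^{2(j-1)}((j-1)!)^2}{\pi\,(2j-2)!}\cos^{2(j-1)}(v)\,\mathbf{1}_{(-\pi/2,\pi/2)}(v)\,\mathrm{d}v .$$ Then the joint distribution of $(I_N,\Delta_N)$ is given by $$(I_N,\Delta_N)\ \overset{\mathrm{law}}{=}\ \left(\sum_{j=1}^N W_j,\ \prod_{j=1}^N \beta_{j,j-1}\,2\cos W_j\right).$$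
   Context: If $e^{\mathrm{i}\theta_1},\dots,e^{\mathrm{i}\theta_N}$ are the eigenvalues of $V_N$, then $\log Z_N:=\sum_{n=1}^N\log(1-e^{\mathrm{i}\theta_n})$ with the branch $\operatorname{Im}\log(1-e^{\mathrm{i}\theta_n})\in(-\pi/2,\pi/2]$ (defined almost surely, since almost surely no eigenvalue equals $1$). Equivalently, $\log Z_N$ is the value at $x=1$ of the unique continuous determination of $x\mapsto\log\det(I_N-xV_N)$ on $[0,1]$ that equals $0$ at $x=0$. A beta random variable with parameters $a,b>0$ has density $\frac{\Gamma(a+b)}{\Gamma(a)\Gamma(b)}t^{a-1}(1-t)^{b-1}$ on $[0,1]$. $\overset{\mathrm{law}}{=}$ denotes equality in distribution. *)

theory Defs
  imports "HOL-Probability.Probability" "HOL-Computational_Algebra.Computational_Algebra"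
begin

definition conj_transpose :: "complex^'n^'m \<Rightarrow> complex^'m^'n" where
  "conj_transpose A = map_matrix cnj (transpose A)"

definition unitary_group :: "(complex^'n^'n) set" where
  "unitary_group = {A. A ** conj_transpose A = mat 1 \<and> conj_transpose A ** A = mat 1}"

text \<open>Left Haar measure normalised to total mass one. Since the unitary group is compact, it is
  unique and also right-invariant.\<close>

definition haar_unitary :: "(complex^'n^'n) measure \<Rightarrow> bool" where
  "haar_unitary \<mu> \<longleftrightarrow>
     prob_space \<mu> \<and>
     sets \<mu> = sets (restrict_space borel unitary_group) \<and>
     (\<forall>g\<in>unitary_group. distr \<mu> \<mu> (\<lambda>x. g ** x) = \<mu>)"

definition char_polynomial :: "complex^'n^'n \<Rightarrow> complex poly" where
  "char_polynomial A = det (mat [:0, 1:] - map_matrix (\<lambda>a. [:a:]) A)"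

text \<open>With algebraic multiplicity.\<close>

definition eigenvalues :: "complex^'n^'n \<Rightarrow> complex multiset" where
  "eigenvalues A = proots (char_polynomial A)"

text \<open>For \<open>z\<close> on the unit circle with \<open>z \<noteq> 1\<close> the real part of \<open>1 - z\<close> is positive, so the
  imaginary part of the principal value \<open>Ln (1 - z)\<close> lies in the interval from \<open>- pi / 2\<close> to
  \<open>pi / 2\<close>. If \<open>1\<close> is an eigenvalue, the value below depends on the convention \<open>Ln 0 = 0\<close>; for
  a Haar distributed matrix this happens with probability zero.\<close>

definition log_det_one_minus :: "complex^'n^'n \<Rightarrow> complex" where
  "log_det_one_minus A = (\<Sum>z\<in>#eigenvalues A. Ln (1 - z))"

definition beta_density :: "real \<Rightarrow> real \<Rightarrow> real \<Rightarrow> real" where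
  "beta_density a b t =
     Gamma (a + b) / (Gamma a * Gamma b) * t powr (a - 1) * (1 - t) powr (b - 1) *
     indicator {0..1} t"

text \<open>The density of the measure usually written \<open>\<sigma>\<close> with index \<open>2 * k\<close>.\<close>

definition cos_density :: "nat \<Rightarrow> real \<Rightarrow> real" where
  "cos_density k v =
     2 ^ (2 * k) * (fact k)\<^sup>2 / (pi * fact (2 * k)) * cos v ^ (2 * k) *
     indicator {- pi / 2 <..< pi / 2} v"

end

theory Submission
  imports Defs "HOL-Real_Asymp.Real_Asymp"
begin

text \<open>Let \<open>V\<close> be Haar distributed on the unitary matrices that fix the basis vectors outside
  \<open>insert k S\<close>, and let \<open>v\<close> be its \<open>k\<close>-th column. If \<open>R\<close> is the unitary with \<open>R - 1\<close> of rank at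
  most one that maps the \<open>k\<close>-th basis vector to \<open>v\<close>, then \<open>V = R ** h\<close>, where \<open>h\<close> is independent of \<open>v\<close>
  and Haar distributed on the matrices that fix the basis vectors outside \<open>S\<close>, and
  \<open>det (1 - V) = (1 - v $ k) * det (1 - h)\<close> for the corresponding blocks. The same holds for the
  logarithms with the prescribed branch: the contractions \<open>A\<close> with \<open>det (1 - A) \<noteq> 0\<close> are star-shaped
  around \<open>0\<close>, so the two sides are compared by shrinking \<open>h\<close> to \<open>0\<close>.

  The entry \<open>v $ k\<close> has a rotation invariant law, and comparison with a normalised Gaussian vector
  gives the law of its modulus. In polar coordinates around \<open>1\<close> this law becomes that of
  \<open>\<beta> * 2 * cos W\<close> and \<open>W\<close> with independent \<open>\<beta>\<close> and \<open>W\<close>.\<close>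

section \<open>The continuous logarithm of the determinant\<close>

text \<open>The modulus of the determinant identity is immediate, but its logarithms agree only
  modulo 2 pi i. Fixing the branch takes continuity, which a sum over eigenvalues does not visibly
  have as a function of the matrix; contractions give the unitary matrices room to move to 0. The
  dimension is part of the type, so the recursion runs over index sets: \<open>fixing S\<close> is a
  copy of the unitary group of size \<open>card S\<close>, and \<open>V ** coord_proj S\<close> is
  the corresponding block padded by zeros, whose extra eigenvalues 0 contribute
  \<open>Ln 1 = 0\<close>. The constants come from w = 2 t cos(phi) e^(i phi), where 1 - |1 - w|^2 =
  4 cos(phi)^2 t (1 - t). If \<open>card S = j - 1\<close> with j >= 2, the density of the entry is
  proportional to the power j - 2 of this quantity. The Jacobian 4 t cos(phi)^2 raises the exponents
  of t and cos(phi), which leaves cos(phi)^(2(j-1)) and the beta parameters j and j - 1. For j = 1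
  the entry lies on the unit circle and the beta factor degenerates to 1.\<close>

no_notation fps_nth (infixl "$" 75)

text \<open>Euclidean operator norm at most 1. Unitary matrices lie on the boundary of this set, and
  their truncations and the multiples \<open>t *\<^sub>R A\<close> with t in [0, 1] stay inside
  it.\<close>

definition contractive :: "complex^'n^'n \<Rightarrow> bool" where
  "contractive A \<longleftrightarrow> (\<forall>x. norm (A *v x) \<le> norm x)"

lemma norm_scaleR_vec_le: "0 \<le> t \<Longrightarrow> t \<le> 1 \<Longrightarrow> norm (t *\<^sub>R x) \<le> norm x"
  for x :: "'a :: real_normed_vector"
  by (simp add: mult_left_le_one_le)

lemma scaleR_matrix_vector_mult: "(t *\<^sub>R A) *v x = t *\<^sub>R (A *v x)"
  for A :: "complex^'n^'m"
  by (simp add: vec_eq_iff matrix_vector_mult_def scaleR_sum_right)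

lemma contractive_scaleR:
  assumes "contractive A" "0 \<le> t" "t \<le> 1"
  shows "contractive (t *\<^sub>R A)"
  using assms norm_scaleR_vec_le order_trans
  unfolding contractive_def scaleR_matrix_vector_mult by blast

lemma contractive_mult:
  "contractive A \<Longrightarrow> contractive B \<Longrightarrow> contractive (A ** B)"
  unfolding contractive_def matrix_vector_mul_assoc [symmetric] using order_trans by blast

lemma contractive_zero [simp]: "contractive 0"
  by (simp add: contractive_def)

lemma det_zero_imp_fixed:
  fixes A :: "complex^'n^'n"
  assumes "det (mat 1 - A) = 0"
  obtains x where "x \<noteq> 0" "A *v x = x"
proof -
  have "\<not> invertible (mat 1 - A)"
    using assms invertible_det_nz by blast
  then obtain x where "x \<noteq> 0" "(mat 1 - A) *v x = 0"
    by (auto simp: invertible_left_inverse matrix_left_invertible_ker)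
  then show thesis
    by (intro that [of x]) (auto simp: matrix_vector_mult_diff_rdistrib)
qed

text \<open>A nonzero vector fixed by \<open>t *\<^sub>R A\<close> would have norm at most t times
  its own norm.\<close>

lemma det_one_minus_scaled_nonzero:
  assumes "contractive A" "0 \<le> t" "t < 1"
  shows "det (mat 1 - t *\<^sub>R A) \<noteq> 0"
proof
  assume "det (mat 1 - t *\<^sub>R A) = 0"
  then obtain x where x: "x \<noteq> 0" "(t *\<^sub>R A) *v x = x"
    by (rule det_zero_imp_fixed)
  then have "norm x = t * norm (A *v x)"
    using assms by (metis abs_of_nonneg norm_scaleR scaleR_matrix_vector_mult)
  also have "\<dots> \<le> t * norm x"
    using assms by (auto simp: contractive_def intro: mult_left_mono)
  also have "\<dots> < norm x"
    using assms x by simp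
  finally show False by simp
qed

section \<open>Factorisation of the determinant over the eigenvalues\<close>

lemma continuous_on_det [continuous_intros]:
  fixes f :: "'a::topological_space \<Rightarrow> complex^'n^'n"
  assumes "continuous_on S f"
  shows "continuous_on S (\<lambda>x. det (f x))"
  unfolding det_def using assms by (intro continuous_intros)

lemma poly_det: "poly (det M) z = det (map_matrix (\<lambda>p. poly p z) M)"
  for M :: "complex poly^'n^'n"
  by (simp add: det_def poly_sum poly_prod map_matrix_def sign_def) 

lemma poly_char_polynomial: "poly (char_polynomial A) z = det (mat z - A)"
proof -
  have "map_matrix (\<lambda>p. poly p z) (mat [:0, 1:] - map_matrix (\<lambda>a. [:a:]) A) = mat z - A"
    by (simp add: vec_eq_iff mat_def map_matrix_def)
  then show ?thesis
    by (simp add: char_polynomial_def poly_det)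
qed

lemma det_scaleR: "det (c *\<^sub>R A) = of_real c ^ CARD('n) * det A" for A :: "complex^'n^'n"
proof -
  have "c *\<^sub>R A = (\<chi> i. (of_real c :: complex) *s (A $ i))"
    by (simp add: vec_eq_iff scaleR_conv_of_real [where 'a = complex])
  then show ?thesis
    by (simp add: det_rows_mul)
qed

lemma det_one_minus_eq_char_polynomial:
  fixes A :: "complex^'n^'n"
  assumes "t \<noteq> 0"
  shows "det (mat 1 - t *\<^sub>R A) = of_real t ^ CARD('n) * poly (char_polynomial A) (1 / of_real t)"
proof -
  have "mat 1 - t *\<^sub>R A = t *\<^sub>R (mat (1 / complex_of_real t) - A)"
    using assms by (simp add: vec_eq_iff mat_def scaleR_conv_of_real [where 'a = complex] field_simps)
  then show ?thesis
    by (simp add: det_scaleR poly_char_polynomial)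
qed

text \<open>Two logarithms of the same path differ by multiples of 2 pi i, whose distinct values are
  at least 2 pi apart, so on a connected interval the difference is constant. Every question about
  the branch is settled by this argument.\<close>

lemma exp_unique_path:
  fixes f g :: "real \<Rightarrow> complex"
  assumes f: "continuous_on {0..1} f" and g: "continuous_on {0..1} g"
    and eq: "\<And>x. x \<in> {0..1} \<Longrightarrow> exp (f x) = exp (g x)" and "f 0 = g 0"
  shows "f 1 = g 1"
proof -
  have "(\<lambda>x. f x - g x) constant_on {0..1}"
  proof (rule continuous_discrete_range_constant)
    show "continuous_on {0..1} (\<lambda>x. f x - g x)" "connected {0..1::real}"
      by (auto intro: continuous_intros f g)
    fix x :: real assume x: "x \<in> {0..1}"
    have "2 * pi \<le> norm ((f y - g y) - (f x - g x))"
      if y: "y \<in> {0..1}" and ne: "f y - g y \<noteq> f x - g x" for y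
    proof -
      obtain m :: int where m: "f y = g y + (of_int (2*m) * pi) * \<i>"
        using eq [OF y] unfolding exp_eq by blast
      moreover obtain n :: int where n: "f x = g x + (of_int (2*n) * pi) * \<i>"
        using eq [OF x] unfolding exp_eq by blast
      ultimately have "(f y - g y) - (f x - g x) = of_int (m - n) * (2 * pi * \<i>)" and "m \<noteq> n"
        using ne by (auto simp: algebra_simps)
      moreover have "1 \<le> \<bar>m - n\<bar>" using \<open>m \<noteq> n\<close> by linarith
      then have "1 \<le> \<bar>real_of_int (m - n)\<bar>" by linarith
      ultimately show ?thesis
        by (simp add: norm_mult del: of_int_diff)
    qed
    then show "\<exists>e>0. \<forall>y. y \<in> {0..1} \<and> f y - g y \<noteq> f x - g x \<longrightarrow> e \<le> norm ((f y - g y) - (f x - g x))"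
      by (intro exI [of _ "2 * pi"]) auto
  qed
  then show ?thesis
    using \<open>f 0 = g 0\<close> unfolding constant_on_def
    by (metis atLeastAtMost_iff eq_iff_diff_eq_0 order_refl zero_le_one)
qed

text \<open>The decomposition into roots leaves the degree and the leading coefficient of the
  characteristic polynomial open; hence the two different powers of t and the factor
  \<open>lead_coeff\<close>, which are determined afterwards from the behaviour at t = 0.\<close>

lemma scaled_char_polynomial_prod:
  fixes A :: "complex^'n^'n" and t :: real
  assumes "t \<noteq> 0"
  shows "of_real t ^ size (eigenvalues A) * det (mat 1 - t *\<^sub>R A) =
           lead_coeff (char_polynomial A) * of_real t ^ CARD('n) *
             (\<Prod>z\<in>#eigenvalues A. 1 - of_real t * z)"
proof -
  let ?p = "char_polynomial A"
  have "poly ?p z = lead_coeff ?p * (\<Prod>x\<in>#eigenvalues A. z - x)" for z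
    by (subst complex_poly_decompose_multiset [of ?p, symmetric])
       (simp add: eigenvalues_def poly_prod_mset image_mset.compositionality o_def)
  moreover have "of_real t ^ size M * (\<Prod>x\<in>#M. 1 / of_real t - x) = (\<Prod>z\<in>#M. 1 - of_real t * z)"
    for M :: "complex multiset"
    using assms by (induction M) (auto simp: field_simps)
  ultimately show ?thesis
    using assms by (simp add: det_one_minus_eq_char_polynomial mult_ac)
qed

text \<open>A comparison of orders at 0: since f and g tend to 1, a surplus of powers of t on the
  right would force f to tend to 0, and with equal powers the constant is the limit of f /
  g.\<close>

lemma power_mult_limits:
  fixes f g :: "real \<Rightarrow> complex"
  assumes f: "(f \<longlongrightarrow> 1) (at 0)" and g: "(g \<longlongrightarrow> 1) (at 0)"
    and eq: "\<forall>t. t \<noteq> 0 \<longrightarrow> of_real t ^ d * f t = c * of_real t ^ N * g t"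
  shows "N \<le> d" "d = N \<Longrightarrow> c = 1" "c \<noteq> 0"
proof -
  have cong: "l = m" if "(h1 \<longlongrightarrow> l) (at 0)" "(h2 \<longlongrightarrow> m) (at 0)" "\<And>t. t \<noteq> 0 \<Longrightarrow> h1 t = h2 t"
    for h1 h2 :: "real \<Rightarrow> complex" and l m
  proof (rule tendsto_unique [OF _ _ that(2)])
    show "(h2 \<longlongrightarrow> l) (at 0)"
      using that(1) by (rule Lim_transform_eventually) (simp add: eventually_at_filter that(3))
  qed simp
  show "N \<le> d"
  proof (rule ccontr)
    assume "\<not> N \<le> d"
    have "((\<lambda>t. c * of_real t ^ (N - d) * g t) \<longlongrightarrow> c * of_real 0 ^ (N - d) * 1) (at 0)"
      by (intro tendsto_intros g)
    moreover have "f t = c * of_real t ^ (N - d) * g t" if "t \<noteq> 0" for t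
    proof -
      have "of_real t ^ N = (of_real t ^ d * of_real t ^ (N - d) :: complex)"
        using \<open>\<not> N \<le> d\<close> by (simp flip: power_add)
      then show ?thesis
        using eq [rule_format, OF that] that by simp
    qed
    ultimately have "1 = c * of_real 0 ^ (N - d) * 1"
      using cong [OF f] by blast
    with \<open>\<not> N \<le> d\<close> show False by (simp add: zero_power)
  qed
  show "c = 1" if "d = N"
  proof -
    have "((\<lambda>t. c * g t) \<longlongrightarrow> c * 1) (at 0)"
      by (intro tendsto_intros g)
    from cong [OF f this] eq that show ?thesis by simp
  qed
  show "c \<noteq> 0"
    using cong [OF f tendsto_const [of 0]] eq by fastforce
qed

text \<open>Both sides tend to 1 as t goes to 0. This shows that the characteristic polynomial is
  monic of degree \<open>CARD('n)\<close> without an expansion of the determinant.\<close>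

lemma det_one_minus_scaleR:
  fixes A :: "complex^'n^'n" and t :: real
  shows "det (mat 1 - t *\<^sub>R A) = (\<Prod>z\<in>#eigenvalues A. 1 - of_real t * z)"
proof -
  define f where "f t = det (mat 1 - t *\<^sub>R A)" for t :: real
  define g where "g t = (\<Prod>z\<in>#eigenvalues A. 1 - complex_of_real t * z)" for t :: real
  define c where "c = lead_coeff (char_polynomial A)"
  let ?d = "size (eigenvalues A)" and ?N = "CARD('n)"
  have eq: "\<forall>t. t \<noteq> 0 \<longrightarrow> of_real t ^ ?d * f t = c * of_real t ^ ?N * g t"
    using scaled_char_polynomial_prod [of _ A] by (simp add: f_def g_def c_def)
  have "isCont f 0"
    unfolding f_def using continuous_on_det [of UNIV "\<lambda>t. mat 1 - t *\<^sub>R A"]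
    by (auto simp: continuous_on_eq_continuous_at intro!: continuous_intros)
  then have f: "(f \<longlongrightarrow> 1) (at 0)"
    by (simp add: isCont_def f_def)
  have "((\<lambda>t. \<Prod>z\<in>#M. 1 - complex_of_real t * z) \<longlongrightarrow> 1) (at 0)" for M
  proof (induction M)
    case (add z M)
    have "((\<lambda>t. 1 - complex_of_real t * z) \<longlongrightarrow> 1 - of_real 0 * z) (at 0)"
      by (intro tendsto_intros)
    from tendsto_mult [OF this add.IH] show ?case by simp
  qed simp
  then have g: "(g \<longlongrightarrow> 1) (at 0)" by (simp add: g_def [abs_def])
  note lim = power_mult_limits [OF f g eq]
  \<comment> \<open>The same identity with \<open>f\<close> and \<open>g\<close> exchanged; it gives
    the opposite inequality between the two exponents.\<close>
  have "\<forall>t. t \<noteq> 0 \<longrightarrow> of_real t ^ ?N * g t = 1 / c * of_real t ^ ?d * f t"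
    using eq lim(3) by (simp add: field_simps)
  from power_mult_limits(1) [OF g f this] lim(1) have "?d = ?N" by simp
  then have "c = 1" by (rule lim(2))
  have "f t = g t"
    using eq \<open>?d = ?N\<close> \<open>c = 1\<close> by (cases "t = 0") (simp_all add: f_def g_def)
  then show ?thesis by (simp add: f_def g_def)
qed

lemma eigenvalue_norm_le_1:
  assumes "contractive A" "z \<in># eigenvalues A"
  shows "cmod z \<le> 1"
proof -
  have "det (mat z - A) = 0"
    using assms(2) unfolding eigenvalues_def poly_char_polynomial [symmetric]
    by (cases "char_polynomial A = 0") auto
  then have "\<not> invertible (mat z - A)"
    using invertible_det_nz by blast
  then obtain x where x: "x \<noteq> 0" "(mat z - A) *v x = 0"
    by (auto simp: invertible_left_inverse matrix_left_invertible_ker)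
  have "mat z *v x = z *s x"
    by (simp add: vec_eq_iff matrix_vector_mult_def mat_def if_distrib [of "\<lambda>a. a * _"] cong: if_cong)
  with x have "A *v x = z *s x"
    by (simp add: matrix_vector_mult_diff_rdistrib)
  moreover have "norm (z *s x) = cmod z * norm x"
    by (simp add: norm_vec_def L2_set_def norm_mult power_mult_distrib real_sqrt_mult
        sum_distrib_left [symmetric])
  ultimately have "cmod z * norm x \<le> norm x"
    using assms(1) unfolding contractive_def by metis
  then show ?thesis using x by simp
qed

section \<open>The branch as a continuous function on nonsingular contractions\<close>

definition log_domain :: "(complex^'n^'n) set" where
  "log_domain = {A. contractive A \<and> det (mat 1 - A) \<noteq> 0}"

lemma log_domainD:
  assumes "A \<in> log_domain"
  shows "contractive A" "det (mat 1 - A) \<noteq> 0"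
  using assms by (auto simp: log_domain_def)

lemma scaleR_log_domain:
  assumes "contractive A" "0 \<le> t" "t < 1"
  shows "t *\<^sub>R A \<in> log_domain"
  using assms det_one_minus_scaled_nonzero [OF assms] contractive_scaleR [of A t]
  by (simp add: log_domain_def)

lemma scaleR_log_domain':
  assumes "A \<in> log_domain" "0 \<le> t" "t \<le> 1"
  shows "t *\<^sub>R A \<in> log_domain"
proof (cases "t = 1")
  case False
  then show ?thesis
    using assms by (intro scaleR_log_domain) (auto simp: log_domain_def)
qed (use assms in auto)

lemma contractible_log_domain:
  "contractible (log_domain :: (complex^'n^'n) set)"
proof (rule starlike_imp_contractible)
  have "closed_segment 0 A \<subseteq> log_domain" if "A \<in> log_domain"
    for A :: "complex^'n^'n"
    using scaleR_log_domain' [OF that] by (auto simp: closed_segment_def)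
  moreover have "(0 :: complex^'n^'n) \<in> log_domain"
    by (simp add: log_domain_def)
  ultimately show "starlike (log_domain :: (complex^'n^'n) set)"
    unfolding starlike_def by blast
qed

lemma Re_one_minus_pos:
  assumes "cmod w \<le> 1" "w \<noteq> 1"
  shows "0 < Re (1 - w)"
proof (rule ccontr)
  assume "\<not> 0 < Re (1 - w)"
  then have "Re w \<ge> 1" by simp
  moreover have "Re w \<le> cmod w" by (rule complex_Re_le_cmod)
  ultimately have "Re w = 1" "cmod w = 1" using assms by auto
  then have "Im w = 0" by (simp add: cmod_def)
  with \<open>Re w = 1\<close> assms show False by (simp add: complex_eq_iff)
qed

lemma Re_one_minus_scaled_pos:
  assumes "cmod z \<le> 1" "0 \<le> t" "t \<le> 1" "t = 1 \<Longrightarrow> z \<noteq> 1"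
  shows "0 < Re (1 - complex_of_real t * z)"
proof (rule Re_one_minus_pos)
  show "cmod (of_real t * z) \<le> 1"
    using assms by (simp add: norm_mult mult_le_one)
  have "cmod (of_real t * z) < 1" if "t < 1"
  proof -
    have "t * cmod z \<le> t * 1" using assms by (intro mult_left_mono) auto
    with that assms show ?thesis by (simp add: norm_mult)
  qed
  then show "of_real t * z \<noteq> 1"
    using assms by fastforce
qed

text \<open>The candidate for the branch at \<open>t *\<^sub>R A\<close>, written with the
  eigenvalues of \<open>A\<close> itself, so that continuity in t does not involve the motion of
  eigenvalues.\<close>

definition radial_log :: "complex^'n^'n \<Rightarrow> real \<Rightarrow> complex" where
  "radial_log A t = (\<Sum>z\<in>#eigenvalues A. Ln (1 - of_real t * z))"

lemma radial_log_0 [simp]: "radial_log A 0 = 0"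
  by (simp add: radial_log_def)

lemma radial_log_1: "radial_log A 1 = log_det_one_minus A"
  by (simp add: radial_log_def log_det_one_minus_def)

lemma not_in_eigenvalues_1:
  assumes "det (mat 1 - A) \<noteq> 0"
  shows "1 \<notin># eigenvalues A"
  using assms det_one_minus_scaleR [of 1 A] by (auto simp: prod_mset_zero_iff)

lemma exp_radial_log:
  assumes "det (mat 1 - t *\<^sub>R A) \<noteq> 0"
  shows "exp (radial_log A t) = det (mat 1 - t *\<^sub>R A)"
proof -
  have "exp (\<Sum>z\<in>#M. Ln (1 - of_real t * z)) = (\<Prod>z\<in>#M. 1 - of_real t * z)"
    if "0 \<notin># image_mset (\<lambda>z. 1 - of_real t * z) M" for M
    using that by (induction M) (auto simp: exp_add)
  moreover have "0 \<notin># image_mset (\<lambda>z. 1 - of_real t * z) (eigenvalues A)"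
    using assms unfolding det_one_minus_scaleR prod_mset_zero_iff .
  ultimately show ?thesis
    by (simp add: det_one_minus_scaleR radial_log_def)
qed

lemma continuous_on_sum_mset:
  fixes f :: "'b \<Rightarrow> 'a::topological_space \<Rightarrow> complex"
  assumes "\<And>z. z \<in># M \<Longrightarrow> continuous_on T (f z)"
  shows "continuous_on T (\<lambda>t. \<Sum>z\<in>#M. f z t)"
  using assms by (induction M) (auto intro!: continuous_intros)

text \<open>The numbers \<open>1 - t * z\<close> stay in the open right half plane, away from the
  cut of \<open>Ln\<close>; the only dangerous case is t = 1 together with an eigenvalue 1.\<close>

lemma continuous_on_radial_log:
  assumes "contractive A" "T \<subseteq> {0..1}" "1 \<in> T \<Longrightarrow> 1 \<notin># eigenvalues A"
  shows "continuous_on T (radial_log A)"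
proof -
  have "1 - complex_of_real t * z \<notin> \<real>\<^sub>\<le>\<^sub>0" if "z \<in># eigenvalues A" "t \<in> T" for z t
    using Re_one_minus_scaled_pos [of z t] eigenvalue_norm_le_1 [OF assms(1) that(1)] that assms(2,3)
    by (force simp: complex_nonpos_Reals_iff)
  then show ?thesis
    unfolding radial_log_def by (intro continuous_on_sum_mset continuous_intros) auto
qed

text \<open>Continuity is obtained indirectly: contractibility provides some continuous logarithm
  \<open>m\<close> of the determinant, and along each ray \<open>m\<close> and
  \<open>radial_log\<close> are continuous logarithms of the same path that start at 0. At t = 1
  this identifies \<open>m\<close> with \<open>log_det_one_minus\<close>; for t < 1 it then
  evaluates \<open>log_det_one_minus\<close> on multiples of \<open>A\<close>.\<close>

lemma log_det_one_minus_facts: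
  "continuous_on log_domain (log_det_one_minus :: complex^'n^'n \<Rightarrow> complex)"
  "\<And>A t. contractive A \<Longrightarrow> 0 \<le> t \<Longrightarrow> t < 1 \<Longrightarrow>
     log_det_one_minus (t *\<^sub>R A :: complex^'n^'n) = radial_log A t"
proof -
  let ?C = "log_domain :: (complex^'n^'n) set"
  obtain l where l: "continuous_on ?C l" "\<And>A. A \<in> ?C \<Longrightarrow> det (mat 1 - A) = exp (l A)"
    by (rule continuous_logarithm_on_contractible
          [OF _ contractible_log_domain, of "\<lambda>A. det (mat 1 - A)"])
       (auto intro!: continuous_intros dest: log_domainD)
  \<comment> \<open>The logarithm \<open>l\<close> is determined only up to a multiple of 2 pi i;
    subtracting \<open>l 0\<close> selects the one that vanishes at 0.\<close>
  define m where "m A = l A - l 0" for A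
  have "(0 :: complex^'n^'n) \<in> ?C"
    by (simp add: log_domain_def)
  then have "exp (l 0) = 1"
    using l(2) [of 0] by simp
  then have m: "continuous_on ?C m" "\<And>A. A \<in> ?C \<Longrightarrow> exp (m A) = det (mat 1 - A)" "m 0 = 0"
    using l by (auto simp: m_def [abs_def] exp_diff intro!: continuous_intros)
  have radial: "m (t *\<^sub>R A) = radial_log A t"
    if A: "contractive A" "0 \<le> t" "t \<le> 1" "t *\<^sub>R A \<in> ?C" for A :: "complex^'n^'n" and t
  proof -
    have in_C: "(s * t) *\<^sub>R A \<in> ?C" if "s \<in> {0..1}" for s
      using scaleR_log_domain' [OF A(4), of s] that by simp
    have "m ((1 * t) *\<^sub>R A) = radial_log A (1 * t)"
    proof (rule exp_unique_path [of "\<lambda>s. m ((s * t) *\<^sub>R A)" "\<lambda>s. radial_log A (s * t)"])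
      show "continuous_on {0..1} (\<lambda>s. m ((s * t) *\<^sub>R A))"
        by (rule continuous_on_compose2 [OF m(1)]) (use in_C in \<open>auto intro!: continuous_intros\<close>)
      have "1 \<notin># eigenvalues A" if "t = 1"
        using not_in_eigenvalues_1 that A(4) by (auto simp: log_domain_def)
      then have "continuous_on {0..t} (radial_log A)"
        using A by (intro continuous_on_radial_log) auto
      then show "continuous_on {0..1} (\<lambda>s. radial_log A (s * t))"
        by (rule continuous_on_compose2)
           (use A in \<open>auto intro!: continuous_intros simp: mult_left_le_one_le\<close>)
      show "exp (m ((s * t) *\<^sub>R A)) = exp (radial_log A (s * t))" if "s \<in> {0..1}" for s
        using in_C [OF that] by (simp add: m exp_radial_log log_domain_def)
    qed (simp add: m)
    then show ?thesis by simp
  qed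
  have "m A = log_det_one_minus A" if "A \<in> ?C" for A
    using radial [of A 1] that by (simp add: radial_log_1 log_domainD)
  then show "continuous_on ?C log_det_one_minus"
    using m(1) by (simp cong: continuous_on_cong)
  show "log_det_one_minus (t *\<^sub>R A) = radial_log A t"
    if "contractive A" "0 \<le> t" "t < 1" for A :: "complex^'n^'n" and t
    using radial [of A t] scaleR_log_domain [OF that] that
      \<open>\<And>A. A \<in> ?C \<Longrightarrow> m A = log_det_one_minus A\<close> by simp
qed

lemmas continuous_on_log_det_one_minus = log_det_one_minus_facts(1)
lemmas log_det_one_minus_scaleR = log_det_one_minus_facts(2)

lemma exp_log_det_one_minus:
  assumes "A \<in> log_domain"
  shows "exp (log_det_one_minus A) = det (mat 1 - A)"
  using exp_radial_log [of 1 A] log_domainD [OF assms] by (simp add: radial_log_1)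

lemma log_det_one_minus_0 [simp]: "log_det_one_minus 0 = 0"
  using log_det_one_minus_scaleR [of 0 0] by simp

section \<open>Measurability of the logarithm on all contractions\<close>

text \<open>The shift by 2 keeps \<open>1 - radius j\<close> strictly below 1, so that
  \<open>ln (1 - radius j)\<close> is never 0 and can serve as a divisor.\<close>

definition radius :: "nat \<Rightarrow> real" where
  "radius j = 1 - 1 / real (j + 2)"

lemma radius: "0 \<le> radius j" "radius j < 1"
  by (auto simp: radius_def field_simps)

lemma radius_lim: "radius \<longlonglongrightarrow> 1"
  unfolding radius_def by real_asymp

lemma tendsto_sum_mset:
  fixes f :: "'b \<Rightarrow> 'a \<Rightarrow> 'c::real_normed_vector"
  assumes "\<And>z. z \<in># M \<Longrightarrow> ((f z) \<longlongrightarrow> g z) F"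
  shows "((\<lambda>t. \<Sum>z\<in>#M. f z t) \<longlongrightarrow> (\<Sum>z\<in>#M. g z)) F"
  using assms by (induction M) (auto intro!: tendsto_intros)

lemma Im_sum_mset: "Im (\<Sum>z\<in>#M. f z) = (\<Sum>z\<in>#M. Im (f z))"
  by (induction M) auto

lemma sum_mset_indicator: "(\<Sum>z\<in>#M. if z = a then c else 0) = real (count M a) * c"
  by (induction M) (auto simp: algebra_simps)

text \<open>Every eigenvalue 1 contributes exactly \<open>ln (1 - radius j)\<close> to the logarithm
  of the modulus; every other eigenvalue contributes a convergent term, which the division makes
  vanish. The multiplicity of 1 is thus a limit of continuous functions of the matrix.\<close>

lemma multiplicity_limit:
  assumes A: "contractive A"
  shows "(\<lambda>j. ln (cmod (det (mat 1 - radius j *\<^sub>R A))) / ln (1 - radius j))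
           \<longlonglongrightarrow> real (count (eigenvalues A) 1)"
proof -
  have "ln (cmod (\<Prod>z\<in>#M. 1 - of_real t * z)) = (\<Sum>z\<in>#M. ln (cmod (1 - of_real t * z)))"
    if "\<And>z. z \<in># M \<Longrightarrow> 1 - of_real t * z \<noteq> 0" for M t
    using that
  proof (induction M)
    case (add x M)
    then have "(\<Prod>z\<in>#M. 1 - of_real t * z) \<noteq> 0"
      by (auto simp: prod_mset_zero_iff)
    with add show ?case by (simp add: norm_mult ln_mult)
  qed simp
  moreover have "1 - of_real (radius j) * z \<noteq> 0" if "z \<in># eigenvalues A" for j z
    using Re_one_minus_scaled_pos [of z "radius j"] eigenvalue_norm_le_1 [OF A that] radius [of j]
    by force
  ultimately have eq: "ln (cmod (det (mat 1 - radius j *\<^sub>R A))) / ln (1 - radius j) =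
      (\<Sum>z\<in>#eigenvalues A. ln (cmod (1 - of_real (radius j) * z)) / ln (1 - radius j))" for j
    by (simp add: det_one_minus_scaleR sum_mset_distrib_left sum_mset_distrib_right divide_inverse)
  have "(\<lambda>j. ln (cmod (1 - of_real (radius j) * z)) / ln (1 - radius j)) \<longlonglongrightarrow>
          (if z = 1 then 1 else 0)" for z
  proof (cases "z = 1")
    case True
    have e: "ln (cmod (1 - of_real (radius j) * z)) / ln (1 - radius j) = 1" for j
    proof -
      have "cmod (1 - of_real (radius j) * z) = 1 - radius j"
        using radius [of j] True by (metis abs_of_pos diff_gt_0_iff_gt mult.right_neutral
            norm_of_real of_real_1 of_real_diff)
      moreover have "ln (1 - radius j) \<noteq> 0"
        by (simp add: radius_def)
      ultimately show ?thesis by simp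
    qed
    show ?thesis unfolding e using True by simp
  next
    case False
    have "(\<lambda>j. ln (cmod (1 - of_real (radius j) * z))) \<longlonglongrightarrow> ln (cmod (1 - of_real 1 * z))"
      using False by (intro tendsto_intros radius_lim) auto
    moreover have "filterlim (\<lambda>j. ln (1 - radius j)) at_bot sequentially"
      unfolding radius_def by real_asymp
    ultimately have "(\<lambda>j. ln (cmod (1 - of_real (radius j) * z)) / ln (1 - radius j)) \<longlonglongrightarrow> 0"
      by (metis filterlim_at_bot_imp_at_infinity tendsto_divide_0)
    with False show ?thesis by simp
  qed
  then have "(\<lambda>j. \<Sum>z\<in>#eigenvalues A. ln (cmod (1 - of_real (radius j) * z)) / ln (1 - radius j))
      \<longlonglongrightarrow> (\<Sum>z\<in>#eigenvalues A. if z = 1 then 1 else 0)"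
    by (intro tendsto_sum_mset)
  then show ?thesis
    unfolding eq sum_mset_indicator by simp
qed

text \<open>The library leaves \<open>Ln 0\<close> unspecified, so every eigenvalue \<open>1\<close> contributes an
  unknown constant; measurability therefore needs the multiplicity of this eigenvalue.\<close>

lemma Im_log_det_limit:
  assumes A: "contractive A"
  shows "(\<lambda>j. Im (log_det_one_minus (radius j *\<^sub>R A))) \<longlonglongrightarrow>
           Im (log_det_one_minus A) - real (count (eigenvalues A) 1) * Im (Ln 0)"
proof -
  have "(\<lambda>j. Im (Ln (1 - of_real (radius j) * z))) \<longlonglongrightarrow>
          Im (Ln (1 - z)) - (if z = 1 then Im (Ln 0) else 0)" if z: "z \<in># eigenvalues A" for z
  proof (cases "z = 1")
    case True
    \<comment> \<open>Here \<open>1 - radius j\<close> is a positive real number, so the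
      approximants have argument 0 whatever \<open>Ln 0\<close> is.\<close>
    have "Im (Ln (1 - of_real (radius j) * z)) = 0" for j
      using radius [of j] Im_Ln_of_real [of "1 - radius j"] True by simp
    with True show ?thesis by simp
  next
    case False
    then have "1 - of_real 1 * z \<notin> \<real>\<^sub>\<le>\<^sub>0"
      using Re_one_minus_pos [OF eigenvalue_norm_le_1 [OF A z]]
      by (auto simp: complex_nonpos_Reals_iff)
    then have "(\<lambda>j. Im (Ln (1 - of_real (radius j) * z))) \<longlonglongrightarrow> Im (Ln (1 - of_real 1 * z))"
      by (intro tendsto_intros radius_lim) auto
    with False show ?thesis by simp
  qed
  then have "(\<lambda>j. \<Sum>z\<in>#eigenvalues A. Im (Ln (1 - of_real (radius j) * z))) \<longlonglongrightarrow>
      (\<Sum>z\<in>#eigenvalues A. Im (Ln (1 - z)) - (if z = 1 then Im (Ln 0) else 0))"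
    by (rule tendsto_sum_mset)
  also have "(\<Sum>z\<in>#eigenvalues A. Im (Ln (1 - z)) - (if z = 1 then Im (Ln 0) else 0)) =
      Im (log_det_one_minus A) - real (count (eigenvalues A) 1) * Im (Ln 0)"
  proof -
    have "(\<Sum>z\<in>#M. f z - g z) = (\<Sum>z\<in>#M. f z) - (\<Sum>z\<in>#M. g z)" for M :: "complex multiset" and f g :: "complex \<Rightarrow> real"
      by (induction M) auto
    then show ?thesis
      by (simp add: log_det_one_minus_def Im_sum_mset sum_mset_indicator)
  qed
  finally show ?thesis
    using radius by (simp add: log_det_one_minus_scaleR [OF A] radial_log_def Im_sum_mset)
qed

lemma closed_contractive: "closed {A :: complex^'n^'n. contractive A}"
proof -
  have "{A :: complex^'n^'n. contractive A} = (\<Inter>x. {A. norm (A *v x) \<le> norm x})"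
    by (auto simp: contractive_def)
  also have "closed \<dots>"
    by (intro closed_INT ballI closed_Collect_le continuous_intros)
       (auto simp: matrix_vector_mult_def intro!: continuous_intros)
  finally show ?thesis .
qed

lemma continuous_on_scaled_log_det:
  assumes "0 \<le> t" "t < 1"
  shows "continuous_on {A :: complex^'n^'n. contractive A} (\<lambda>A. log_det_one_minus (t *\<^sub>R A))"
  by (rule continuous_on_compose2 [OF continuous_on_log_det_one_minus])
     (use assms scaleR_log_domain in \<open>auto intro!: continuous_intros\<close>)

text \<open>The corrected argument and the multiplicity of the eigenvalue 1 are both pointwise
  limits of continuous functions; the value \<open>Ln 0\<close> enters only through a constant
  factor.\<close>

lemma borel_measurable_Im_log_det:
  "(\<lambda>A. Im (log_det_one_minus A)) \<in>
     borel_measurable (restrict_space borel {A :: complex^'n^'n. contractive A})"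
proof -
  let ?M = "restrict_space borel {A :: complex^'n^'n. contractive A}"
  have cont: "f \<in> borel_measurable ?M" if "continuous_on {A. contractive A} f"
    for f :: "complex^'n^'n \<Rightarrow> real"
    using that by (rule borel_measurable_continuous_on_restrict)
  have mult: "(\<lambda>A. real (count (eigenvalues A) 1)) \<in> borel_measurable ?M"
  proof (rule borel_measurable_LIMSEQ_real)
    show "(\<lambda>j. ln (cmod (det (mat 1 - radius j *\<^sub>R A))) / ln (1 - radius j))
            \<longlonglongrightarrow> real (count (eigenvalues A) 1)" if "A \<in> space ?M" for A
      using that by (intro multiplicity_limit) (auto simp: space_restrict_space)
    show "(\<lambda>A. ln (cmod (det (mat 1 - radius j *\<^sub>R A))) / ln (1 - radius j)) \<in> borel_measurable ?M" for j
    proof -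
      have "ln (1 - radius j) \<noteq> 0"
        by (simp add: radius_def)
      then show ?thesis
        using det_one_minus_scaled_nonzero [OF _ radius [of j]]
        by (intro cont continuous_intros) auto
    qed
  qed
  have "(\<lambda>A. Im (log_det_one_minus A) - real (count (eigenvalues A) 1) * Im (Ln 0)) \<in> borel_measurable ?M"
  proof (rule borel_measurable_LIMSEQ_real)
    show "(\<lambda>j. Im (log_det_one_minus (radius j *\<^sub>R A))) \<longlonglongrightarrow>
             Im (log_det_one_minus A) - real (count (eigenvalues A) 1) * Im (Ln 0)"
      if "A \<in> space ?M" for A
      using that by (intro Im_log_det_limit) (auto simp: space_restrict_space)
    show "(\<lambda>A. Im (log_det_one_minus (radius j *\<^sub>R A))) \<in> borel_measurable ?M" for j
      by (intro cont continuous_intros continuous_on_scaled_log_det radius)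
  qed
  from borel_measurable_add [OF this borel_measurable_times [OF mult borel_measurable_const, of "Im (Ln 0)"]]
  show ?thesis by simp
qed

section \<open>Reflections\<close>

text \<open>A complex Householder matrix, built from u = \<open>axis k 1 - v\<close>. The divisor
  \<open>cnj (1 - v $ k)\<close> is what makes \<open>axis k 1\<close> go to \<open>v\<close>. For
  \<open>v $ k = 1\<close> division by zero leaves the identity, as it should for a unit vector,
  because then \<open>v = axis k 1\<close>.\<close>

definition reflector :: "'n \<Rightarrow> complex^'n \<Rightarrow> complex^'n^'n" where
  "reflector k v = (\<chi> i j. (if i = j then 1 else 0) -
     (axis k 1 - v) $ i * cnj ((axis k 1 - v) $ j) / cnj (1 - v $ k))"

text \<open>Meant for \<open>X\<close> with \<open>vanishes_at k X\<close>: a block padded by zeros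
  at k becomes the same block padded by a fixed basis vector.\<close>

definition block_extend :: "'n \<Rightarrow> complex^'n^'n \<Rightarrow> complex^'n^'n" where
  "block_extend k X = (\<chi> i j. if i = k \<and> j = k then 1 else X $ i $ j)"

definition vanishes_at :: "'n \<Rightarrow> complex^'n^'n \<Rightarrow> bool" where
  "vanishes_at k X \<longleftrightarrow> (\<forall>i. X $ i $ k = 0 \<and> X $ k $ i = 0)"

lemma power2_norm_vec: "(norm x)\<^sup>2 = (\<Sum>i\<in>UNIV. (cmod (x $ i))\<^sup>2)" for x :: "complex^'n"
  by (simp add: norm_vec_def L2_set_def sum_nonneg)

lemma of_real_power2_norm: "complex_of_real ((norm x)\<^sup>2) = (\<Sum>i\<in>UNIV. x $ i * cnj (x $ i))"
  for x :: "complex^'n"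
  by (simp only: power2_norm_vec of_real_sum complex_norm_square)

lemma unitary_norm:
  assumes "A \<in> unitary_group"
  shows "norm (A *v x) = norm x"
proof -
  have A: "(\<Sum>i\<in>UNIV. cnj (A $ i $ j) * A $ i $ l) = (if j = l then 1 else 0)" for j l
  proof -
    have "(conj_transpose A ** A) $ j $ l = mat 1 $ j $ l"
      using assms by (simp add: unitary_group_def)
    then show ?thesis
      by (simp add: matrix_matrix_mult_def conj_transpose_def map_matrix_def transpose_def mat_def)
  qed
  have "complex_of_real ((norm (A *v x))\<^sup>2) =
      (\<Sum>i\<in>UNIV. (\<Sum>l\<in>UNIV. A $ i $ l * x $ l) * (\<Sum>j\<in>UNIV. cnj (A $ i $ j) * cnj (x $ j)))"
    unfolding of_real_power2_norm by (simp add: matrix_vector_mult_def)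
  also have "\<dots> = (\<Sum>i\<in>UNIV. \<Sum>l\<in>UNIV. \<Sum>j\<in>UNIV. (cnj (A $ i $ j) * A $ i $ l) * (x $ l * cnj (x $ j)))"
    by (simp add: sum_product mult_ac)
  also have "\<dots> = (\<Sum>l\<in>UNIV. \<Sum>i\<in>UNIV. \<Sum>j\<in>UNIV. (cnj (A $ i $ j) * A $ i $ l) * (x $ l * cnj (x $ j)))"
    by (rule sum.swap)
  also have "\<dots> = (\<Sum>l\<in>UNIV. \<Sum>j\<in>UNIV. \<Sum>i\<in>UNIV. (cnj (A $ i $ j) * A $ i $ l) * (x $ l * cnj (x $ j)))"
    by (rule sum.cong [OF refl], rule sum.swap)
  also have "\<dots> = (\<Sum>l\<in>UNIV. \<Sum>j\<in>UNIV. (if j = l then 1 else 0) * (x $ l * cnj (x $ j)))"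
    by (simp only: A flip: sum_distrib_right)
  also have "\<dots> = complex_of_real ((norm x)\<^sup>2)"
    unfolding of_real_power2_norm by (simp add: if_distrib [of "\<lambda>a. a * _"] cong: if_cong)
  finally show ?thesis
    by (metis of_real_eq_iff norm_ge_zero power2_eq_iff_nonneg)
qed

lemma unitary_contractive: "A \<in> unitary_group \<Longrightarrow> contractive A"
  by (simp add: contractive_def unitary_norm)

lemma unit_vector_eq_axis:
  fixes v :: "complex^'n"
  assumes "norm v = 1" "v $ k = 1"
  shows "v = axis k 1"
proof -
  have "(\<Sum>i\<in>UNIV. (cmod (v $ i))\<^sup>2) = 1"
    using assms(1) power2_norm_vec [of v] by simp
  then have "(\<Sum>i\<in>UNIV - {k}. (cmod (v $ i))\<^sup>2) = 0"
    using assms(2) by (simp add: sum.remove [of UNIV k])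
  then have "v $ i = 0" if "i \<noteq> k" for i
    using that by (subst (asm) sum_nonneg_eq_0_iff) auto
  then show ?thesis
    using assms(2) by (simp add: vec_eq_iff axis_def)
qed

lemma sum_if_eq: "(\<Sum>i\<in>UNIV. (if i = k then 1 else 0) * f i) = (f k :: complex)"
  "(\<Sum>i\<in>UNIV. (if k = i then 1 else 0) * f i) = (f k :: complex)" for k :: "'n::finite"
  by (simp_all add: if_distrib [of "\<lambda>a. a * _"] cong: if_cong)

text \<open>For c = 1 / \<open>cnj (u $ k)\<close>, multiplying \<open>1 - c u u^H\<close> by its
  adjoint leaves 1 minus (c + cnj c - |c|^2 |u|^2) times u u^H. The bracket vanishes because a unit
  vector \<open>v\<close> gives |u|^2 = 2 Re (1 - v_k) = u_k + cnj u_k.\<close>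

lemma reflector_unitary:
  fixes v :: "complex^'n"
  assumes v: "norm v = 1"
  shows "reflector k v \<in> unitary_group"
proof (cases "v $ k = 1")
  case True
  then have "reflector k v = mat 1"
    by (simp add: vec_eq_iff reflector_def mat_def)
  then show ?thesis
    by (simp add: unitary_group_def conj_transpose_def map_matrix_def transpose_mat)
       (simp add: vec_eq_iff mat_def)
next
  case False
  define u where "u = axis k 1 - v"
  define c where "c = 1 / cnj (1 - v $ k)"
  have c: "c * cnj (u $ k) = 1" "cnj c * u $ k = 1"
    using False by (auto simp: c_def u_def axis_def complex_eq_iff)
  have "(\<Sum>i\<in>UNIV. u $ i * cnj (u $ i)) = u $ k + cnj (u $ k)"
  proof -
    have "(\<Sum>i\<in>UNIV. u $ i * cnj (u $ i)) =
       (\<Sum>i\<in>UNIV. (if i = k then 1 else 0) * (1 - v $ i - cnj (v $ i)) + v $ i * cnj (v $ i))"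
      by (intro sum.cong) (auto simp: u_def axis_def algebra_simps)
    also have "\<dots> = 1 - v $ k - cnj (v $ k) + 1"
      using of_real_power2_norm [of v] v by (simp add: sum.distrib sum_if_eq)
    finally show ?thesis by (simp add: u_def axis_def)
  qed
  then have "c * cnj c * (\<Sum>i\<in>UNIV. u $ i * cnj (u $ i)) =
      (cnj c * u $ k) * c + (c * cnj (u $ k)) * cnj c"
    by (simp add: algebra_simps)
  then have norm_u: "c * cnj c * (\<Sum>i\<in>UNIV. u $ i * cnj (u $ i)) = c + cnj c"
    by (simp add: c)
  have R: "reflector k v $ i $ j = (if i = j then 1 else 0) - c * u $ i * cnj (u $ j)" for i j
    by (simp add: reflector_def u_def c_def)
  have "(conj_transpose (reflector k v) ** reflector k v) $ i $ j = mat 1 $ i $ j" for i j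
  proof -
    have "(conj_transpose (reflector k v) ** reflector k v) $ i $ j =
      (\<Sum>l\<in>UNIV. ((if l = i then 1 else 0) - cnj c * cnj (u $ l) * u $ i) *
                  ((if l = j then 1 else 0) - c * u $ l * cnj (u $ j)))"
      unfolding matrix_matrix_mult_def conj_transpose_def map_matrix_def transpose_def
      by (simp add: R) (intro sum.cong, auto)
    also have "\<dots> = (\<Sum>l\<in>UNIV. (if l = i then 1 else 0) * (if l = j then 1 else 0)
          - (if l = i then 1 else 0) * (c * u $ l * cnj (u $ j))
          - (if l = j then 1 else 0) * (cnj c * cnj (u $ l) * u $ i)
          + (u $ l * cnj (u $ l)) * (c * cnj c * u $ i * cnj (u $ j)))"
      by (intro sum.cong) (auto simp: algebra_simps)
    also have "\<dots> = (if i = j then 1 else 0) - c * u $ i * cnj (u $ j) - cnj c * cnj (u $ j) * u $ i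
        + (\<Sum>l\<in>UNIV. u $ l * cnj (u $ l)) * (c * cnj c * u $ i * cnj (u $ j))"
      by (simp add: sum.distrib sum_subtractf sum_if_eq sum_distrib_right)
    also have "(\<Sum>l\<in>UNIV. u $ l * cnj (u $ l)) * (c * cnj c * u $ i * cnj (u $ j)) =
        (c + cnj c) * (u $ i * cnj (u $ j))"
      by (subst norm_u [symmetric]) (simp add: mult_ac)
    finally show ?thesis by (simp add: mat_def algebra_simps)
  qed
  then have "conj_transpose (reflector k v) ** reflector k v = mat 1"
    by (simp add: vec_eq_iff)
  then show ?thesis
    unfolding unitary_group_def using matrix_left_right_inverse by blast
qed

lemma matrix_vector_mult_axis: "(A *v axis k 1) $ i = A $ i $ k" for A :: "complex^'n^'m"
  by (simp add: matrix_vector_mult_def axis_def if_distrib [of "\<lambda>a. _ * a"] cong: if_cong)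

lemma reflector_axis:
  fixes v :: "complex^'n"
  assumes v: "norm v = 1"
  shows "reflector k v *v axis k 1 = v"
proof (cases "v $ k = 1")
  case True
  then have "reflector k v = mat 1"
    by (simp add: vec_eq_iff reflector_def mat_def)
  then show ?thesis
    using unit_vector_eq_axis [OF v True] by simp
next
  case False
  then have "cnj (1 - v $ k) \<noteq> 0"
    by (metis complex_cnj_zero_iff eq_iff_diff_eq_0)
  then show ?thesis
    by (auto simp: vec_eq_iff matrix_vector_mult_axis) (auto simp: reflector_def axis_def)
qed

lemma reflector_fixes:
  fixes v :: "complex^'n"
  assumes "v $ i = 0" "i \<noteq> k"
  shows "reflector k v *v axis i 1 = axis i 1"
  using assms by (auto simp: vec_eq_iff matrix_vector_mult_axis) (auto simp: reflector_def axis_def)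

section \<open>Determinant and logarithm of a reflector times a block\<close>

text \<open>Cramer's rule with the identity as coefficient matrix, where the solution is
  \<open>u\<close> itself.\<close>

lemma det_replace_column: "det (\<chi> i j. if j = k then u $ i else if i = j then 1 else 0) = u $ k"
  for u :: "complex^'n"
proof -
  have "(\<chi> i j. if j = k then u $ i else if i = j then 1 else 0) =
        (\<chi> i j. if j = k then (mat 1 *v u) $ i else (mat 1 :: complex^'n^'n) $ i $ j)"
    by (simp only: matrix_vector_mul_lid) (simp add: vec_eq_iff mat_def)
  then show ?thesis
    using cramer_lemma [of k "mat 1 :: complex^'n^'n" u] by simp
qed

lemma det_replace_row: "det (\<chi> i j. if i = k then w $ j else if i = j then 1 else 0) = w $ k"
  for w :: "complex^'n"
proof -
  let ?T = "\<chi> i j. if i = k then w $ j else if i = j then 1 else 0"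
  have "transpose ?T = (\<chi> i j. if j = k then w $ i else if i = j then 1 else 0)"
    by (auto simp: vec_eq_iff transpose_def)
  then have "det (transpose ?T) = w $ k"
    by (simp only: det_replace_column)
  then show ?thesis
    by (simp only: det_transpose)
qed

text \<open>Apart from the factor \<open>1 - X\<close>, the rank one perturbation \<open>1 - reflector k v ** block_extend k X\<close>
  consists of an elementary column and an elementary row operation.\<close>

lemma det_reflector_block:
  fixes v :: "complex^'n"
  assumes X: "vanishes_at k X"
  shows "det (mat 1 - reflector k v ** block_extend k X) = (1 - v $ k) * det (mat 1 - X)"
proof -
  define u where "u = axis k 1 - v"
  define Y where "Y = block_extend k X"
  \<comment> \<open>The row for which \<open>reflector k v ** Y\<close> is \<open>Y\<close> minus
    the outer product of \<open>u\<close> and \<open>w\<close>.\<close>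
  define w where "w = (\<chi> j. \<Sum>l\<in>UNIV. cnj (u $ l) * Y $ l $ j / cnj (1 - v $ k))"
  define T where "T = (\<chi> i j. if i = k then w $ j else if i = j then 1 else 0)"
  define T' where "T' = (\<chi> i j. if j = k then u $ i else if i = j then 1 else 0)"
  have uk: "u $ k = 1 - v $ k"
    by (simp add: u_def)
  have Yk: "Y $ l $ k = (if l = k then 1 else 0)" for l
    using X by (simp add: Y_def block_extend_def vanishes_at_def)
  have XY: "X $ i $ j = Y $ i $ j - (if i = k \<and> j = k then 1 else 0)" for i j
    using X by (simp add: Y_def block_extend_def vanishes_at_def)
  have RY: "(reflector k v ** Y) $ i $ j = Y $ i $ j - u $ i * w $ j" for i j
  proof -
    have "(reflector k v ** Y) $ i $ j =
       (\<Sum>l\<in>UNIV. (if i = l then 1 else 0) * Y $ l $ j - u $ i * (cnj (u $ l) * Y $ l $ j / cnj (1 - v $ k)))"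
      by (simp add: matrix_matrix_mult_def reflector_def u_def left_diff_distrib mult.assoc)
    then show ?thesis
      by (simp add: sum_subtractf sum_if_eq w_def sum_distrib_left)
  qed
  have XT: "((mat 1 - X) ** T) $ i $ j =
      (if i = k then w $ j else if j = k then 0 else (if i = j then 1 else 0) - X $ i $ j)" for i j
  proof -
    have "((mat 1 - X) ** T) $ i $ j =
       (\<Sum>l\<in>UNIV. (if l = k then 1 else 0) * ((mat 1 - X) $ i $ l * w $ j)
          + (if l = j then 1 else 0) * (if l = k then 0 else (mat 1 - X) $ i $ l))"
      unfolding matrix_matrix_mult_def T_def
      by simp (intro sum.cong, auto)
    also have "\<dots> = (mat 1 - X) $ i $ k * w $ j + (if j = k then 0 else (mat 1 - X) $ i $ j)"
      by (simp only: sum.distrib sum_if_eq)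
    finally show ?thesis
      using X by (auto simp: vanishes_at_def mat_def)
  qed
  \<comment> \<open>Row k of \<open>(mat 1 - X) ** T\<close> is \<open>w\<close>, and its other rows
    vanish at k. Multiplication by \<open>T'\<close> spreads row k along \<open>u\<close>, which
    adds the outer product of \<open>u\<close> and \<open>w\<close> to
    \<open>mat 1 - Y\<close>.\<close>
  have "mat 1 - reflector k v ** Y = T' ** ((mat 1 - X) ** T)"
  proof -
    have "(T' ** ((mat 1 - X) ** T)) $ i $ j = (mat 1 - reflector k v ** Y) $ i $ j" for i j
    proof -
      let ?Z = "(mat 1 - X) ** T"
      have "(T' ** ?Z) $ i $ j =
        (\<Sum>l\<in>UNIV. (if l = k then 1 else 0) * (u $ i * ?Z $ l $ j)
          + (if l = i then 1 else 0) * (if l = k then 0 else ?Z $ l $ j))"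
        unfolding matrix_matrix_mult_def [of T']
        by (simp only: vec_lambda_beta T'_def) (intro sum.cong, auto)
      also have "\<dots> = u $ i * ?Z $ k $ j + (if i = k then 0 else ?Z $ i $ j)"
        by (simp only: sum.distrib sum_if_eq)
      also have "\<dots> = (mat 1 - reflector k v ** Y) $ i $ j"
      proof -
        have "(mat 1 :: complex^'n^'n) $ i $ j = (if i = j then 1 else 0)"
          by (simp add: mat_def)
        then show ?thesis
          using X by (auto simp: XT RY XY Yk vanishes_at_def)
      qed
      finally show ?thesis .
    qed
    then show ?thesis by (simp add: vec_eq_iff)
  qed
  then have "det (mat 1 - reflector k v ** Y) = u $ k * det (mat 1 - X) * w $ k"
    by (simp add: det_mul T_def T'_def det_replace_row det_replace_column)
  moreover have "w $ k = 1" if "v $ k \<noteq> 1"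
  proof -
    have "cnj (1 - v $ k) \<noteq> 0"
      using that by (metis complex_cnj_zero_iff eq_iff_diff_eq_0)
    then show ?thesis
      by (simp add: w_def Yk uk flip: sum_divide_distrib) (simp add: uk if_distrib cong: if_cong)
  qed
  \<comment> \<open>For \<open>v $ k = 1\<close> nothing is known about \<open>w $ k\<close>, but
    then \<open>u $ k = 0\<close> and both sides vanish.\<close>
  ultimately show ?thesis
    by (cases "v $ k = 1") (auto simp: uk Y_def)
qed

text \<open>Coordinate k passes through unchanged and is orthogonal to the image under
  \<open>X\<close> of the other coordinates, so Pythagoras applies.\<close>

lemma block_extend_contractive:
  fixes X :: "complex^'n^'n"
  assumes X: "contractive X" "vanishes_at k X"
  shows "contractive (block_extend k X)"
  unfolding contractive_def
proof
  fix x :: "complex^'n"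
  define y where "y = (\<chi> i. if i = k then 0 else x $ i)"
  have "X *v x = X *v y"
    using X(2) unfolding matrix_vector_mult_def vec_eq_iff
    by (auto simp: y_def vanishes_at_def intro!: sum.cong)
  have comp: "(block_extend k X *v x) $ i = (if i = k then x $ k else (X *v y) $ i)" for i
  proof (cases "i = k")
    case True
    then have "(block_extend k X *v x) $ i = (\<Sum>j\<in>UNIV. (if j = k then 1 else 0) * x $ j)"
      using X(2) unfolding matrix_vector_mult_def block_extend_def
      by simp (intro sum.cong, auto simp: vanishes_at_def)
    with True show ?thesis by (simp add: sum_if_eq)
  next
    case False
    then have "(block_extend k X *v x) $ i = (X *v x) $ i"
      by (simp add: matrix_vector_mult_def block_extend_def)
    with False \<open>X *v x = X *v y\<close> show ?thesis by simp
  qed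
  have "(X *v y) $ k = 0"
    using X(2) by (simp add: matrix_vector_mult_def vanishes_at_def)
  have "(norm (block_extend k X *v x))\<^sup>2 = (cmod (x $ k))\<^sup>2 + (\<Sum>i\<in>UNIV - {k}. (cmod ((X *v y) $ i))\<^sup>2)"
    by (simp add: power2_norm_vec comp sum.remove [of UNIV k])
  also have "\<dots> = (cmod (x $ k))\<^sup>2 + (norm (X *v y))\<^sup>2"
    using \<open>(X *v y) $ k = 0\<close> by (simp add: power2_norm_vec sum.remove [of UNIV k])
  also have "\<dots> \<le> (cmod (x $ k))\<^sup>2 + (norm y)\<^sup>2"
    using X(1) by (simp add: contractive_def)
  also have "\<dots> = (norm x)\<^sup>2"
    by (simp add: power2_norm_vec sum.remove [of UNIV k] y_def)
  finally show "norm (block_extend k X *v x) \<le> norm x"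
    by (simp add: power2_le_iff_abs_le)
qed

lemma reflector_block_nonsingular:
  fixes v :: "complex^'n"
  assumes v: "norm v = 1" "v $ k \<noteq> 1"
    and X: "X \<in> log_domain" "vanishes_at k X"
  shows "reflector k v ** block_extend k X \<in> log_domain"
proof -
  have "contractive (reflector k v ** block_extend k X)"
    by (intro contractive_mult unitary_contractive reflector_unitary block_extend_contractive
        log_domainD(1) v X)
  moreover have "det (mat 1 - reflector k v ** block_extend k X) \<noteq> 0"
    using log_domainD(2) [OF X(1)] v(2) by (simp add: det_reflector_block [OF X(2)])
  ultimately show ?thesis
    by (simp add: log_domain_def)
qed

text \<open>The starting point of the deformation: \<open>v\<close> is the only nonzero column, so
  the determinant along the ray is 1 - t v_k, which stays in the right half plane where
  \<open>Ln\<close> is continuous.\<close>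

lemma log_det_rank_one:
  fixes v :: "complex^'n"
  assumes v: "norm v = 1" "v $ k \<noteq> 1"
  shows "log_det_one_minus (reflector k v ** block_extend k 0) = Ln (1 - v $ k)"
proof -
  have vk: "cmod (v $ k) \<le> 1"
    using Finite_Cartesian_Product.norm_nth_le [of v k] v by simp
  define M where "M = reflector k v ** block_extend k 0"
  have M: "M \<in> log_domain"
    unfolding M_def by (rule reflector_block_nonsingular [OF v])
      (auto simp: log_domain_def vanishes_at_def)
  have M_eq: "M $ i $ j = (if j = k then v $ i else 0)" for i j
  proof -
    have "M $ i $ j = (\<Sum>l\<in>UNIV. (if l = k then 1 else 0) * (if j = k then reflector k v $ i $ l else 0))"
      unfolding M_def matrix_matrix_mult_def block_extend_def
      by simp (intro sum.cong, auto)
    also have "\<dots> = (if j = k then (reflector k v *v axis k 1) $ i else 0)"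
      by (simp add: sum_if_eq matrix_vector_mult_axis)
    finally show ?thesis by (simp add: reflector_axis v)
  qed
  have det: "det (mat 1 - t *\<^sub>R M) = 1 - of_real t * v $ k" for t
  proof -
    have "mat 1 - t *\<^sub>R M = (\<chi> i j. if j = k then (axis k 1 - t *\<^sub>R v) $ i else if i = j then 1 else 0)"
      by (auto simp: vec_eq_iff mat_def M_eq axis_def)
    then show ?thesis
      by (simp add: det_replace_column scaleR_conv_of_real [where 'a = complex])
  qed
  have pos: "0 < Re (1 - of_real t * v $ k)" if "t \<in> {0..1}" for t
    using Re_one_minus_scaled_pos [of "v $ k" t] vk v that by auto
  have "log_det_one_minus (1 *\<^sub>R M) = Ln (1 - of_real 1 * v $ k)"
  proof (rule exp_unique_path [of "\<lambda>t. log_det_one_minus (t *\<^sub>R M)" "\<lambda>t. Ln (1 - of_real t * v $ k)"])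
    show "continuous_on {0..1} (\<lambda>t. log_det_one_minus (t *\<^sub>R M))"
      by (rule continuous_on_compose2 [OF continuous_on_log_det_one_minus])
         (use scaleR_log_domain' [OF M] in \<open>auto intro!: continuous_intros\<close>)
    show "continuous_on {0..1} (\<lambda>t. Ln (1 - of_real t * v $ k))"
      by (intro continuous_intros) (use pos in \<open>force simp: complex_nonpos_Reals_iff\<close>)
    show "exp (log_det_one_minus (t *\<^sub>R M)) = exp (Ln (1 - of_real t * v $ k))" if "t \<in> {0..1}" for t
      using scaleR_log_domain' [OF M, of t] that pos [OF that] det [of t]
      by (auto simp: exp_log_det_one_minus log_domain_def)
  qed simp
  then show ?thesis by (simp add: M_def)
qed

text \<open>Only \<open>X\<close> is scaled, while the reflector and the entry 1 at k stay. The path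
  therefore remains in \<open>log_domain\<close> and reaches the rank one case at t = 0; by
  \<open>det_reflector_block\<close> both sides have the same exponential all along.\<close>

lemma log_det_reflector_block:
  fixes v :: "complex^'n"
  assumes v: "norm v = 1" "v $ k \<noteq> 1"
    and X: "X \<in> log_domain" "vanishes_at k X"
  shows "log_det_one_minus (reflector k v ** block_extend k X) = Ln (1 - v $ k) + log_det_one_minus X"
proof -
  let ?M = "\<lambda>t::real. reflector k v ** block_extend k (t *\<^sub>R X)"
  have tX: "t *\<^sub>R X \<in> log_domain" "vanishes_at k (t *\<^sub>R X)" if "t \<in> {0..1}" for t
    using scaleR_log_domain' [OF X(1), of t] X(2) that by (auto simp: vanishes_at_def)
  have M: "?M t \<in> log_domain" if "t \<in> {0..1}" for t
    by (rule reflector_block_nonsingular [OF v tX [OF that]])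
  have "log_det_one_minus (?M 1) = Ln (1 - v $ k) + log_det_one_minus (1 *\<^sub>R X)"
  proof (rule exp_unique_path [of "\<lambda>t. log_det_one_minus (?M t)"
        "\<lambda>t. Ln (1 - v $ k) + log_det_one_minus (t *\<^sub>R X)"])
    have "continuous_on {0..1} (\<lambda>t. if c then 1 else (t *\<^sub>R X) $ i $ j)" for c i j
      by (cases c) (auto intro!: continuous_intros)
    then have "continuous_on {0..1} ?M"
      unfolding matrix_matrix_mult_def block_extend_def
      by (intro continuous_on_vec_lambda continuous_on_sum continuous_on_mult continuous_on_const)
         simp
    then show "continuous_on {0..1} (\<lambda>t. log_det_one_minus (?M t))"
      by (rule continuous_on_compose2 [OF continuous_on_log_det_one_minus]) (use M in auto)
    show "continuous_on {0..1} (\<lambda>t. Ln (1 - v $ k) + log_det_one_minus (t *\<^sub>R X))"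
      by (intro continuous_on_add continuous_on_const
            continuous_on_compose2 [OF continuous_on_log_det_one_minus])
         (use tX in \<open>auto intro!: continuous_intros\<close>)
    show "exp (log_det_one_minus (?M t)) = exp (Ln (1 - v $ k) + log_det_one_minus (t *\<^sub>R X))"
      if "t \<in> {0..1}" for t
      using M [OF that] tX [OF that] v
      by (simp add: exp_log_det_one_minus exp_add det_reflector_block)
    show "log_det_one_minus (?M 0) = Ln (1 - v $ k) + log_det_one_minus (0 *\<^sub>R X)"
      using log_det_rank_one [OF v] by simp
  qed
  then show ?thesis by simp
qed

section \<open>Invariant measures on unitary groups\<close>

text \<open>A copy of the unitary group of size \<open>card S\<close> among the matrices of full
  size. Trivial columns outside \<open>S\<close> entail trivial rows there, because the adjoint
  fixes the same vectors.\<close>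

definition fixing :: "'n set \<Rightarrow> (complex^'n^'n) set" where
  "fixing S = {A \<in> unitary_group. \<forall>i. i \<notin> S \<longrightarrow> A *v axis i 1 = axis i 1}"

lemma conj_transpose_nth: "conj_transpose A $ i $ j = cnj (A $ j $ i)"
  by (simp add: conj_transpose_def map_matrix_def transpose_def)

lemma conj_transpose_conj_transpose [simp]: "conj_transpose (conj_transpose A) = A"
  by (simp add: vec_eq_iff conj_transpose_nth)

lemma conj_transpose_mult: "conj_transpose (A ** B) = conj_transpose B ** conj_transpose A"
  by (simp add: vec_eq_iff conj_transpose_nth matrix_matrix_mult_def mult.commute)

lemma unitary_conj_transpose: "A \<in> unitary_group \<Longrightarrow> conj_transpose A \<in> unitary_group"
  by (simp add: unitary_group_def)

lemma unitary_mult: "A \<in> unitary_group \<Longrightarrow> B \<in> unitary_group \<Longrightarrow> A ** B \<in> unitary_group"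
  unfolding unitary_group_def conj_transpose_mult mem_Collect_eq
  by (metis matrix_mul_assoc matrix_mul_rid)

lemma unitary_cancel:
  assumes "A \<in> unitary_group"
  shows "conj_transpose A ** (A ** B) = B" "A ** (conj_transpose A ** B) = B"
    "conj_transpose A *v (A *v x) = x" "A *v (conj_transpose A *v x) = x"
  using assms by (simp_all add: unitary_group_def matrix_mul_assoc matrix_vector_mul_assoc)

lemma fixing_unitary: "A \<in> fixing S \<Longrightarrow> A \<in> unitary_group"
  by (simp add: fixing_def)

lemma fixing_mono: "S \<subseteq> T \<Longrightarrow> fixing S \<subseteq> fixing T"
  by (auto simp: fixing_def)

lemma fixing_UNIV [simp]: "fixing UNIV = unitary_group"
  by (simp add: fixing_def)

lemma fixing_conj_transpose:
  assumes "A \<in> fixing S"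
  shows "conj_transpose A \<in> fixing S"
  using assms unitary_cancel(3) [OF fixing_unitary [OF assms]]
  by (auto simp: fixing_def unitary_conj_transpose) metis

lemma fixing_mult: "A \<in> fixing S \<Longrightarrow> B \<in> fixing S \<Longrightarrow> A ** B \<in> fixing S"
  by (auto simp: fixing_def unitary_mult matrix_vector_mul_assoc [symmetric])

lemma fixing_column:
  assumes "A \<in> fixing S" "i \<notin> S"
  shows "A $ j $ i = (if j = i then 1 else 0)"
proof -
  have "(A *v axis i 1) $ j = axis i 1 $ j"
    using assms by (simp add: fixing_def)
  then show ?thesis
    unfolding matrix_vector_mult_axis by (simp add: axis_def)
qed

lemma fixing_row:
  assumes "A \<in> fixing S" "i \<notin> S"
  shows "A $ i $ j = (if j = i then 1 else 0)"
  using fixing_column [OF fixing_conj_transpose [OF assms(1)] assms(2), of j]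
  by (simp add: conj_transpose_nth split: if_splits)

section \<open>Closedness of the groups and measurability of matrix operations\<close>

lemma closed_unitary_group: "closed (unitary_group :: (complex^'n^'n) set)"
proof -
  have "unitary_group = (\<Inter>i j.
      {A :: complex^'n^'n. (\<Sum>l\<in>UNIV. A $ i $ l * cnj (A $ j $ l)) = (if i = j then 1 else 0)} \<inter>
      {A. (\<Sum>l\<in>UNIV. cnj (A $ l $ i) * A $ l $ j) = (if i = j then 1 else 0)})"
    unfolding unitary_group_def vec_eq_iff
    by (auto simp: matrix_matrix_mult_def conj_transpose_nth mat_def)
  also have "closed \<dots>"
    by (intro closed_INT ballI closed_Int closed_Collect_eq continuous_intros)
  finally show ?thesis .
qed

lemma fixing_borel [measurable]: "fixing S \<in> sets (borel :: (complex^'n^'n) measure)"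
proof -
  have "fixing S = unitary_group \<inter> (\<Inter>i\<in>-S. \<Inter>j. {A :: complex^'n^'n. A $ j $ i = axis i 1 $ j})"
    by (auto simp: fixing_def vec_eq_iff matrix_vector_mult_axis)
  also have "closed \<dots>"
    by (intro closed_Int closed_unitary_group closed_INT ballI closed_Collect_eq continuous_intros)
  finally show ?thesis by (rule borel_closed)
qed

lemma borel_measurable_vec_lambda:
  fixes f :: "'i::finite \<Rightarrow> 'a \<Rightarrow> 'b::euclidean_space"
  assumes "\<And>i. f i \<in> borel_measurable M"
  shows "(\<lambda>x. \<chi> i. f i x) \<in> borel_measurable M"
proof (subst borel_measurable_euclidean_space, rule ballI)
  fix b :: "'b^'i" 
  have 1: "(\<lambda>x. f i x \<bullet> b $ i) \<in> borel_measurable M" for i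
    by (rule borel_measurable_inner [OF assms borel_measurable_const])
  have "(\<lambda>x. \<Sum>i\<in>UNIV. f i x \<bullet> b $ i) \<in> borel_measurable M"
    by (rule borel_measurable_sum) (rule 1)
  then show "(\<lambda>x. (\<chi> i. f i x) \<bullet> b) \<in> borel_measurable M"
    by (simp only: inner_vec_def vec_lambda_beta)
qed

lemma borel_measurable_vec_nth [measurable (raw)]:
  fixes f :: "'a \<Rightarrow> 'b::euclidean_space ^ 'i"
  assumes "f \<in> borel_measurable M"
  shows "(\<lambda>x. f x $ i) \<in> borel_measurable M"
  by (rule measurable_compose [OF assms borel_measurable_continuous_onI])
     (intro continuous_intros)

lemma borel_measurable_matrix_mult [measurable (raw)]:
  fixes f :: "'a \<Rightarrow> complex^'n^'m" and g :: "'a \<Rightarrow> complex^'k^'n"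
  assumes [measurable]: "f \<in> borel_measurable M" "g \<in> borel_measurable M"
  shows "(\<lambda>x. f x ** g x) \<in> borel_measurable M"
  unfolding matrix_matrix_mult_def by (intro borel_measurable_vec_lambda) measurable

lemma borel_measurable_matrix_vector_mult [measurable (raw)]:
  fixes f :: "'a \<Rightarrow> complex^'n^'m" and g :: "'a \<Rightarrow> complex^'n"
  assumes [measurable]: "f \<in> borel_measurable M" "g \<in> borel_measurable M"
  shows "(\<lambda>x. f x *v g x) \<in> borel_measurable M"
  unfolding matrix_vector_mult_def by (intro borel_measurable_vec_lambda) measurable

lemma borel_measurable_cnj [measurable (raw)]:
  assumes "f \<in> borel_measurable M"
  shows "(\<lambda>x. cnj (f x)) \<in> borel_measurable M"
  by (rule measurable_compose [OF assms borel_measurable_continuous_onI]) (intro continuous_intros)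

lemma borel_measurable_conj_transpose [measurable (raw)]:
  assumes [measurable]: "f \<in> borel_measurable M"
  shows "(\<lambda>x. conj_transpose (f x)) \<in> borel_measurable M"
proof -
  have "(\<lambda>x. conj_transpose (f x)) = (\<lambda>x. \<chi> i j. cnj (f x $ j $ i))"
    by (simp add: vec_eq_iff conj_transpose_nth fun_eq_iff)
  then show ?thesis
    by (simp only:) (intro borel_measurable_vec_lambda, measurable)
qed

lemma borel_measurable_reflector [measurable (raw)]:
  assumes [measurable]: "f \<in> borel_measurable M"
  shows "(\<lambda>x. reflector k (f x)) \<in> borel_measurable M"
  unfolding reflector_def by (intro borel_measurable_vec_lambda) measurable

text \<open>Measures on the group are regarded as measures on the space of all matrices.\<close>

definition prob_on :: "(complex^'n^'n) set \<Rightarrow> (complex^'n^'n) measure \<Rightarrow> bool" where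
  "prob_on G \<mu> \<longleftrightarrow> prob_space \<mu> \<and> sets \<mu> = sets borel \<and> (AE x in \<mu>. x \<in> G)"

definition left_invariant :: "(complex^'n^'n) set \<Rightarrow> (complex^'n^'n) measure \<Rightarrow> bool" where
  "left_invariant G \<mu> \<longleftrightarrow> prob_on G \<mu> \<and> (\<forall>g\<in>G. distr \<mu> borel (\<lambda>x. g ** x) = \<mu>)"

definition right_invariant :: "(complex^'n^'n) set \<Rightarrow> (complex^'n^'n) measure \<Rightarrow> bool" where
  "right_invariant G \<mu> \<longleftrightarrow> prob_on G \<mu> \<and> (\<forall>g\<in>G. distr \<mu> borel (\<lambda>x. x ** g) = \<mu>)"

lemma prob_onD:
  assumes "prob_on G \<mu>"
  shows "prob_space \<mu>" "sets \<mu> = sets borel" "AE x in \<mu>. x \<in> G"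
  using assms by (auto simp: prob_on_def)

lemma left_invariant_prob_on: "left_invariant G \<mu> \<Longrightarrow> prob_on G \<mu>"
  by (simp add: left_invariant_def)

section \<open>Left and right invariance coincide\<close>

lemma nn_integral_distr_eq_self:
  assumes "sets M = sets borel" "h \<in> borel_measurable borel" "distr M borel h = M"
    and "f \<in> borel_measurable borel"
  shows "(\<integral>\<^sup>+x. f (h x) \<partial>M) = (\<integral>\<^sup>+x. f x \<partial>M)"
  using nn_integral_distr [of h M borel f] assms by (simp cong: measurable_cong_sets)

lemma left_invariant_nn_integral:
  assumes "left_invariant G \<mu>" "g \<in> G" "f \<in> borel_measurable borel"
  shows "(\<integral>\<^sup>+x. f (g ** x) \<partial>\<mu>) = (\<integral>\<^sup>+x. f x \<partial>\<mu>)"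
  using assms by (intro nn_integral_distr_eq_self) (auto simp: left_invariant_def prob_on_def)

lemma right_invariant_nn_integral:
  assumes "right_invariant G \<mu>" "g \<in> G" "f \<in> borel_measurable borel"
  shows "(\<integral>\<^sup>+x. f (x ** g) \<partial>\<mu>) = (\<integral>\<^sup>+x. f x \<partial>\<mu>)"
  using assms by (intro nn_integral_distr_eq_self) (auto simp: right_invariant_def prob_on_def)

text \<open>The double integral of \<open>indicator A (x ** y)\<close>, with y under
  \<open>\<mu>\<close> and x under \<open>\<nu>\<close>, is evaluated in both orders: the inner
  integral is constant by left invariance in one and by right invariance in the other.\<close>

lemma left_right_invariant_eq:
  fixes G :: "(complex^'n^'n) set"
  assumes \<mu>: "left_invariant G \<mu>" and \<nu>: "right_invariant G \<nu>"
  shows "\<mu> = \<nu>"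
proof -
  have "prob_on G \<mu>" "prob_on G \<nu>"
    using assms by (auto simp: left_invariant_def right_invariant_def)
  note p\<mu> = prob_onD [OF \<open>prob_on G \<mu>\<close>] and p\<nu> = prob_onD [OF \<open>prob_on G \<nu>\<close>]
  note [measurable_cong] = p\<mu>(2) p\<nu>(2)
  interpret \<mu>: prob_space \<mu> by (rule p\<mu>)
  interpret \<nu>: prob_space \<nu> by (rule p\<nu>)
  interpret pair_sigma_finite \<mu> \<nu> ..
  show ?thesis
  proof (rule measure_eqI)
    fix A assume "A \<in> sets \<mu>"
    then have A [measurable]: "A \<in> sets borel" by (simp add: p\<mu>(2))
    have "emeasure \<mu> A = (\<integral>\<^sup>+x. emeasure \<mu> A \<partial>\<nu>)"
      by (simp add: \<nu>.emeasure_space_1)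
    also have "\<dots> = (\<integral>\<^sup>+x. \<integral>\<^sup>+y. indicator A (x ** y) \<partial>\<mu> \<partial>\<nu>)"
    proof (rule nn_integral_cong_AE)
      show "AE x in \<nu>. emeasure \<mu> A = (\<integral>\<^sup>+y. indicator A (x ** y) \<partial>\<mu>)"
        using p\<nu>(3)
        by eventually_elim (subst left_invariant_nn_integral [OF \<mu>], use A p\<mu>(2) in auto)
    qed
    also have "\<dots> = (\<integral>\<^sup>+y. \<integral>\<^sup>+x. indicator A (x ** y) \<partial>\<nu> \<partial>\<mu>)"
      by (rule Fubini') measurable
    also have "\<dots> = (\<integral>\<^sup>+y. emeasure \<nu> A \<partial>\<mu>)"
    proof (rule nn_integral_cong_AE)
      show "AE y in \<mu>. (\<integral>\<^sup>+x. indicator A (x ** y) \<partial>\<nu>) = emeasure \<nu> A"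
        using p\<mu>(3)
        by eventually_elim (subst right_invariant_nn_integral [OF \<nu>], use A p\<nu>(2) in auto)
    qed
    also have "\<dots> = emeasure \<nu> A"
      by (simp add: \<mu>.emeasure_space_1)
    finally show "emeasure \<mu> A = emeasure \<nu> A" .
  qed (simp add: p\<mu> p\<nu>)
qed

lemma prob_on_distr:
  assumes \<mu>: "prob_on G \<mu>" and f [measurable]: "f \<in> borel_measurable borel"
    and H [measurable]: "H \<in> sets borel" and GH: "\<And>x. x \<in> G \<Longrightarrow> f x \<in> H"
  shows "prob_on H (distr \<mu> borel f)"
proof -
  note p = prob_onD [OF \<mu>] and [measurable_cong] = prob_onD(2) [OF \<mu>]
  have "AE x in \<mu>. f x \<in> H"
    using p(3) GH by (rule eventually_mono)
  then have "AE x in distr \<mu> borel f. x \<in> H"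
    by (subst AE_distr_iff) simp_all
  moreover have "prob_space (distr \<mu> borel f)"
    by (rule prob_space.prob_space_distr [OF p(1)]) simp
  ultimately show ?thesis
    by (simp add: prob_on_def)
qed

lemma prob_on_distr_conj_transpose:
  assumes "prob_on (fixing S) \<mu>"
  shows "prob_on (fixing S) (distr \<mu> borel conj_transpose)"
  by (rule prob_on_distr [OF assms]) (simp_all add: fixing_conj_transpose)

text \<open>On the group the adjoint is the inverse, and it reverses products.\<close>

lemma invariant_distr_conj_transpose:
  shows "right_invariant (fixing S) \<mu> \<Longrightarrow> left_invariant (fixing S) (distr \<mu> borel conj_transpose)"
    and "left_invariant (fixing S) \<mu> \<Longrightarrow> right_invariant (fixing S) (distr \<mu> borel conj_transpose)"
proof -
  have swap: "distr (distr \<mu> borel conj_transpose) borel f = distr (distr \<mu> borel g) borel conj_transpose"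
    if "prob_on (fixing S) \<mu>" and [measurable]: "f \<in> borel_measurable borel" "g \<in> borel_measurable borel"
      and "\<And>x. f (conj_transpose x) = conj_transpose (g x)" for f g
  proof -
    note [measurable_cong] = prob_onD(2) [OF that(1)]
    show ?thesis by (simp add: distr_distr o_def that(4))
  qed
  show "left_invariant (fixing S) (distr \<mu> borel conj_transpose)" if \<mu>: "right_invariant (fixing S) \<mu>"
  proof -
    have p: "prob_on (fixing S) \<mu>" using \<mu> by (simp add: right_invariant_def)
    have "distr (distr \<mu> borel conj_transpose) borel (\<lambda>x. g ** x) = distr \<mu> borel conj_transpose"
      if "g \<in> fixing S" for g
      using swap [OF p, of "\<lambda>x. g ** x" "\<lambda>x. x ** conj_transpose g"] \<mu> fixing_conj_transpose [OF that]
      by (simp add: right_invariant_def conj_transpose_mult)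
    with prob_on_distr_conj_transpose [OF p] show ?thesis
      by (simp add: left_invariant_def)
  qed
  show "right_invariant (fixing S) (distr \<mu> borel conj_transpose)" if \<mu>: "left_invariant (fixing S) \<mu>"
  proof -
    have p: "prob_on (fixing S) \<mu>" using \<mu> by (rule left_invariant_prob_on)
    have "distr (distr \<mu> borel conj_transpose) borel (\<lambda>x. x ** g) = distr \<mu> borel conj_transpose"
      if "g \<in> fixing S" for g
      using swap [OF p, of "\<lambda>x. x ** g" "\<lambda>x. conj_transpose g ** x"] \<mu> fixing_conj_transpose [OF that]
      by (simp add: left_invariant_def conj_transpose_mult)
    with prob_on_distr_conj_transpose [OF p] show ?thesis
      by (simp add: right_invariant_def)
  qed
qed

text \<open>The adjoint image of a measure that is invariant on one side is invariant on the other,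
  and \<open>left_right_invariant_eq\<close> identifies it with the measure itself.\<close>

lemma left_invariant_iff_right_invariant:
  "left_invariant (fixing S) \<mu> \<longleftrightarrow> right_invariant (fixing S) \<mu>"
  using left_right_invariant_eq invariant_distr_conj_transpose
  by metis

section \<open>Splitting off one column of a random unitary matrix\<close>

text \<open>The factor \<open>h\<close> in \<open>V = R ** h\<close>, the inverse of the unitary
  \<open>R\<close> being its adjoint; unrelated to the cofactors of a determinant.\<close>

definition cofactor :: "'n \<Rightarrow> complex^'n^'n \<Rightarrow> complex^'n^'n" where
  "cofactor k V = conj_transpose (reflector k (V *v axis k 1)) ** V"

lemma borel_measurable_cofactor [measurable (raw)]:
  assumes [measurable]: "f \<in> borel_measurable M"
  shows "(\<lambda>x. cofactor k (f x)) \<in> borel_measurable M"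
  unfolding cofactor_def by measurable

lemma fixing_axis_norm: "V \<in> fixing S \<Longrightarrow> norm (V *v axis k 1) = 1"
  by (simp add: unitary_norm fixing_unitary)

lemma reflector_fixing:
  fixes v :: "complex^'n"
  assumes "norm v = 1" "k \<in> S" "\<And>i. i \<notin> S \<Longrightarrow> v $ i = 0"
  shows "reflector k v \<in> fixing S"
  using assms by (auto simp: fixing_def reflector_unitary intro!: reflector_fixes)

lemma reflector_axis_fixing:
  assumes "V \<in> fixing S" "k \<in> S"
  shows "reflector k (V *v axis k 1) \<in> fixing S"
proof (rule reflector_fixing)
  fix i assume "i \<notin> S"
  then show "(V *v axis k 1) $ i = 0"
    using fixing_row [OF assms(1), of i k] assms(2) by (auto simp: matrix_vector_mult_axis)
qed (use assms fixing_axis_norm in auto)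

lemma reflector_cofactor:
  assumes "V \<in> unitary_group"
  shows "reflector k (V *v axis k 1) ** cofactor k V = V"
  unfolding cofactor_def
  by (rule unitary_cancel) (simp add: reflector_unitary unitary_norm assms)

lemma cofactor_fixing:
  assumes V: "V \<in> fixing (insert k S)"
  shows "cofactor k V \<in> fixing S"
proof -
  let ?R = "reflector k (V *v axis k 1)"
  have R: "?R \<in> fixing (insert k S)"
    using reflector_axis_fixing [OF V] by simp
  then have "cofactor k V \<in> fixing (insert k S)"
    unfolding cofactor_def using V by (intro fixing_mult fixing_conj_transpose)
  moreover have "cofactor k V *v axis k 1 = axis k 1"
  proof -
    have "cofactor k V *v axis k 1 = conj_transpose ?R *v (?R *v axis k 1)"
      by (simp add: cofactor_def matrix_vector_mul_assoc [symmetric] reflector_axis fixing_axis_norm [OF V])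
    then show ?thesis
      by (simp add: unitary_cancel fixing_unitary [OF R])
  qed
  ultimately show ?thesis
    by (auto simp: fixing_def)
qed

text \<open>Since \<open>g\<close> fixes \<open>axis k 1\<close>, the matrices \<open>V\<close> and
  \<open>V ** g\<close> share column k and hence the reflector. This equivariance yields both the
  invariance of the law of the cofactor and its independence of the column.\<close>

lemma cofactor_mult:
  assumes "g \<in> fixing S" "k \<notin> S"
  shows "cofactor k (V ** g) = cofactor k V ** g" "(V ** g) *v axis k 1 = V *v axis k 1"
  using assms by (auto simp: cofactor_def fixing_def matrix_vector_mul_assoc [symmetric] matrix_mul_assoc)

lemma left_invariant_cofactor:
  assumes \<mu>: "left_invariant (fixing (insert k S)) \<mu>" and k: "k \<notin> S"
  shows "left_invariant (fixing S) (distr \<mu> borel (cofactor k))"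
proof -
  have \<mu>': "right_invariant (fixing (insert k S)) \<mu>"
    using \<mu> by (simp add: left_invariant_iff_right_invariant)
  have pr: "prob_on (fixing (insert k S)) \<mu>" using \<mu> by (rule left_invariant_prob_on)
  note [measurable_cong] = prob_onD(2) [OF pr]
  have "prob_on (fixing S) (distr \<mu> borel (cofactor k))"
    by (rule prob_on_distr [OF pr]) (simp_all add: cofactor_fixing)
  moreover have "distr (distr \<mu> borel (cofactor k)) borel (\<lambda>x. x ** g) = distr \<mu> borel (cofactor k)"
    if g: "g \<in> fixing S" for g
  proof -
    have "distr (distr \<mu> borel (cofactor k)) borel (\<lambda>x. x ** g) =
          distr (distr \<mu> borel (\<lambda>x. x ** g)) borel (cofactor k)"
      by (simp add: distr_distr o_def cofactor_mult [OF g k])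
    also have "distr \<mu> borel (\<lambda>x. x ** g) = \<mu>"
      using \<mu>' g fixing_mono [OF subset_insertI, of S k] by (auto simp: right_invariant_def)
    finally show ?thesis .
  qed
  ultimately show ?thesis
    unfolding left_invariant_iff_right_invariant by (simp add: right_invariant_def)
qed

text \<open>Replacing \<open>V\<close> by \<open>V ** g\<close>, with \<open>g\<close> drawn from
  the law of the cofactor, keeps the column and turns the cofactor \<open>h\<close> into
  \<open>h ** g\<close>; for fixed \<open>h\<close> this has the law of \<open>g\<close>, whatever
  the column is.\<close>

lemma cofactor_independent:
  fixes f :: "complex^'n \<Rightarrow> complex^'n^'n \<Rightarrow> ennreal"
  assumes \<mu>: "left_invariant (fixing (insert k S)) \<mu>" and k: "k \<notin> S"
    and f [measurable]: "case_prod f \<in> borel_measurable (borel \<Otimes>\<^sub>M borel)"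
  shows "(\<integral>\<^sup>+V. f (V *v axis k 1) (cofactor k V) \<partial>\<mu>) =
         (\<integral>\<^sup>+V. \<integral>\<^sup>+h. f (V *v axis k 1) h \<partial>distr \<mu> borel (cofactor k) \<partial>\<mu>)"
proof -
  define \<kappa> where "\<kappa> = distr \<mu> borel (cofactor k)"
  have \<kappa>: "left_invariant (fixing S) \<kappa>"
    unfolding \<kappa>_def by (rule left_invariant_cofactor [OF \<mu> k])
  have \<mu>': "right_invariant (fixing (insert k S)) \<mu>"
    using \<mu> by (simp add: left_invariant_iff_right_invariant)
  have "prob_on (fixing (insert k S)) \<mu>" "prob_on (fixing S) \<kappa>"
    using \<mu> \<kappa> by (auto simp: left_invariant_def)
  note p\<mu> = prob_onD [OF this(1)] and p\<kappa> = prob_onD [OF this(2)]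
  note [measurable_cong] = p\<mu>(2) p\<kappa>(2)
  interpret \<mu>: prob_space \<mu> by (rule p\<mu>)
  interpret \<kappa>: prob_space \<kappa> by (rule p\<kappa>)
  interpret pair_sigma_finite \<kappa> \<mu> ..
  let ?I = "\<integral>\<^sup>+V. f (V *v axis k 1) (cofactor k V) \<partial>\<mu>"
  have "?I = (\<integral>\<^sup>+g. \<integral>\<^sup>+V. f (V *v axis k 1) (cofactor k V) \<partial>\<mu> \<partial>\<kappa>)"
    by (simp add: \<kappa>.emeasure_space_1)
  also have "\<dots> = (\<integral>\<^sup>+g. \<integral>\<^sup>+V. f (V *v axis k 1) (cofactor k V ** g) \<partial>\<mu> \<partial>\<kappa>)"
  proof (rule nn_integral_cong_AE)
    have "?I = (\<integral>\<^sup>+V. f (V *v axis k 1) (cofactor k V ** g) \<partial>\<mu>)" if g: "g \<in> fixing S" for g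
      using right_invariant_nn_integral [OF \<mu>', of g "\<lambda>V. f (V *v axis k 1) (cofactor k V)"]
        g fixing_mono [OF subset_insertI, of S k]
      by (subst eq_commute) (auto simp: cofactor_mult [OF g k])
    then show "AE g in \<kappa>. ?I = (\<integral>\<^sup>+V. f (V *v axis k 1) (cofactor k V ** g) \<partial>\<mu>)"
      using p\<kappa>(3) by (auto elim!: eventually_mono)
  qed
  also have "\<dots> = (\<integral>\<^sup>+V. \<integral>\<^sup>+g. f (V *v axis k 1) (cofactor k V ** g) \<partial>\<kappa> \<partial>\<mu>)"
    by (rule Fubini' [symmetric]) measurable
  also have "\<dots> = (\<integral>\<^sup>+V. \<integral>\<^sup>+g. f (V *v axis k 1) g \<partial>\<kappa> \<partial>\<mu>)"
  proof (rule nn_integral_cong_AE)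
    show "AE V in \<mu>. (\<integral>\<^sup>+g. f (V *v axis k 1) (cofactor k V ** g) \<partial>\<kappa>) =
                     (\<integral>\<^sup>+g. f (V *v axis k 1) g \<partial>\<kappa>)"
      using p\<mu>(3)
    proof eventually_elim
      case (elim V)
      show ?case
        by (rule left_invariant_nn_integral [OF \<kappa> cofactor_fixing [OF elim]]) measurable
    qed
  qed
  finally show ?thesis by (simp add: \<kappa>_def)
qed

section \<open>Lebesgue measure on the complex plane and in polar coordinates\<close>

lemma nn_integral_lborel_complex:
  assumes f [measurable]: "f \<in> borel_measurable borel"
  shows "(\<integral>\<^sup>+z. f z \<partial>lborel) = (\<integral>\<^sup>+x. \<integral>\<^sup>+y. f (Complex x y) \<partial>lborel \<partial>lborel)"
proof -
  have [measurable]: "(\<lambda>(x, y). Complex x y) \<in> borel_measurable (lborel \<Otimes>\<^sub>M lborel)"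
    by (subst borel_measurable_complex_iff) (simp add: case_prod_beta)
  let ?M = "distr (lborel \<Otimes>\<^sub>M lborel) borel (\<lambda>(x, y). Complex x y)"
  have "lborel = ?M"
  proof (rule lborel_eqI)
    fix l u :: complex
    assume le: "\<And>b. b \<in> Basis \<Longrightarrow> l \<bullet> b \<le> u \<bullet> b"
    then have le': "Re l \<le> Re u" "Im l \<le> Im u"
      using le [of 1] le [of \<i>] by (simp_all add: Basis_complex_def)
    have "(\<lambda>(x, y). Complex x y) -` box l u \<inter> space (lborel \<Otimes>\<^sub>M lborel) =
          {Re l <..< Re u} \<times> {Im l <..< Im u}"
      by (auto simp: in_box_complex_iff space_pair_measure)
    then have "emeasure ?M (box l u) =
        emeasure (lborel \<Otimes>\<^sub>M lborel) ({Re l <..< Re u} \<times> {Im l <..< Im u})"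
      by (simp add: emeasure_distr)
    also have "\<dots> = ennreal ((Re u - Re l) * (Im u - Im l))"
      using le' by (simp add: lborel.emeasure_pair_measure_Times ennreal_mult)
    also have "(Re u - Re l) * (Im u - Im l) = (\<Prod>b\<in>Basis. (u - l) \<bullet> b)"
      by (simp add: Basis_complex_def)
    finally show "emeasure ?M (box l u) =
        ennreal (\<Prod>b\<in>Basis. (u - l) \<bullet> b)" .
  qed simp
  then have "(\<integral>\<^sup>+z. f z \<partial>lborel) =
      (\<integral>\<^sup>+z. f z \<partial>?M)"
    by simp
  also have "\<dots> = (\<integral>\<^sup>+p. f (case p of (x, y) \<Rightarrow> Complex x y) \<partial>(lborel \<Otimes>\<^sub>M lborel))"
    by (rule nn_integral_distr) measurable
  also have "\<dots> = (\<integral>\<^sup>+x. \<integral>\<^sup>+y. f (Complex x y) \<partial>lborel \<partial>lborel)"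
    by (subst lborel.nn_integral_fst [symmetric]) simp_all
  finally show ?thesis .
qed

text \<open>A translation invariant measure is determined up to a factor, and the unit ball shows that the
  factor is one.\<close>

lemma lborel_distr_isometry:
  fixes T :: "'a::euclidean_space \<Rightarrow> 'a"
  assumes lin: "linear T" and norm_T: "\<And>x. norm (T x) = norm x"
  shows "distr lborel borel T = lborel"
proof -
  define \<nu> where "\<nu> = distr lborel borel T"
  define B where "B = (ball 0 1 :: 'a set)"
  have B [measurable]: "B \<in> sets borel" and B_minus: "- x \<in> B \<longleftrightarrow> x \<in> B" for x
    by (auto simp: B_def)
  have T [measurable]: "T \<in> borel_measurable borel"
    using linear_continuous_on [OF linear_conv_bounded_linear [THEN iffD1, OF lin]]
    by (rule borel_measurable_continuous_onI)
  have [measurable_cong]: "sets \<nu> = sets borel"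
    by (simp add: \<nu>_def)
  have inj: "inj T"
    using norm_T lin by (simp add: linear_injective_0) (metis norm_eq_zero)
  then have "surj T"
    by (rule linear_inj_imp_surj [OF lin])
  have ball: "emeasure \<nu> B = emeasure lborel B"
  proof -
    have "T -` B \<inter> space lborel = B"
      by (auto simp: norm_T B_def)
    then show ?thesis by (simp add: \<nu>_def emeasure_distr)
  qed
  obtain T' where T': "linear T'" "T' \<circ> T = id"
    using linear_injective_left_inverse [OF lin inj] by blast
  have [measurable]: "T' \<in> borel_measurable borel"
    by (intro borel_measurable_continuous_onI linear_continuous_on linear_conv_bounded_linear [THEN iffD1] T')
  \<comment> \<open>Pulling back along the inverse of \<open>T\<close> recovers Lebesgue measure,
    which makes \<open>\<nu>\<close> sigma-finite, as Fubini's theorem demands.\<close>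
  have "distr \<nu> borel T' = lborel"
    using T'(2) by (simp add: \<nu>_def distr_distr id_def distr_id2)
  then interpret \<nu>: sigma_finite_measure \<nu>
    by (intro sigma_finite_measure_distr [of \<nu> borel T']) (simp_all add: lborel.sigma_finite_measure_axioms)
  have shift_\<nu>: "(\<integral>\<^sup>+x. f (c + x) \<partial>\<nu>) = (\<integral>\<^sup>+x. f x \<partial>\<nu>)"
    if [measurable]: "f \<in> borel_measurable borel" for f c
  proof -
    obtain d where d: "c = T d" using \<open>surj T\<close> by (metis surjD)
    have "(\<integral>\<^sup>+x. f (c + x) \<partial>\<nu>) = (\<integral>\<^sup>+x. f (T (d + x)) \<partial>lborel)"
      by (simp add: \<nu>_def nn_integral_distr d linear_add [OF lin])
    also have "\<dots> = (\<integral>\<^sup>+x. f (T x) \<partial>distr lborel borel ((+) d))"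
      by (subst nn_integral_distr) simp_all
    also have "\<dots> = (\<integral>\<^sup>+x. f x \<partial>\<nu>)"
      by (simp add: lborel_distr_plus \<nu>_def nn_integral_distr)
    finally show ?thesis .
  qed
  have shift: "(\<integral>\<^sup>+x. f (c + x) \<partial>lborel) = (\<integral>\<^sup>+x. f x \<partial>lborel)"
    if "f \<in> borel_measurable borel" for f and c :: 'a
    using that by (intro nn_integral_distr_eq_self lborel_distr_plus) simp_all
  interpret P: pair_sigma_finite lborel \<nu> ..
  have "\<nu> = lborel"
  proof (rule measure_eqI)
    fix A assume "A \<in> sets \<nu>"
    then have A [measurable]: "A \<in> sets borel" by (simp add: \<nu>_def)
    \<comment> \<open>Evaluate the double integral of
      \<open>indicator A x * indicator B (y - x)\<close> in both orders, with a shift of x by y in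
      between. The ball reappears as the condition \<open>- x \<in> B\<close>; its symmetry and its
      invariance under \<open>T\<close> leave the same factor on both sides.\<close>
    have "emeasure \<nu> A * emeasure lborel B = (\<integral>\<^sup>+x. indicator A x * emeasure lborel B \<partial>\<nu>)"
      by (simp add: nn_integral_multc)
    also have "\<dots> = (\<integral>\<^sup>+x. \<integral>\<^sup>+y. indicator A x * indicator B (y - x) \<partial>lborel \<partial>\<nu>)"
    proof (rule nn_integral_cong)
      fix x :: 'a
      have "(\<integral>\<^sup>+y. indicator B (y - x) \<partial>lborel) = emeasure lborel B"
        using shift [OF borel_measurable_indicator [of B borel], of "- x"] by simp
      moreover have "(\<integral>\<^sup>+y. indicator A x * indicator B (y - x) \<partial>lborel) =
          indicator A x * (\<integral>\<^sup>+y. indicator B (y - x) \<partial>lborel)"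
        by (rule nn_integral_cmult) measurable
      ultimately show "indicator A x * emeasure lborel B =
          (\<integral>\<^sup>+y. indicator A x * indicator B (y - x) \<partial>lborel)"
        by (simp only:)
    qed
    also have "\<dots> = (\<integral>\<^sup>+y. \<integral>\<^sup>+x. indicator A x * indicator B (y - x) \<partial>\<nu> \<partial>lborel)"
      by (rule P.Fubini') measurable
    also have "\<dots> = (\<integral>\<^sup>+y. \<integral>\<^sup>+x. indicator A (y + x) * indicator B (- x) \<partial>\<nu> \<partial>lborel)"
    proof (rule nn_integral_cong)
      fix y :: 'a
      show "(\<integral>\<^sup>+x. indicator A x * indicator B (y - x) \<partial>\<nu>) =
            (\<integral>\<^sup>+x. indicator A (y + x) * indicator B (- x) \<partial>\<nu>)"
        by (subst shift_\<nu> [of _ y, symmetric]) simp_all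
    qed
    also have "\<dots> = (\<integral>\<^sup>+x. \<integral>\<^sup>+y. indicator A (y + x) * indicator B (- x) \<partial>lborel \<partial>\<nu>)"
      by (rule P.Fubini' [symmetric]) measurable
    also have "\<dots> = (\<integral>\<^sup>+x. emeasure lborel A * indicator B x \<partial>\<nu>)"
    proof (rule nn_integral_cong)
      fix x :: 'a
      have "(\<integral>\<^sup>+y. indicator A (x + y) \<partial>lborel) = emeasure lborel A"
        by (subst shift) simp_all
      moreover have "indicator B (- x) = (indicator B x :: ennreal)"
        by (simp add: indicator_def B_minus)
      ultimately show "(\<integral>\<^sup>+y. indicator A (y + x) * indicator B (- x) \<partial>lborel) =
          emeasure lborel A * indicator B x"
        by (simp add: nn_integral_multc add.commute)
    qed
    also have "\<dots> = emeasure lborel A * emeasure lborel B"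
      by (subst nn_integral_cmult) (simp_all add: ball)
    finally have "emeasure \<nu> A * emeasure lborel B = emeasure lborel A * emeasure lborel B" .
    moreover have "emeasure lborel B \<noteq> 0"
    proof -
      have "ennreal (unit_ball_vol (real DIM('a))) \<noteq> 0"
        using unit_ball_vol_pos [of "real DIM('a)"] by (simp add: ennreal_eq_0_iff not_le)
      then show ?thesis by (simp add: emeasure_ball B_def)
    qed
    moreover have "emeasure lborel B \<noteq> \<top>"
      using emeasure_lborel_ball_finite [of "0 :: 'a" 1] by (simp add: less_top B_def)
    ultimately show "emeasure \<nu> A = emeasure lborel A"
      by (simp add: mult.commute [of _ "emeasure lborel B"] ennreal_mult_cancel_left)
  qed (simp add: \<nu>_def)
  then show ?thesis by (simp add: \<nu>_def)
qed

text \<open>A disc of radius sqrt a has area pi a, so the squared modulus carries Lebesgue measure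
  to the constant density pi on the half line; comparing the two on the sets \<open>{..a}\<close>
  suffices.\<close>

lemma nn_integral_lborel_cmod_power2:
  assumes f [measurable]: "f \<in> borel_measurable borel"
  shows "(\<integral>\<^sup>+z. f ((cmod z)\<^sup>2) \<partial>lborel) = (\<integral>\<^sup>+u. ennreal pi * (f u * indicator {0..} u) \<partial>lborel)"
proof -
  let ?M = "distr (lborel :: complex measure) borel (\<lambda>z. (cmod z)\<^sup>2)"
  let ?N = "density lborel (\<lambda>u. ennreal pi * indicator {0..} u) :: real measure"
  have M: "emeasure ?M {..a} = (if a < 0 then 0 else ennreal (pi * a))" for a
  proof -
    have "(cmod z)\<^sup>2 \<le> a \<longleftrightarrow> 0 \<le> a \<and> cmod z \<le> sqrt a" for z
      using real_sqrt_le_iff [of "(cmod z)\<^sup>2" a] order_trans [OF zero_le_power2 [of "cmod z"], of a]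
      by auto
    then have "(\<lambda>z. (cmod z)\<^sup>2) -` {..a} \<inter> space lborel = (if a < 0 then {} else cball 0 (sqrt a))"
      by auto
    then show ?thesis
      by (simp add: emeasure_distr emeasure_cball eval_unit_ball_vol)
  qed
  have N: "emeasure ?N {..a} = (if a < 0 then 0 else ennreal (pi * a))" for a
  proof -
    have "emeasure ?N {..a} = (\<integral>\<^sup>+u. ennreal pi * indicator {0..a} u \<partial>lborel)"
      by (subst emeasure_density) (auto intro!: nn_integral_cong split: split_indicator)
    then show ?thesis
      by (simp add: nn_integral_cmult ennreal_mult)
  qed
  have "?M = ?N"
  proof (rule measure_eqI_generator_eq [of "range (\<lambda>a::real. {..a})" UNIV _ _ "\<lambda>n. {..real n}"])
    show "Int_stable (range (\<lambda>a::real. {..a}))"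
      by (auto simp: Int_stable_def Int_atMost)
    show "sets ?M = sigma_sets UNIV (range (\<lambda>a::real. {..a}))" "sets ?N = sigma_sets UNIV (range (\<lambda>a::real. {..a}))"
      by (simp_all add: borel_eq_atMost)
    show "(\<Union>n. {..real n}) = UNIV"
      using real_arch_simple by auto
  qed (auto simp: M N)
  have "(\<integral>\<^sup>+z. f ((cmod z)\<^sup>2) \<partial>lborel) = (\<integral>\<^sup>+u. f u \<partial>?M)"
    by (subst nn_integral_distr) simp_all
  also have "\<dots> = (\<integral>\<^sup>+u. f u \<partial>?N)"
    by (simp only: \<open>?M = ?N\<close>)
  also have "\<dots> = (\<integral>\<^sup>+u. ennreal pi * (f u * indicator {0..} u) \<partial>lborel)"
    by (simp add: nn_integral_density mult_ac)
  finally show ?thesis .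
qed

section \<open>Polar coordinates in the right half plane\<close>

lemma borel_measurable_tan_real [measurable]: "(tan :: real \<Rightarrow> real) \<in> borel_measurable borel"
  unfolding tan_def by measurable

text \<open>The substitution y = tan(phi), checked on intervals with the fundamental theorem of
  calculus.\<close>

lemma nn_integral_tan:
  assumes f [measurable]: "f \<in> borel_measurable borel"
  shows "(\<integral>\<^sup>+y. f y \<partial>lborel) =
    (\<integral>\<^sup>+\<phi>. f (tan \<phi>) * ennreal (1 / (cos \<phi>)\<^sup>2) * indicator {- pi / 2 <..< pi / 2} \<phi> \<partial>lborel)"
proof -
  let ?I = "{- pi / 2 <..< pi / 2}"
  let ?M = "density lborel (\<lambda>\<phi>. ennreal (1 / (cos \<phi>)\<^sup>2) * indicator ?I \<phi>)"
  have "lborel = distr ?M borel tan"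
  proof (rule lborel_eqI)
    fix l u :: real
    assume "\<And>b. b \<in> Basis \<Longrightarrow> l \<bullet> b \<le> u \<bullet> b"
    then have le: "l \<le> u" by simp
    have cos_pos: "0 < cos \<phi>" if "\<phi> \<in> {arctan l..arctan u}" for \<phi>
      using that arctan_lbound [of l] arctan_ubound [of u] by (intro cos_gt_zero_pi) auto
    have [measurable]: "(tan -` {l<..<u} :: real set) \<in> sets borel"
      by (rule measurable_sets_borel [where M = borel]) measurable
    have "emeasure (distr ?M borel tan) (box l u) =
        (\<integral>\<^sup>+\<phi>. ennreal (1 / (cos \<phi>)\<^sup>2) * indicator ?I \<phi> * indicator (tan -` {l<..<u}) \<phi> \<partial>lborel)"
      by (subst emeasure_distr, simp, simp, subst emeasure_density) simp_all
    also have "\<dots> = (\<integral>\<^sup>+\<phi>. ennreal (1 / (cos \<phi>)\<^sup>2) * indicator {arctan l<..<arctan u} \<phi> \<partial>lborel)"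
    proof (rule nn_integral_cong)
      fix \<phi> :: real
      have "\<phi> \<in> ?I \<and> tan \<phi> \<in> {l<..<u} \<longleftrightarrow> \<phi> \<in> {arctan l<..<arctan u}"
        using arctan_lbound [of l] arctan_ubound [of u] arctan_tan [of \<phi>]
          arctan_less_iff [of l "tan \<phi>"] arctan_less_iff [of "tan \<phi>" u] by auto
      then show "ennreal (1 / (cos \<phi>)\<^sup>2) * indicator ?I \<phi> * indicator (tan -` {l<..<u}) \<phi> =
          ennreal (1 / (cos \<phi>)\<^sup>2) * indicator {arctan l<..<arctan u} \<phi>"
        by (auto simp: indicator_def)
    qed
    also have "\<dots> = (\<integral>\<^sup>+\<phi>. ennreal (1 / (cos \<phi>)\<^sup>2) * indicator {arctan l..arctan u} \<phi> \<partial>lborel)"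
    proof (rule nn_integral_cong_AE)
      show "AE \<phi> in lborel. ennreal (1 / (cos \<phi>)\<^sup>2) * indicator {arctan l<..<arctan u} \<phi> =
          ennreal (1 / (cos \<phi>)\<^sup>2) * indicator {arctan l..arctan u} \<phi>"
        using AE_lborel_singleton [of "arctan l"] AE_lborel_singleton [of "arctan u"]
        by eventually_elim (auto simp: indicator_def)
    qed
    also have "\<dots> = ennreal (tan (arctan u) - tan (arctan l))"
    proof (rule nn_integral_FTC_Icc)
      show "(tan has_real_derivative 1 / (cos \<phi>)\<^sup>2) (at \<phi>)" if "\<phi> \<in> {arctan l..arctan u}" for \<phi>
        using DERIV_tan [of \<phi>] cos_pos [OF that] by (simp add: inverse_eq_divide)
    qed (use le in \<open>simp_all add: arctan_le_iff\<close>)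
    finally show "emeasure (distr ?M borel tan) (box l u) = ennreal (\<Prod>b\<in>Basis. (u - l) \<bullet> b)"
      by (simp add: tan_arctan)
  qed simp
  then have "(\<integral>\<^sup>+y. f y \<partial>lborel) = (\<integral>\<^sup>+y. f y \<partial>distr ?M borel tan)"
    by simp
  also have "\<dots> = (\<integral>\<^sup>+\<phi>. f (tan \<phi>) \<partial>?M)"
    by (rule nn_integral_distr) measurable
  also have "\<dots> = (\<integral>\<^sup>+\<phi>. ennreal (1 / (cos \<phi>)\<^sup>2) * indicator ?I \<phi> * f (tan \<phi>) \<partial>lborel)"
    by (rule nn_integral_density) measurable
  finally show ?thesis by (simp add: mult_ac)
qed

text \<open>Two substitutions in one variable: y = x tan(phi) for fixed x > 0, then, after
  exchanging the integrals, x = r cos(phi) for fixed phi. The factors x / cos(phi)^2 and cos(phi)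
  combine to r.\<close>

lemma nn_integral_half_plane_polar:
  assumes f [measurable]: "f \<in> borel_measurable borel"
  shows "(\<integral>\<^sup>+z. f z * indicator {z. 0 < Re z} z \<partial>lborel) =
    (\<integral>\<^sup>+\<phi>. \<integral>\<^sup>+r. f (of_real r * cis \<phi>) * ennreal r * indicator {0<..} r *
       indicator {- pi / 2 <..< pi / 2} \<phi> \<partial>lborel \<partial>lborel)"
proof -
  let ?I = "{- pi / 2 <..< pi / 2}"
  have [measurable]: "(\<lambda>x. Complex (g x) (h x)) \<in> borel_measurable M"
    if [measurable]: "g \<in> borel_measurable M" "h \<in> borel_measurable M" for g h and M :: "'x measure"
    by (subst borel_measurable_complex_iff) simp
  have "(\<integral>\<^sup>+z. f z * indicator {z. 0 < Re z} z \<partial>lborel) =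
      (\<integral>\<^sup>+x. \<integral>\<^sup>+y. f (Complex x y) * indicator {0<..} x \<partial>lborel \<partial>lborel)"
    by (subst nn_integral_lborel_complex) (auto simp: indicator_def intro!: nn_integral_cong)
  also have "\<dots> = (\<integral>\<^sup>+x. \<integral>\<^sup>+\<phi>. f (Complex x (x * tan \<phi>)) * ennreal (x / (cos \<phi>)\<^sup>2) *
      indicator {0<..} x * indicator ?I \<phi> \<partial>lborel \<partial>lborel)"
  proof (rule nn_integral_cong)
    fix x :: real
    show "(\<integral>\<^sup>+y. f (Complex x y) * indicator {0<..} x \<partial>lborel) =
      (\<integral>\<^sup>+\<phi>. f (Complex x (x * tan \<phi>)) * ennreal (x / (cos \<phi>)\<^sup>2) *
         indicator {0<..} x * indicator ?I \<phi> \<partial>lborel)"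
    proof (cases "0 < x")
      case True
      then have "(\<integral>\<^sup>+y. f (Complex x y) * indicator {0<..} x \<partial>lborel) =
          ennreal x * (\<integral>\<^sup>+y. f (Complex x (x * y)) \<partial>lborel)"
        by (subst nn_integral_real_affine [where c = x and t = 0]) simp_all
      also have "\<dots> = ennreal x * (\<integral>\<^sup>+\<phi>. f (Complex x (x * tan \<phi>)) * ennreal (1 / (cos \<phi>)\<^sup>2) *
          indicator ?I \<phi> \<partial>lborel)"
        by (subst nn_integral_tan) simp_all
      also have "\<dots> = (\<integral>\<^sup>+\<phi>. ennreal x * (f (Complex x (x * tan \<phi>)) * ennreal (1 / (cos \<phi>)\<^sup>2) *
          indicator ?I \<phi>) \<partial>lborel)"
        by (rule nn_integral_cmult [symmetric]) measurable
      also have "\<dots> = (\<integral>\<^sup>+\<phi>. f (Complex x (x * tan \<phi>)) * ennreal (x / (cos \<phi>)\<^sup>2) *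
         indicator {0<..} x * indicator ?I \<phi> \<partial>lborel)"
      proof (rule nn_integral_cong)
        fix \<phi> :: real
        have "ennreal (x / (cos \<phi>)\<^sup>2) = ennreal x * ennreal (1 / (cos \<phi>)\<^sup>2)"
          using True by (subst ennreal_mult [symmetric]) auto
        then show "ennreal x * (f (Complex x (x * tan \<phi>)) * ennreal (1 / (cos \<phi>)\<^sup>2) * indicator ?I \<phi>) =
          f (Complex x (x * tan \<phi>)) * ennreal (x / (cos \<phi>)\<^sup>2) * indicator {0<..} x * indicator ?I \<phi>"
          using True by (simp add: mult_ac)
      qed
      finally show ?thesis .
    qed simp
  qed
  also have "\<dots> = (\<integral>\<^sup>+\<phi>. \<integral>\<^sup>+x. f (Complex x (x * tan \<phi>)) * ennreal (x / (cos \<phi>)\<^sup>2) *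
      indicator {0<..} x * indicator ?I \<phi> \<partial>lborel \<partial>lborel)"
    by (rule lborel_pair.Fubini') measurable
  also have "\<dots> = (\<integral>\<^sup>+\<phi>. \<integral>\<^sup>+r. f (of_real r * cis \<phi>) * ennreal r * indicator {0<..} r *
       indicator ?I \<phi> \<partial>lborel \<partial>lborel)"
  proof (rule nn_integral_cong)
    fix \<phi> :: real
    show "(\<integral>\<^sup>+x. f (Complex x (x * tan \<phi>)) * ennreal (x / (cos \<phi>)\<^sup>2) *
      indicator {0<..} x * indicator ?I \<phi> \<partial>lborel) =
      (\<integral>\<^sup>+r. f (of_real r * cis \<phi>) * ennreal r * indicator {0<..} r * indicator ?I \<phi> \<partial>lborel)"
      (is "?lhs = ?rhs")
    proof (cases "\<phi> \<in> ?I")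
      case True
      then have c: "0 < cos \<phi>" by (intro cos_gt_zero_pi) auto
      have "?lhs = ennreal (cos \<phi>) * (\<integral>\<^sup>+r. f (Complex (cos \<phi> * r) (cos \<phi> * r * tan \<phi>)) *
          ennreal (cos \<phi> * r / (cos \<phi>)\<^sup>2) * indicator {0<..} (cos \<phi> * r) * indicator ?I \<phi> \<partial>lborel)"
        using c by (subst nn_integral_real_affine [where c = "cos \<phi>" and t = 0]) simp_all
      also have "\<dots> = (\<integral>\<^sup>+r. ennreal (cos \<phi>) * (f (Complex (cos \<phi> * r) (cos \<phi> * r * tan \<phi>)) *
          ennreal (cos \<phi> * r / (cos \<phi>)\<^sup>2) * indicator {0<..} (cos \<phi> * r) * indicator ?I \<phi>) \<partial>lborel)"
        by (rule nn_integral_cmult [symmetric]) measurable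
      also have "\<dots> = ?rhs"
      proof (rule nn_integral_cong)
        fix r :: real
        have "Complex (cos \<phi> * r) (cos \<phi> * r * tan \<phi>) = of_real r * cis \<phi>"
          using c by (simp add: complex_eq_iff tan_def)
        moreover have "ennreal r = ennreal (cos \<phi>) * ennreal (cos \<phi> * r / (cos \<phi>)\<^sup>2)"
          if "0 < r"
          using c that by (subst ennreal_mult [symmetric]) (auto simp: power2_eq_square)
        moreover have "0 < cos \<phi> * r \<longleftrightarrow> 0 < r"
          using c by (simp add: zero_less_mult_iff)
        ultimately show "ennreal (cos \<phi>) * (f (Complex (cos \<phi> * r) (cos \<phi> * r * tan \<phi>)) *
          ennreal (cos \<phi> * r / (cos \<phi>)\<^sup>2) * indicator {0<..} (cos \<phi> * r) * indicator ?I \<phi>) =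
          f (of_real r * cis \<phi>) * ennreal r * indicator {0<..} r * indicator ?I \<phi>"
          by (auto simp: indicator_def mult_ac)
      qed
      finally show ?thesis .
    qed simp
  qed
  finally show ?thesis .
qed

section \<open>Rotation invariant laws\<close>

definition rotation_invariant :: "complex measure \<Rightarrow> bool" where
  "rotation_invariant \<zeta> \<longleftrightarrow> prob_space \<zeta> \<and> sets \<zeta> = sets borel \<and>
     (\<forall>c. cmod c = 1 \<longrightarrow> distr \<zeta> borel (\<lambda>z. c * z) = \<zeta>)"

lemma rotation_invariantD:
  assumes "rotation_invariant \<zeta>"
  shows "prob_space \<zeta>" "sets \<zeta> = sets borel" "cmod c = 1 \<Longrightarrow> distr \<zeta> borel (\<lambda>z. c * z) = \<zeta>"
  using assms by (auto simp: rotation_invariant_def)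

lemma rotation_invariant_nn_integral:
  assumes "rotation_invariant \<zeta>" "cmod c = 1" "f \<in> borel_measurable borel"
  shows "(\<integral>\<^sup>+z. f (c * z) \<partial>\<zeta>) = (\<integral>\<^sup>+z. f z \<partial>\<zeta>)"
  using assms by (intro nn_integral_distr_eq_self rotation_invariantD) simp_all

lemma borel_measurable_sgn_complex [measurable (raw)]:
  fixes f :: "'a \<Rightarrow> complex"
  assumes [measurable]: "f \<in> borel_measurable M"
  shows "(\<lambda>x. sgn (f x)) \<in> borel_measurable M"
  unfolding sgn_eq by measurable

lemma norm_sgn_complex: "w \<noteq> 0 \<Longrightarrow> cmod (sgn w) = 1" for w :: complex
  by (simp add: norm_sgn)

text \<open>Multiplying by an independent uniform phase does not change a rotation invariant law, and it
  makes the original phase irrelevant.\<close>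

lemma rotation_invariant_mix:
  assumes \<zeta>: "rotation_invariant \<zeta>" and \<eta>: "rotation_invariant \<eta>" and nz: "AE w in \<eta>. w \<noteq> 0"
    and f [measurable]: "f \<in> borel_measurable borel"
  shows "(\<integral>\<^sup>+z. f z \<partial>\<zeta>) = (\<integral>\<^sup>+z. \<integral>\<^sup>+w. f (of_real (cmod z) * sgn w) \<partial>\<eta> \<partial>\<zeta>)"
proof -
  note [measurable_cong] = rotation_invariantD(2) [OF \<zeta>] rotation_invariantD(2) [OF \<eta>]
  interpret \<zeta>: prob_space \<zeta> by (rule rotation_invariantD [OF \<zeta>])
  interpret \<eta>: prob_space \<eta> by (rule rotation_invariantD [OF \<eta>])
  interpret pair_sigma_finite \<eta> \<zeta> ..
  have "(\<integral>\<^sup>+z. f z \<partial>\<zeta>) = (\<integral>\<^sup>+w. \<integral>\<^sup>+z. f z \<partial>\<zeta> \<partial>\<eta>)"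
    by (simp add: \<eta>.emeasure_space_1)
  also have "\<dots> = (\<integral>\<^sup>+w. \<integral>\<^sup>+z. f (sgn w * z) \<partial>\<zeta> \<partial>\<eta>)"
  proof (rule nn_integral_cong_AE)
    show "AE w in \<eta>. (\<integral>\<^sup>+z. f z \<partial>\<zeta>) = (\<integral>\<^sup>+z. f (sgn w * z) \<partial>\<zeta>)"
      using nz
    proof eventually_elim
      case (elim w)
      show ?case
        by (rule rotation_invariant_nn_integral [OF \<zeta> norm_sgn_complex [OF elim] f, symmetric])
    qed
  qed
  also have "\<dots> = (\<integral>\<^sup>+z. \<integral>\<^sup>+w. f (sgn w * z) \<partial>\<eta> \<partial>\<zeta>)"
    by (rule Fubini' [symmetric]) measurable
  also have "\<dots> = (\<integral>\<^sup>+z. \<integral>\<^sup>+w. f (of_real (cmod z) * sgn w) \<partial>\<eta> \<partial>\<zeta>)"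
  proof (rule nn_integral_cong)
    fix z :: complex
    show "(\<integral>\<^sup>+w. f (sgn w * z) \<partial>\<eta>) = (\<integral>\<^sup>+w. f (of_real (cmod z) * sgn w) \<partial>\<eta>)"
    proof (cases "z = 0")
      case False
      have z: "z = of_real (cmod z) * sgn z"
        by (simp add: sgn_eq)
      have "of_real (cmod z) * sgn (sgn z * w) = sgn w * z" for w
      proof -
        have "of_real (cmod z) * sgn (sgn z * w) = (of_real (cmod z) * sgn z) * sgn w"
          by (simp add: sgn_mult mult.assoc)
        also have "\<dots> = sgn w * z"
          by (subst z [symmetric]) (rule mult.commute)
        finally show ?thesis .
      qed
      then show ?thesis
        using rotation_invariant_nn_integral [OF \<eta> norm_sgn_complex [OF False],
            of "\<lambda>w. f (of_real (cmod z) * sgn w)"]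
        by simp
    qed simp
  qed
  finally show ?thesis .
qed

text \<open>\<open>rotation_invariant_mix\<close> writes both laws as a modulus times an independent
  phase taken from \<open>\<eta>\<close>; for \<open>\<eta>\<close> itself the lemma is applied with
  both laws equal.\<close>

lemma rotation_invariant_unique:
  assumes \<zeta>: "rotation_invariant \<zeta>" and \<eta>: "rotation_invariant \<eta>" and nz: "AE w in \<eta>. w \<noteq> 0"
    and radial: "distr \<zeta> borel cmod = distr \<eta> borel cmod"
  shows "\<zeta> = \<eta>"
proof (rule measure_eqI)
  note [measurable_cong] = rotation_invariantD(2) [OF \<zeta>] rotation_invariantD(2) [OF \<eta>]
  interpret \<eta>: prob_space \<eta> by (rule rotation_invariantD [OF \<eta>])
  fix A assume "A \<in> sets \<zeta>"
  then have A [measurable]: "A \<in> sets borel" by (simp add: rotation_invariantD(2) [OF \<zeta>])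
  define f :: "complex \<Rightarrow> ennreal" where "f = indicator A"
  have f [measurable]: "f \<in> borel_measurable borel" by (simp add: f_def)
  define g where "g r = (\<integral>\<^sup>+w. f (of_real r * sgn w) \<partial>\<eta>)" for r
  have g [measurable]: "g \<in> borel_measurable borel"
    unfolding g_def by measurable
  have "emeasure \<zeta> A = (\<integral>\<^sup>+z. f z \<partial>\<zeta>)"
    by (simp add: f_def rotation_invariantD(2) [OF \<zeta>])
  also have "\<dots> = (\<integral>\<^sup>+z. g (cmod z) \<partial>\<zeta>)"
    unfolding g_def by (rule rotation_invariant_mix [OF \<zeta> \<eta> nz f])
  also have "\<dots> = (\<integral>\<^sup>+r. g r \<partial>distr \<zeta> borel cmod)"
    by (rule nn_integral_distr [symmetric]) measurable
  also have "\<dots> = (\<integral>\<^sup>+z. g (cmod z) \<partial>\<eta>)"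
    unfolding radial by (rule nn_integral_distr) measurable
  also have "\<dots> = (\<integral>\<^sup>+z. f z \<partial>\<eta>)"
    unfolding g_def by (rule rotation_invariant_mix [OF \<eta> \<eta> nz f, symmetric])
  also have "\<dots> = emeasure \<eta> A"
    by (simp add: f_def rotation_invariantD(2) [OF \<eta>])
  finally show "emeasure \<zeta> A = emeasure \<eta> A" .
qed (simp add: rotation_invariantD(2) [OF \<zeta>] rotation_invariantD(2) [OF \<eta>])

section \<open>The law of one coordinate of a uniform unit vector\<close>

text \<open>Here the complex dimension of the unit vector is m + 2. In dimension 1 the coordinate
  lies on the circle and has no density, so that case is treated apart.\<close>

definition disc_density :: "nat \<Rightarrow> complex \<Rightarrow> ennreal" where
  "disc_density m z = ennreal (real (m + 1) / pi * (1 - (cmod z)\<^sup>2) ^ m) * indicator {z. cmod z < 1} z"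

definition disc_law :: "nat \<Rightarrow> complex measure" where
  "disc_law m = density lborel (disc_density m)"

lemma sets_disc_law [simp, measurable_cong]: "sets (disc_law m) = sets borel"
  by (simp add: disc_law_def)

lemma borel_measurable_disc_density [measurable]: "disc_density m \<in> borel_measurable borel"
  unfolding disc_density_def by measurable

lemma nn_integral_disc_law:
  assumes [measurable]: "f \<in> borel_measurable borel"
  shows "(\<integral>\<^sup>+z. f z \<partial>disc_law m) = (\<integral>\<^sup>+z. disc_density m z * f z \<partial>lborel)"
  unfolding disc_law_def by (rule nn_integral_density) measurable

text \<open>The squared modulus has density (m + 1) (1 - u)^m on the unit interval, the constant 1 /
  pi being cancelled by the area factor.\<close>

lemma disc_law_tail:
  assumes s: "0 \<le> s" "s \<le> 1"
  shows "emeasure (disc_law m) {z. s < (cmod z)\<^sup>2} = ennreal ((1 - s) ^ (m + 1))"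
proof -
  have "(\<lambda>z :: complex. indicator {s<..} ((cmod z)\<^sup>2) :: ennreal) = indicator {z. s < (cmod z)\<^sup>2}"
    by (auto simp: indicator_def)
  then have "emeasure (disc_law m) {z. s < (cmod z)\<^sup>2} =
      (\<integral>\<^sup>+z. indicator {s<..} ((cmod z)\<^sup>2) \<partial>disc_law m)"
    by (simp only:) (rule nn_integral_indicator [symmetric], simp)
  also have "\<dots> = (\<integral>\<^sup>+z. disc_density m z * indicator {s<..} ((cmod z)\<^sup>2) \<partial>lborel)"
    by (rule nn_integral_disc_law) measurable
  also have "\<dots> = (\<integral>\<^sup>+z. (\<lambda>u. ennreal (real (m + 1) / pi * (1 - u) ^ m) * indicator {s<..<1} u) ((cmod z)\<^sup>2) \<partial>lborel)"
    by (intro nn_integral_cong)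
       (auto simp: disc_density_def indicator_def power_less_one_iff abs_square_less_1)
  also have "\<dots> = (\<integral>\<^sup>+u. ennreal pi *
      (ennreal (real (m + 1) / pi * (1 - u) ^ m) * indicator {s<..<1} u * indicator {0..} u) \<partial>lborel)"
    by (rule nn_integral_lborel_cmod_power2) measurable
  also have "\<dots> = (\<integral>\<^sup>+u. ennreal (real (m + 1) * (1 - u) ^ m) * indicator {s..1} u \<partial>lborel)"
  proof (rule nn_integral_cong_AE)
    show "AE u in lborel. ennreal pi *
        (ennreal (real (m + 1) / pi * (1 - u) ^ m) * indicator {s<..<1} u * indicator {0..} u) =
        ennreal (real (m + 1) * (1 - u) ^ m) * indicator {s..1} u"
      using AE_lborel_singleton [of s] AE_lborel_singleton [of 1]
    proof eventually_elim
      case (elim u)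
      then show ?case
        using s by (auto simp: indicator_def ennreal_mult [symmetric])
    qed
  qed
  also have "\<dots> = ennreal ((- ((1 - 1) ^ (m + 1))) - (- ((1 - s) ^ (m + 1))))"
  proof (rule nn_integral_FTC_Icc [where F = "\<lambda>u. - ((1 - u) ^ (m + 1))"])
    fix u :: real
    show "((\<lambda>u. - ((1 - u) ^ (m + 1))) has_real_derivative real (m + 1) * (1 - u) ^ m) (at u)"
      by (rule DERIV_cong, rule DERIV_minus, rule DERIV_power, rule DERIV_diff, rule DERIV_const, rule DERIV_ident)
         simp
  qed (use s in auto)
  finally show ?thesis by simp
qed

lemma disc_law_AE: "AE z in disc_law m. cmod z < 1" "AE z in disc_law m. z \<noteq> 0"
proof -
  show "AE z in disc_law m. cmod z < 1"
    unfolding disc_law_def by (subst AE_density) (auto simp: disc_density_def indicator_def)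
  have "AE z in lborel. z \<noteq> (0 :: complex)"
    by (rule AE_lborel_singleton)
  then show "AE z in disc_law m. z \<noteq> 0"
    unfolding disc_law_def by (subst AE_density) (auto elim: eventually_mono)
qed

text \<open>The total mass is the tail at s = 0, because the origin is a null set.\<close>

lemma prob_space_disc_law: "prob_space (disc_law m)"
proof
  have "emeasure (disc_law m) (space (disc_law m)) = emeasure (disc_law m) {z. 0 < (cmod z)\<^sup>2}"
    by (rule emeasure_eq_AE) (use disc_law_AE(2) [of m] in \<open>auto elim!: eventually_mono simp: disc_law_def\<close>)
  then show "emeasure (disc_law m) (space (disc_law m)) = 1"
    using disc_law_tail [of 0 m] by simp
qed

lemma nn_integral_lborel_rotation:
  assumes "cmod c = 1" and "f \<in> borel_measurable borel"
  shows "(\<integral>\<^sup>+z. f (c * z) \<partial>lborel) = (\<integral>\<^sup>+z. f z \<partial>lborel)"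
  using assms by (intro nn_integral_distr_eq_self lborel_distr_isometry)
    (auto simp: norm_mult bounded_linear_mult_right bounded_linear.linear)

lemma rotation_invariant_disc_law: "rotation_invariant (disc_law m)"
  unfolding rotation_invariant_def
proof (intro conjI allI impI prob_space_disc_law)
  fix c :: complex assume c: "cmod c = 1"
  show "distr (disc_law m) borel (\<lambda>z. c * z) = disc_law m"
  proof (rule measure_eqI)
    fix A assume "A \<in> sets (distr (disc_law m) borel (\<lambda>z. c * z))"
    then have [measurable]: "A \<in> sets borel" by simp
    have "emeasure (distr (disc_law m) borel (\<lambda>z. c * z)) A =
        (\<integral>\<^sup>+z. indicator A z \<partial>distr (disc_law m) borel (\<lambda>z. c * z))"
      by simp
    also have "\<dots> = (\<integral>\<^sup>+z. indicator A (c * z) \<partial>disc_law m)"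
      by (rule nn_integral_distr) measurable
    also have "\<dots> = (\<integral>\<^sup>+z. disc_density m z * indicator A (c * z) \<partial>lborel)"
      by (rule nn_integral_disc_law) measurable
    also have "\<dots> = (\<integral>\<^sup>+z. disc_density m (c * z) * indicator A (c * z) \<partial>lborel)"
      by (simp add: disc_density_def norm_mult c indicator_def)
    also have "\<dots> = (\<integral>\<^sup>+z. disc_density m z * indicator A z \<partial>lborel)"
      by (rule nn_integral_lborel_rotation [OF c]) measurable
    also have "\<dots> = (\<integral>\<^sup>+z. indicator A z \<partial>disc_law m)"
      by (rule nn_integral_disc_law [symmetric]) measurable
    finally show "emeasure (distr (disc_law m) borel (\<lambda>z. c * z)) A = emeasure (disc_law m) A"
      by simp
  qed simp
qed simp

text \<open>Rotation invariance leaves only the law of the modulus to be compared: the tails decide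
  it below level 1, and \<open>le1\<close> decides it from there on.\<close>

lemma rotation_invariant_eq_disc_law:
  assumes \<zeta>: "rotation_invariant \<zeta>" and le1: "AE z in \<zeta>. cmod z \<le> 1"
    and tail: "\<And>s. 0 \<le> s \<Longrightarrow> s < 1 \<Longrightarrow> emeasure \<zeta> {z. s < (cmod z)\<^sup>2} = ennreal ((1 - s) ^ (m + 1))"
  shows "\<zeta> = disc_law m"
proof (rule rotation_invariant_unique [OF \<zeta> rotation_invariant_disc_law disc_law_AE(2)])
  note [measurable_cong] = rotation_invariantD(2) [OF \<zeta>]
  have sp: "space \<zeta> = UNIV"
    using rotation_invariantD(2) [OF \<zeta>] by (metis sets_eq_imp_space_eq space_borel)
  interpret \<zeta>: prob_space \<zeta> by (rule rotation_invariantD [OF \<zeta>])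
  interpret \<eta>: prob_space "disc_law m" by (rule prob_space_disc_law)
  show "distr \<zeta> borel cmod = distr (disc_law m) borel cmod"
  proof (rule measure_eqI_lessThan)
    fix x :: real
    have e1: "emeasure (distr \<zeta> borel cmod) {x<..} = emeasure \<zeta> {z. x < cmod z}"
      by (subst emeasure_distr) (auto simp: sp intro!: arg_cong [where f = "emeasure \<zeta>"])
    have e2: "emeasure (distr (disc_law m) borel cmod) {x<..} = emeasure (disc_law m) {z. x < cmod z}"
      by (subst emeasure_distr) (auto simp: disc_law_def intro!: arg_cong2 [where f = emeasure])
    show "emeasure (distr \<zeta> borel cmod) {x<..} < \<infinity>"
      using \<zeta>.emeasure_finite unfolding e1 by (simp add: less_top [symmetric])
    consider "x < 0" | "0 \<le> x" "x < 1" | "1 \<le> x" by linarith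
    then show "emeasure (distr \<zeta> borel cmod) {x<..} = emeasure (distr (disc_law m) borel cmod) {x<..}"
    proof cases
      case 1
      then have "{z :: complex. x < cmod z} = UNIV"
        by (auto intro: less_le_trans)
      then show ?thesis
        using \<zeta>.emeasure_space_1 \<eta>.emeasure_space_1 unfolding e1 e2 by (simp add: sp disc_law_def)
    next
      case 2
      then have "{z. x < cmod z} = {z :: complex. x\<^sup>2 < (cmod z)\<^sup>2}"
        by (auto intro: power_strict_mono simp: power2_less_imp_less)
      then show ?thesis
        using 2 tail [of "x\<^sup>2"] disc_law_tail [of "x\<^sup>2" m] unfolding e1 e2
        by (simp add: power_le_one power_less_one_iff abs_square_less_1)
    next
      case 3
      have "AE z in \<zeta>. \<not> x < cmod z"
        using le1 by eventually_elim (use 3 in simp)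
      then have "emeasure \<zeta> {z. x < cmod z} = 0"
        using emeasure_eq_0_AE [of "\<lambda>z. x < cmod z" \<zeta>] by (simp add: sp)
      moreover have "AE z in disc_law m. \<not> x < cmod z"
        using disc_law_AE(1) [of m] by eventually_elim (use 3 in simp)
      then have "emeasure (disc_law m) {z. x < cmod z} = 0"
        using emeasure_eq_0_AE [of "\<lambda>z. x < cmod z" "disc_law m"] by (simp add: disc_law_def)
      ultimately show ?thesis unfolding e1 e2 by simp
    qed
  qed simp_all
qed

section \<open>Polar coordinates around 1\<close>

lemma nn_integral_lborel_reflect:
  fixes f :: "complex \<Rightarrow> ennreal"
  assumes [measurable]: "f \<in> borel_measurable borel"
  shows "(\<integral>\<^sup>+z. f (c - z) \<partial>lborel) = (\<integral>\<^sup>+z. f z \<partial>lborel)"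
proof -
  have "(\<integral>\<^sup>+z. f z \<partial>lborel) = (\<integral>\<^sup>+z. f (c + z) \<partial>lborel)"
    by (intro nn_integral_distr_eq_self [symmetric] lborel_distr_plus) simp_all
  also have "\<dots> = (\<integral>\<^sup>+z. f (c + (-1) * z) \<partial>lborel)"
    by (rule nn_integral_lborel_rotation [symmetric]) simp_all
  finally show ?thesis by simp
qed

text \<open>The arctangent formula makes Borel measurability evident and agrees with the imaginary
  part of \<open>Ln\<close> in the right half plane.\<close>

definition half_arg :: "complex \<Rightarrow> real" where
  "half_arg z = arctan (Im z / Re z)"

abbreviation polar :: "complex \<Rightarrow> real \<times> real" where
  "polar z \<equiv> (half_arg z, cmod z)"

lemma borel_measurable_half_arg [measurable]: "half_arg \<in> borel_measurable borel"
  unfolding half_arg_def by measurable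

lemma Im_Ln_eq_half_arg: "0 < Re z \<Longrightarrow> Im (Ln z) = half_arg z"
  unfolding half_arg_def by (metis Arg_eq_Im_Ln arg_conv_arctan order_less_irrefl zero_complex.simps(1))

lemma half_arg_polar:
  assumes "0 < r" "\<phi> \<in> {- pi / 2 <..< pi / 2}"
  shows "half_arg (of_real r * cis \<phi>) = \<phi>"
proof -
  have "0 < cos \<phi>" using assms by (intro cos_gt_zero_pi) auto
  then have "Im (of_real r * cis \<phi>) / Re (of_real r * cis \<phi>) = tan \<phi>"
    using assms by (simp add: tan_def)
  then show ?thesis
    using assms by (simp add: half_arg_def arctan_tan)
qed

text \<open>On the left is the constant of \<open>disc_density m\<close> with the power of 4
  collected from the density and the Jacobian; on the right are the normalising constants of the two
  factors, in which \<open>fact (2 * (m + 1))\<close> cancels.\<close>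

lemma cos_beta_constants:
  "real (m + 1) / pi * 4 ^ (m + 1) =
   2 ^ (2 * (m + 1)) * (fact (m + 1))\<^sup>2 / (pi * fact (2 * (m + 1))) *
   (Gamma (real (m + 2) + (real (m + 2) - 1)) / (Gamma (real (m + 2)) * Gamma (real (m + 2) - 1)))"
proof -
  have "Gamma (real (m + 2) + (real (m + 2) - 1)) = fact (2 * (m + 1))"
    using Gamma_fact [of "2 * (m + 1)", where 'a = real] by (simp add: algebra_simps)
  moreover have "Gamma (real (m + 2)) = fact (m + 1)"
    using Gamma_fact [of "m + 1", where 'a = real] by (simp add: algebra_simps)
  moreover have "Gamma (real (m + 2) - 1) = fact m"
    using Gamma_fact [of m, where 'a = real] by (simp add: algebra_simps)
  moreover have "(4 :: real) ^ (m + 1) = 2 ^ (2 * (m + 1))"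
    by (simp add: power_mult)
  moreover have "(fact (m + 1) :: real) = real (m + 1) * fact m"
    by simp
  moreover have "M / pi * p = p * (M * a)\<^sup>2 / (pi * F) * (F / (M * a * a))"
    if "0 < M" "0 < a" "0 < F" for M a F p :: real
    using that by (simp add: power2_eq_square field_simps)
  ultimately show ?thesis
    by (simp only: fact_gt_zero of_nat_0_less_iff zero_less_Suc add_gr_0 zero_less_one simp_thms)
qed

lemma cos_density_nonneg: "0 \<le> cos_density k v"
  by (simp add: cos_density_def power_mult)

lemma beta_density_nonneg: "0 < a \<Longrightarrow> 0 < b \<Longrightarrow> 0 \<le> beta_density a b t"
  by (simp add: beta_density_def Gamma_real_pos less_imp_le)

text \<open>For w = 2 t cos(phi) e^(i phi) one has 1 - |1 - w|^2 = 4 cos(phi)^2 t (1 - t), so the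
  density separates into a function of phi and a function of t; the disc becomes 0 < t < 1.\<close>

lemma polar_disc_density:
  assumes "\<phi> \<in> {- pi / 2 <..< pi / 2}" "t \<noteq> 0"
  shows "ennreal (2 * cos \<phi>) * (disc_density m (1 - of_real (2 * cos \<phi> * t) * cis \<phi>) *
      ennreal (2 * cos \<phi> * t) * indicator {0<..} (2 * cos \<phi> * t)) =
      ennreal (cos_density (m + 1) \<phi>) * ennreal (beta_density (real (m + 2)) (real (m + 2) - 1) t)"
    (is "?lhs = _")
proof -
  have c: "0 < cos \<phi>" using assms by (intro cos_gt_zero_pi) auto
  let ?w = "of_real (2 * cos \<phi> * t) * cis \<phi>"
  have norm: "(cmod (1 - ?w))\<^sup>2 = 1 - 4 * (cos \<phi>)\<^sup>2 * (t * (1 - t))"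
  proof -
    have "(1 - 2 * c * t * c)\<^sup>2 + (2 * c * t * s)\<^sup>2 = 1 - 4 * c\<^sup>2 * t + 4 * c\<^sup>2 * t\<^sup>2 * (s\<^sup>2 + c\<^sup>2)" for c s :: real
      by (simp add: power2_eq_square algebra_simps)
    from this [of "cos \<phi>" "sin \<phi>"]
    have "(cmod (1 - ?w))\<^sup>2 = 1 - 4 * (cos \<phi>)\<^sup>2 * t + 4 * (cos \<phi>)\<^sup>2 * t\<^sup>2"
      unfolding cmod_power2 by simp
    then show ?thesis by (simp add: power2_eq_square algebra_simps)
  qed
  show ?thesis
  proof (cases "0 < t \<and> t < 1")
    case True
    have "cmod (1 - ?w) < 1"
    proof -
      have "0 < 4 * (cos \<phi>)\<^sup>2 * (t * (1 - t))" using True c by simp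
      then have "(cmod (1 - ?w))\<^sup>2 < 1" unfolding norm by simp
      then show ?thesis by (simp add: abs_square_less_1)
    qed
    moreover have "0 < 2 * cos \<phi> * t" using True c by simp
    ultimately have "?lhs =
      ennreal (2 * cos \<phi> * (real (m + 1) / pi * (4 * (cos \<phi>)\<^sup>2 * (t * (1 - t))) ^ m * (2 * cos \<phi> * t)))"
      using c True unfolding disc_density_def norm by (simp add: ennreal_mult [symmetric])
    also have "2 * cos \<phi> * (real (m + 1) / pi * (4 * (cos \<phi>)\<^sup>2 * (t * (1 - t))) ^ m * (2 * cos \<phi> * t)) =
      (real (m + 1) / pi * 4 ^ (m + 1)) * cos \<phi> ^ (2 * (m + 1)) * (t ^ (m + 1) * (1 - t) ^ m)"
    proof -
      have "2 * c * (M * (4 * c\<^sup>2 * (t * u)) ^ m * (2 * c * t)) = (M * 4 ^ (m + 1)) * c ^ (2 * (m + 1)) * (t ^ (m + 1) * u ^ m)"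
        for c u M :: real
        by (simp add: power_mult power2_eq_square power_mult_distrib mult_ac)
      then show ?thesis .
    qed
    also have "\<dots> = cos_density (m + 1) \<phi> * beta_density (real (m + 2)) (real (m + 2) - 1) t"
    proof -
      have "t powr (real (m + 2) - 1) = t ^ (m + 1)" "(1 - t) powr (real (m + 2) - 1 - 1) = (1 - t) ^ m"
        using True powr_realpow [of t "m + 1"] powr_realpow [of "1 - t" m] by (simp_all add: add.commute)
      then show ?thesis
        unfolding cos_beta_constants cos_density_def beta_density_def
        using True assms by simp
    qed
    also have "ennreal \<dots> = ennreal (cos_density (m + 1) \<phi>) * ennreal (beta_density (real (m + 2)) (real (m + 2) - 1) t)"
      by (rule ennreal_mult) (simp_all add: cos_density_nonneg beta_density_nonneg)
    finally show ?thesis .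
  next
    case False
    have "1 \<le> (cmod (1 - ?w))\<^sup>2" if "1 \<le> t"
      unfolding norm using that by (simp add: mult_nonneg_nonpos)
    then have "\<not> cmod (1 - ?w) < 1" if "1 \<le> t"
      using that abs_square_less_1 [of "cmod (1 - ?w)"] by fastforce
    moreover have "\<not> 0 < 2 * cos \<phi> * t" if "t \<le> 0"
      using that c by (simp add: mult_nonpos_nonneg not_less)
    ultimately have "?lhs = 0"
      using False by (cases "1 \<le> t") (auto simp: disc_density_def)
    \<comment> \<open>At t = 1 the beta density vanishes even for m = 0, because
      \<open>0 powr 0 = 0\<close>; this matches the strict inequality in
      \<open>disc_density\<close>.\<close>
    moreover have "beta_density (real (m + 2)) (real (m + 2) - 1) t = 0"
      using False assms(2) by (cases "t = 1") (auto simp: beta_density_def indicator_def)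
    ultimately show ?thesis by simp
  qed
qed

text \<open>The unit disc around 1 lies in the right half plane, and the ray of angle phi meets it
  for r < 2 cos(phi). Dividing r by this length frees the range of the second variable from
  phi.\<close>

lemma disc_law_one_minus:
  fixes f :: "real \<times> real \<Rightarrow> ennreal"
  assumes f [measurable]: "f \<in> borel_measurable borel"
  shows "(\<integral>\<^sup>+z. f (polar (1 - z)) \<partial>disc_law m) =
    (\<integral>\<^sup>+\<phi>. \<integral>\<^sup>+t. ennreal (cos_density (m + 1) \<phi>) *
       ennreal (beta_density (real (m + 2)) (real (m + 2) - 1) t) * f (\<phi>, t * (2 * cos \<phi>)) \<partial>lborel \<partial>lborel)"
    (is "?lhs = ?rhs")
proof -
  let ?I = "{- pi / 2 <..< pi / 2}"
  have "?lhs = (\<integral>\<^sup>+z. disc_density m (1 - (1 - z)) * f (polar (1 - z)) \<partial>lborel)"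
    by (subst nn_integral_disc_law) simp_all
  also have "\<dots> = (\<integral>\<^sup>+w. disc_density m (1 - w) * f (polar w) \<partial>lborel)"
    by (rule nn_integral_lborel_reflect [of "\<lambda>w. disc_density m (1 - w) * f (polar w)" 1]) measurable
  also have "\<dots> = (\<integral>\<^sup>+w. disc_density m (1 - w) * f (polar w) * indicator {z. 0 < Re z} w \<partial>lborel)"
  proof (rule nn_integral_cong)
    fix w :: complex
    show "disc_density m (1 - w) * f (polar w) =
          disc_density m (1 - w) * f (polar w) * indicator {z. 0 < Re z} w"
    proof (cases "cmod (1 - w) < 1")
      case True
      then have "0 < Re w"
        using complex_Re_le_cmod [of "1 - w"] by simp
      then show ?thesis by simp
    qed (simp add: disc_density_def)
  qed
  also have "\<dots> = (\<integral>\<^sup>+\<phi>. \<integral>\<^sup>+r. disc_density m (1 - of_real r * cis \<phi>) *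
      f (polar (of_real r * cis \<phi>)) * ennreal r * indicator {0<..} r *
      indicator ?I \<phi> \<partial>lborel \<partial>lborel)"
    by (rule nn_integral_half_plane_polar) measurable
  also have "\<dots> = ?rhs"
  proof (rule nn_integral_cong)
    fix \<phi> :: real
    show "(\<integral>\<^sup>+r. disc_density m (1 - of_real r * cis \<phi>) *
      f (polar (of_real r * cis \<phi>)) * ennreal r * indicator {0<..} r *
      indicator ?I \<phi> \<partial>lborel) =
      (\<integral>\<^sup>+t. ennreal (cos_density (m + 1) \<phi>) *
       ennreal (beta_density (real (m + 2)) (real (m + 2) - 1) t) * f (\<phi>, t * (2 * cos \<phi>)) \<partial>lborel)"
      (is "?l = ?r")
    proof (cases "\<phi> \<in> ?I")
      case True
      then have c: "0 < cos \<phi>" by (intro cos_gt_zero_pi) auto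
      have "?l = (\<integral>\<^sup>+r. disc_density m (1 - of_real r * cis \<phi>) * f (\<phi>, r) * ennreal r * indicator {0<..} r \<partial>lborel)"
        using True by (intro nn_integral_cong) (auto simp: indicator_def half_arg_polar norm_mult)
      also have "\<dots> = ennreal (2 * cos \<phi>) * (\<integral>\<^sup>+t. disc_density m (1 - of_real (2 * cos \<phi> * t) * cis \<phi>) *
          f (\<phi>, 2 * cos \<phi> * t) * ennreal (2 * cos \<phi> * t) * indicator {0<..} (2 * cos \<phi> * t) \<partial>lborel)"
        using c by (subst nn_integral_real_affine [where c = "2 * cos \<phi>" and t = 0]) simp_all
      also have "\<dots> = (\<integral>\<^sup>+t. ennreal (2 * cos \<phi>) * (disc_density m (1 - of_real (2 * cos \<phi> * t) * cis \<phi>) *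
          f (\<phi>, 2 * cos \<phi> * t) * ennreal (2 * cos \<phi> * t) * indicator {0<..} (2 * cos \<phi> * t)) \<partial>lborel)"
        by (rule nn_integral_cmult [symmetric]) measurable
      also have "\<dots> = ?r"
      proof (rule nn_integral_cong_AE)
        show "AE t in lborel. ennreal (2 * cos \<phi>) * (disc_density m (1 - of_real (2 * cos \<phi> * t) * cis \<phi>) *
          f (\<phi>, 2 * cos \<phi> * t) * ennreal (2 * cos \<phi> * t) * indicator {0<..} (2 * cos \<phi> * t)) =
          ennreal (cos_density (m + 1) \<phi>) *
          ennreal (beta_density (real (m + 2)) (real (m + 2) - 1) t) * f (\<phi>, t * (2 * cos \<phi>))"
          using AE_lborel_singleton [of 0]
        proof eventually_elim
          case (elim t)
          show ?case
            unfolding polar_disc_density [OF True elim, symmetric] by (simp only: mult_ac)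
        qed
      qed
      finally show ?thesis .
    next
      case False
      then have "cos_density (m + 1) \<phi> = 0"
        by (auto simp: cos_density_def)
      with False show ?thesis by simp
    qed
  qed
  finally show ?thesis .
qed

text \<open>The square of the direction of a rotation invariant vector is rotation invariant, because every
  phase is a square; the polar angle in the half plane then is half the angle on the circle.\<close>

lemma circle_law_one_minus:
  fixes f :: "real \<times> real \<Rightarrow> ennreal"
  assumes \<zeta>: "rotation_invariant \<zeta>" and circle: "AE z in \<zeta>. cmod z = 1"
    and f [measurable]: "f \<in> borel_measurable borel"
  shows "(\<integral>\<^sup>+z. f (polar (1 - z)) \<partial>\<zeta>) =
    (\<integral>\<^sup>+\<phi>. ennreal (cos_density 0 \<phi>) * f (\<phi>, 2 * cos \<phi>) \<partial>lborel)"
    (is "?lhs = ?rhs")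
proof -
  let ?I = "{- pi / 2 <..< pi / 2}"
  \<comment> \<open>Sign and square are chosen so that w = r e^(i phi) gives \<open>1 - q w\<close>
    = 1 + e^(2 i phi) = 2 cos(phi) e^(i phi).\<close>
  define q :: "complex \<Rightarrow> complex" where "q w = - (sgn w)\<^sup>2" for w
  have q [measurable]: "q \<in> borel_measurable borel"
    unfolding q_def by measurable
  \<comment> \<open>\<open>disc_law 0\<close> is merely a convenient rotation invariant law without
    mass at 0, which \<open>q\<close> carries to the circle.\<close>
  define \<xi> where "\<xi> = distr (disc_law 0) borel q"
  have [measurable_cong]: "sets \<xi> = sets borel" by (simp add: \<xi>_def)
  have \<xi>: "rotation_invariant \<xi>"
    unfolding rotation_invariant_def
  proof (intro conjI allI impI)
    show "prob_space \<xi>"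
      unfolding \<xi>_def by (rule prob_space.prob_space_distr [OF prob_space_disc_law]) simp
    fix c :: complex assume c: "cmod c = 1"
    define d where "d = csqrt c"
    have d: "d\<^sup>2 = c" "cmod d = 1"
      using c by (auto simp: d_def)
    have "q (d * w) = c * q w" for w
      using d by (simp add: q_def sgn_mult power_mult_distrib) (simp add: sgn_eq power_divide)
    then have "distr \<xi> borel (\<lambda>z. c * z) = distr (distr (disc_law 0) borel (\<lambda>w. d * w)) borel q"
      by (simp add: \<xi>_def distr_distr o_def)
    also have "\<dots> = \<xi>"
      using rotation_invariantD(3) [OF rotation_invariant_disc_law d(2)] by (simp add: \<xi>_def)
    finally show "distr \<xi> borel (\<lambda>z. c * z) = \<xi>" .
  qed (simp add: \<xi>_def)
  have \<xi>_circle: "AE z in \<xi>. cmod z = 1"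
    unfolding \<xi>_def using disc_law_AE(2) [of 0]
    by (subst AE_distr_iff) (auto simp: q_def norm_power norm_sgn elim!: eventually_mono)
  then have \<xi>_nz: "AE z in \<xi>. z \<noteq> 0"
    by (auto elim!: eventually_mono)
  have "\<zeta> = \<xi>"
  proof (rule rotation_invariant_unique [OF \<zeta> \<xi> \<xi>_nz])
    note [measurable_cong] = rotation_invariantD(2) [OF \<zeta>]
    have "distr \<zeta> borel cmod = distr \<zeta> borel (\<lambda>_. 1)"
      by (rule distr_cong_AE) (use circle in auto)
    also have "\<dots> = return borel 1"
      using rotation_invariantD(1) [OF \<zeta>] by (simp add: prob_space.distr_const)
    also have "\<dots> = distr \<xi> borel (\<lambda>_. 1)"
      using rotation_invariantD(1) [OF \<xi>] by (simp add: prob_space.distr_const)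
    also have "\<dots> = distr \<xi> borel cmod"
      by (rule distr_cong_AE) (use \<xi>_circle in auto)
    finally show "distr \<zeta> borel cmod = distr \<xi> borel cmod" .
  qed
  let ?H = "{z. 0 < Re z}" and ?c = "ennreal (1 / (2 * pi))"
  define g where "g w = f (polar (1 - q w)) * disc_density 0 w" for w
  have g [measurable]: "g \<in> borel_measurable borel"
    unfolding g_def by measurable
  have g_minus: "g (- w) = g w" for w
    by (simp add: g_def q_def sgn_minus disc_density_def indicator_def)
  have "?lhs = (\<integral>\<^sup>+w. g w \<partial>lborel)"
    unfolding \<open>\<zeta> = \<xi>\<close> \<xi>_def
    by (subst nn_integral_distr, simp, simp, subst nn_integral_disc_law) (simp_all add: g_def [abs_def] mult.commute)
  \<comment> \<open>The function \<open>g\<close> is even, so the two half planes contribute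
    equally, and the imaginary axis between them is a null set.\<close>
  also have "\<dots> = (\<integral>\<^sup>+w. g w * indicator ?H w + g w * indicator ?H (- w) \<partial>lborel)"
  proof (rule nn_integral_cong_AE)
    have "emeasure lborel {z. Re z = 0} = (\<integral>\<^sup>+z. indicator {z. Re z = 0} z \<partial>lborel)"
      by (rule nn_integral_indicator [symmetric]) measurable
    also have "\<dots> = (\<integral>\<^sup>+x. \<integral>\<^sup>+y. indicator {z. Re z = 0} (Complex x y) \<partial>lborel \<partial>lborel)"
      by (rule nn_integral_lborel_complex) measurable
    also have "\<dots> = (\<integral>\<^sup>+x. 0 \<partial>(lborel :: real measure))"
      by (rule nn_integral_cong_AE) (use AE_lborel_singleton [of 0] in \<open>auto elim!: eventually_mono\<close>)
    finally have "{z. Re z = 0} \<in> null_sets lborel"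
      by (simp add: null_sets_def)
    then have "AE w in lborel. w \<notin> {z. Re z = 0}"
      by (rule AE_not_in)
    then show "AE w in lborel. g w = g w * indicator ?H w + g w * indicator ?H (- w)"
      by eventually_elim (auto simp: indicator_def)
  qed
  also have "\<dots> = (\<integral>\<^sup>+w. g w * indicator ?H w \<partial>lborel) +
      (\<integral>\<^sup>+w. g w * indicator ?H (- w) \<partial>lborel)"
    by (rule nn_integral_add) measurable
  also have "(\<integral>\<^sup>+w. g w * indicator ?H (- w) \<partial>lborel) =
      (\<integral>\<^sup>+w. g w * indicator ?H w \<partial>lborel)"
    using nn_integral_lborel_rotation [of "-1" "\<lambda>w. g w * indicator ?H w"]
    by (simp add: g_minus)
  also have "(\<integral>\<^sup>+w. g w * indicator ?H w \<partial>lborel) =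
      (\<integral>\<^sup>+\<phi>. \<integral>\<^sup>+r. g (of_real r * cis \<phi>) * ennreal r * indicator {0<..} r * indicator ?I \<phi> \<partial>lborel \<partial>lborel)"
    by (rule nn_integral_half_plane_polar) measurable
  also have "\<dots> = (\<integral>\<^sup>+\<phi>. f (\<phi>, 2 * cos \<phi>) * ?c * indicator ?I \<phi> \<partial>lborel)"
  proof (rule nn_integral_cong)
    fix \<phi> :: real
    show "(\<integral>\<^sup>+r. g (of_real r * cis \<phi>) * ennreal r * indicator {0<..} r * indicator ?I \<phi> \<partial>lborel) =
        f (\<phi>, 2 * cos \<phi>) * ?c * indicator ?I \<phi>" (is "?l = _")
    proof (cases "\<phi> \<in> ?I")
      case True
      then have c: "0 < cos \<phi>" by (intro cos_gt_zero_pi) auto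
      have w: "1 - q (of_real r * cis \<phi>) = of_real (2 * cos \<phi>) * cis \<phi>" if "0 < r" for r
      proof -
        have "sgn (of_real r * cis \<phi>) = cis \<phi>"
          using that by (simp add: sgn_eq norm_mult)
        moreover have "1 + (cis \<phi>)\<^sup>2 = of_real (2 * cos \<phi>) * cis \<phi>"
          using sin_cos_squared_add [of \<phi>] by (simp add: complex_eq_iff power2_eq_square)
        ultimately show ?thesis by (simp add: q_def)
      qed
      \<comment> \<open>The radial integral of r / pi over the unit interval is 1 / (2 pi); the two
        half planes together give 1 / pi, the constant of \<open>cos_density 0\<close>.\<close>
      have "?l = (\<integral>\<^sup>+r. f (\<phi>, 2 * cos \<phi>) * (ennreal (1 / pi * r) * indicator {0..1} r) \<partial>lborel)"
      proof (rule nn_integral_cong_AE)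
        show "AE r in lborel. g (of_real r * cis \<phi>) * ennreal r * indicator {0<..} r * indicator ?I \<phi> =
            f (\<phi>, 2 * cos \<phi>) * (ennreal (1 / pi * r) * indicator {0..1} r)"
          using AE_lborel_singleton [of 0] AE_lborel_singleton [of 1]
        proof eventually_elim
          case (elim r)
          show ?case
          proof (cases "0 < r")
            case r: True
            have "half_arg (1 - q (of_real r * cis \<phi>)) = \<phi>" "cmod (1 - q (of_real r * cis \<phi>)) = 2 * cos \<phi>"
              unfolding w [OF r] using c half_arg_polar [of "2 * cos \<phi>" \<phi>] True
              by (simp_all add: norm_mult del: of_real_mult)
            moreover have "disc_density 0 (of_real r * cis \<phi>) * ennreal r = ennreal (1 / pi * r) * indicator {0..1} r"
              using r elim by (auto simp: disc_density_def norm_mult indicator_def ennreal_mult [symmetric])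
            ultimately show ?thesis
              using r True by (simp add: g_def mult.assoc)
          qed (use elim in \<open>auto simp: indicator_def\<close>)
        qed
      qed
      also have "\<dots> = f (\<phi>, 2 * cos \<phi>) * (\<integral>\<^sup>+r. ennreal (1 / pi * r) * indicator {0..1} r \<partial>lborel)"
        by (rule nn_integral_cmult) measurable
      also have "(\<integral>\<^sup>+r. ennreal (1 / pi * r) * indicator {0..1} r \<partial>lborel) = ennreal (1\<^sup>2 / (2 * pi) - 0\<^sup>2 / (2 * pi))"
        by (rule nn_integral_FTC_Icc) (auto intro!: derivative_eq_intros)
      finally show ?thesis using True by simp
    qed simp
  qed
  also have "\<dots> + \<dots> = (\<integral>\<^sup>+\<phi>. f (\<phi>, 2 * cos \<phi>) * ?c * indicator ?I \<phi> +
      f (\<phi>, 2 * cos \<phi>) * ?c * indicator ?I \<phi> \<partial>lborel)"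
    by (rule nn_integral_add [symmetric]) measurable
  also have "\<dots> = ?rhs"
  proof (rule nn_integral_cong)
    fix \<phi> :: real
    have "?c + ?c = ennreal (1 / pi)"
      by (subst ennreal_plus [symmetric]) (auto simp: field_simps)
    then have K: "X * ?c + X * ?c = X * ennreal (1 / pi)" for X
      by (simp only: distrib_left [symmetric])
    show "f (\<phi>, 2 * cos \<phi>) * ?c * indicator ?I \<phi> +
      f (\<phi>, 2 * cos \<phi>) * ?c * indicator ?I \<phi> = ennreal (cos_density 0 \<phi>) * f (\<phi>, 2 * cos \<phi>)"
      using K [of "f (\<phi>, 2 * cos \<phi>)"]
      by (cases "\<phi> \<in> ?I") (simp_all add: cos_density_def mult.commute [of "ennreal (1 / pi)"])
  qed
  finally show ?thesis .
qed

section \<open>The diagonal entries of a Haar distributed matrix\<close>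

lemma box_vec: "x \<in> box l u \<longleftrightarrow> (\<forall>i. x $ i \<in> box (l $ i) (u $ i))" for x :: "'a::euclidean_space ^ 'n"
  by (auto simp: mem_box Basis_vec_def inner_axis)

lemma prod_Basis_vec:
  fixes x :: "'a::euclidean_space ^ 'n"
  shows "(\<Prod>b\<in>Basis. x \<bullet> b) = (\<Prod>i\<in>UNIV. \<Prod>b\<in>Basis. x $ i \<bullet> b)"
proof -
  have B: "Basis = (\<lambda>(i, b). axis i b :: 'a ^ 'n) ` (UNIV \<times> Basis)"
    by (auto simp: Basis_vec_def)
  have inj: "inj_on (\<lambda>(i, b). axis i b :: 'a ^ 'n) (UNIV \<times> Basis)"
    by (auto simp: inj_on_def axis_eq_axis)
  have "(\<Prod>b\<in>Basis. x \<bullet> b) = (\<Prod>(i, b)\<in>UNIV \<times> Basis. x \<bullet> axis i b)"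
    by (subst B, subst prod.reindex [OF inj]) (simp add: o_def case_prod_unfold)
  then show ?thesis
    by (simp add: prod.cartesian_product inner_axis)
qed

lemma measurable_PiM_vec [measurable]:
  "(\<lambda>f. \<chi> i. f i) \<in> measurable (Pi\<^sub>M (UNIV :: 'n::finite set) (\<lambda>_. lborel :: 'a::euclidean_space measure)) borel"
  by (intro borel_measurable_vec_lambda) measurable

text \<open>The product form allows the coordinates of a Gaussian vector to be integrated one at a
  time.\<close>

lemma lborel_vec:
  "(lborel :: ('a::euclidean_space ^ 'n) measure) = distr (Pi\<^sub>M UNIV (\<lambda>_. lborel)) borel (\<lambda>f. \<chi> i. f i)"
proof (rule lborel_eqI)
  interpret product_sigma_finite "\<lambda>_::'n. lborel :: 'a measure" ..
  let ?M = "distr (Pi\<^sub>M UNIV (\<lambda>_. lborel)) borel (\<lambda>f. \<chi> i. f i) :: ('a ^ 'n) measure"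
  fix l u :: "'a ^ 'n"
  assume le: "\<And>b. b \<in> Basis \<Longrightarrow> l \<bullet> b \<le> u \<bullet> b"
  have le': "l $ i \<bullet> b \<le> u $ i \<bullet> b" if "b \<in> Basis" for i b
    using le [of "axis i b"] that by (simp add: inner_axis)
  have "(\<lambda>f. \<chi> i. f i) -` box l u \<inter> space (Pi\<^sub>M UNIV (\<lambda>_. lborel)) = (\<Pi>\<^sub>E i\<in>UNIV. box (l $ i) (u $ i))"
    by (auto simp: box_vec space_PiM PiE_iff)
  then have "emeasure ?M (box l u) =
      emeasure (Pi\<^sub>M UNIV (\<lambda>_. lborel)) (\<Pi>\<^sub>E i\<in>UNIV. box (l $ i) (u $ i))"
    by (simp add: emeasure_distr)
  also have "\<dots> = (\<Prod>i\<in>UNIV. emeasure lborel (box (l $ i) (u $ i)))"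
    by (rule emeasure_PiM) auto
  also have "\<dots> = (\<Prod>i\<in>UNIV. ennreal (\<Prod>b\<in>Basis. (u $ i - l $ i) \<bullet> b))"
    using le' by simp
  also have "\<dots> = ennreal (\<Prod>i\<in>UNIV. \<Prod>b\<in>Basis. (u $ i - l $ i) \<bullet> b)"
    using le' by (intro prod_ennreal prod_nonneg) (simp add: inner_diff_left)
  also have "(\<Prod>i\<in>UNIV. \<Prod>b\<in>Basis. (u $ i - l $ i) \<bullet> b) = (\<Prod>b\<in>Basis. (u - l) \<bullet> b)"
    by (simp add: prod_Basis_vec)
  finally show "emeasure ?M (box l u) =
      ennreal (\<Prod>b\<in>Basis. (u - l) \<bullet> b)" .
qed simp

section \<open>Standard complex Gaussian vectors\<close>

text \<open>The standard complex normal density, scaled so that the squared modulus is exponential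
  with mean 1.\<close>

definition gauss :: "complex \<Rightarrow> ennreal" where
  "gauss z = ennreal (exp (- (cmod z)\<^sup>2) / pi)"

lemma borel_measurable_gauss [measurable]: "gauss \<in> borel_measurable borel"
  unfolding gauss_def by measurable

lemma borel_measurable_indicator_greaterThan [measurable (raw)]:
  fixes f g :: "'a \<Rightarrow> real"
  assumes [measurable]: "f \<in> borel_measurable M" "g \<in> borel_measurable M"
  shows "(\<lambda>x. indicator {f x<..} (g x) :: ennreal) \<in> borel_measurable M"
  unfolding indicator_def greaterThan_iff by measurable

lemma nn_integral_exp_Ici:
  assumes "0 < c"
  shows "(\<integral>\<^sup>+u. ennreal (exp (- (c * u))) * indicator {a..} u \<partial>lborel) = ennreal (exp (- (c * a)) / c)"
proof -
  have "((\<lambda>u. - exp (- (c * u)) / c) \<longlongrightarrow> 0) at_top"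
    using assms by real_asymp
  then have "(\<integral>\<^sup>+u. ennreal (exp (- (c * u))) * indicator {a..} u \<partial>lborel) = ennreal (0 - (- exp (- (c * a)) / c))"
    by (intro nn_integral_FTC_atLeast) (use assms in \<open>auto intro!: derivative_eq_intros\<close>)
  then show ?thesis by simp
qed

lemma nn_integral_gauss:
  assumes f [measurable]: "f \<in> borel_measurable borel"
  shows "(\<integral>\<^sup>+z. gauss z * f ((cmod z)\<^sup>2) \<partial>lborel) =
         (\<integral>\<^sup>+u. ennreal (exp (- u)) * f u * indicator {0..} u \<partial>lborel)"
proof -
  have "(\<integral>\<^sup>+z. gauss z * f ((cmod z)\<^sup>2) \<partial>lborel) =
      (\<integral>\<^sup>+z. (\<lambda>u. ennreal (exp (- u) / pi) * f u) ((cmod z)\<^sup>2) \<partial>lborel)"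
    by (simp add: gauss_def)
  also have "\<dots> = (\<integral>\<^sup>+u. ennreal pi * (ennreal (exp (- u) / pi) * f u * indicator {0..} u) \<partial>lborel)"
    by (rule nn_integral_lborel_cmod_power2) measurable
  also have "\<dots> = (\<integral>\<^sup>+u. ennreal (exp (- u)) * f u * indicator {0..} u \<partial>lborel)"
    by (intro nn_integral_cong) (simp add: mult.assoc [symmetric] ennreal_mult [symmetric])
  finally show ?thesis .
qed

lemma nn_integral_gauss_exp:
  assumes "0 \<le> c"
  shows "(\<integral>\<^sup>+z. gauss z * ennreal (exp (- (c * (cmod z)\<^sup>2))) \<partial>lborel) = ennreal (1 / (1 + c))"
proof -
  have "ennreal (exp (- u)) * ennreal (exp (- (c * u))) = ennreal (exp (- ((1 + c) * u)))" for u
    by (simp add: ennreal_mult [symmetric] exp_add [symmetric] algebra_simps)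
  then show ?thesis
    using nn_integral_gauss [of "\<lambda>u. ennreal (exp (- (c * u)))"] nn_integral_exp_Ici [of "1 + c" 0] assms
    by simp
qed

lemma nn_integral_gauss_tail:
  assumes "0 \<le> a"
  shows "(\<integral>\<^sup>+z. gauss z * indicator {a<..} ((cmod z)\<^sup>2) \<partial>lborel) = ennreal (exp (- a))"
proof -
  have "(\<integral>\<^sup>+z. gauss z * indicator {a<..} ((cmod z)\<^sup>2) \<partial>lborel) =
      (\<integral>\<^sup>+u. ennreal (exp (- u)) * indicator {a<..} u * indicator {0..} u \<partial>lborel)"
    by (rule nn_integral_gauss) measurable
  also have "\<dots> = (\<integral>\<^sup>+u. ennreal (exp (- (1 * u))) * indicator {a..} u \<partial>lborel)"
  proof (rule nn_integral_cong_AE)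
    show "AE u in lborel. ennreal (exp (- u)) * indicator {a<..} u * indicator {0..} u =
        ennreal (exp (- (1 * u))) * indicator {a..} u"
      using AE_lborel_singleton [of a] by eventually_elim (use assms in \<open>auto simp: indicator_def\<close>)
  qed
  finally show ?thesis
    using nn_integral_exp_Ici [of 1 a] by simp
qed

definition gaussian :: "(complex^'n) measure" where
  "gaussian = density lborel (\<lambda>x. \<Prod>i\<in>UNIV. gauss (x $ i))"

lemma sets_gaussian [simp, measurable_cong]: "sets gaussian = sets borel"
  by (simp add: gaussian_def)

lemma nn_integral_gaussian:
  assumes f [measurable]: "f \<in> borel_measurable borel"
  shows "(\<integral>\<^sup>+x. f x \<partial>gaussian) = (\<integral>\<^sup>+x. (\<Prod>i\<in>UNIV. gauss (x $ i)) * f x \<partial>lborel)"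
  unfolding gaussian_def by (rule nn_integral_density) measurable

lemma nn_integral_gaussian_PiM:
  fixes f :: "complex^'n \<Rightarrow> ennreal"
  assumes f [measurable]: "f \<in> borel_measurable borel"
  shows "(\<integral>\<^sup>+x. f x \<partial>gaussian) =
    (\<integral>\<^sup>+x. (\<Prod>i\<in>UNIV. gauss (x i)) * f (\<chi> i. x i) \<partial>Pi\<^sub>M UNIV (\<lambda>_::'n. lborel))"
  unfolding nn_integral_gaussian [OF f]
  by (subst lborel_vec, subst nn_integral_distr) simp_all

lemma prob_space_gaussian: "prob_space (gaussian :: (complex^'n) measure)"
proof
  interpret product_sigma_finite "\<lambda>_::'n. lborel :: complex measure" ..
  have gauss_1: "(\<integral>\<^sup>+z. gauss z \<partial>lborel) = 1"
    using nn_integral_gauss_exp [of 0] by simp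
  have "emeasure (gaussian :: (complex^'n) measure) (space gaussian) = (\<integral>\<^sup>+x. 1 \<partial>(gaussian :: (complex^'n) measure))"
    by simp
  also have "\<dots> = (\<integral>\<^sup>+x. (\<Prod>i\<in>UNIV. gauss (x i)) \<partial>Pi\<^sub>M UNIV (\<lambda>_::'n. lborel))"
    by (subst nn_integral_gaussian_PiM) simp_all
  also have "\<dots> = 1"
    by (subst product_nn_integral_prod) (simp_all add: gauss_1)
  finally show "emeasure (gaussian :: (complex^'n) measure) (space gaussian) = 1" .
qed

lemma prod_gauss_norm: "(\<Prod>i\<in>UNIV. gauss (x $ i)) = ennreal (exp (- (norm x)\<^sup>2) / pi ^ CARD('n))"
  for x :: "complex^'n"
  by (simp add: gauss_def prod_ennreal power2_norm_vec exp_sum [symmetric] sum_negf [symmetric] prod_dividef)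

text \<open>The density depends on the norm alone, and a unitary matrix is a linear isometry, which
  preserves Lebesgue measure.\<close>

lemma gaussian_unitary_invariant:
  fixes f :: "complex^'n \<Rightarrow> ennreal"
  assumes U: "U \<in> unitary_group" and f [measurable]: "f \<in> borel_measurable borel"
  shows "(\<integral>\<^sup>+x. f (U *v x) \<partial>gaussian) = (\<integral>\<^sup>+x. f x \<partial>gaussian)"
proof -
  have "linear ((*v) U)"
    by (rule linearI)
       (simp add: matrix_vector_right_distrib,
        simp add: vec_eq_iff matrix_vector_mult_def scaleR_sum_right)
  then have iso: "distr lborel borel ((*v) U) = lborel"
    by (rule lborel_distr_isometry) (rule unitary_norm [OF U])
  define g where "g x = (\<Prod>i\<in>UNIV. gauss (x $ i)) * f x" for x
  have g [measurable]: "g \<in> borel_measurable borel"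
    unfolding g_def by measurable
  have "(\<integral>\<^sup>+x. f (U *v x) \<partial>gaussian) = (\<integral>\<^sup>+x. g (U *v x) \<partial>lborel)"
    by (subst nn_integral_gaussian) (simp_all add: g_def prod_gauss_norm unitary_norm [OF U])
  also have "\<dots> = (\<integral>\<^sup>+x. g x \<partial>lborel)"
    by (rule nn_integral_distr_eq_self [OF _ _ iso]) simp_all
  also have "\<dots> = (\<integral>\<^sup>+x. f x \<partial>gaussian)"
    by (simp add: nn_integral_gaussian g_def)
  finally show ?thesis .
qed

section \<open>Normalised Gaussian vectors and the modulus of an entry\<close>

definition proj :: "'n set \<Rightarrow> complex^'n \<Rightarrow> complex^'n" where
  "proj S x = (\<chi> i. if i \<in> S then x $ i else 0)"

lemma proj_nth [simp]: "proj S x $ i = (if i \<in> S then x $ i else 0)"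
  by (simp add: proj_def)

lemma borel_measurable_proj [measurable]: "proj S \<in> borel_measurable borel"
  unfolding proj_def by (rule borel_measurable_vec_lambda) simp

lemma fixing_proj:
  assumes V: "V \<in> fixing S"
  shows "V *v proj S x = proj S (V *v x)"
proof -
  have "V $ i $ j * proj S x $ j = (if i \<in> S then V $ i $ j * x $ j else 0)" for i j
    using fixing_row [OF V, of i j] fixing_column [OF V, of j i] by auto
  then show ?thesis
    by (simp add: vec_eq_iff matrix_vector_mult_def)
qed

lemma power2_norm_proj: "(norm (proj S x))\<^sup>2 = (\<Sum>i\<in>S. (cmod (x $ i))\<^sup>2)"
proof -
  have "(\<Sum>i\<in>UNIV. (cmod (proj S x $ i))\<^sup>2) = (\<Sum>i\<in>UNIV. if i \<in> S then (cmod (x $ i))\<^sup>2 else 0)"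
    by (intro sum.cong) auto
  then show ?thesis
    by (simp add: power2_norm_vec sum.If_cases)
qed

text \<open>Independence of the coordinates; \<open>1 / (1 + c)\<close> is the Laplace transform of \<open>\<bar>x $ i\<bar>\<^sup>2\<close>.\<close>

lemma gaussian_ratio_tail:
  fixes S :: "'n::finite set"
  assumes k: "k \<notin> S" and c: "0 \<le> c"
  shows "(\<integral>\<^sup>+x. indicator {c * (\<Sum>i\<in>S. (cmod (x $ i))\<^sup>2)<..} ((cmod (x $ k))\<^sup>2) \<partial>gaussian) =
         ennreal ((1 / (1 + c)) ^ card S)"
proof -
  interpret product_sigma_finite "\<lambda>_::'n. lborel :: complex measure" ..
  let ?I = "UNIV - {k}"
  let ?M = "\<lambda>I. Pi\<^sub>M I (\<lambda>_::'n. lborel :: complex measure)"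
  let ?e = "\<lambda>i z. if i \<in> S then ennreal (exp (- (c * (cmod z)\<^sup>2))) else 1"
  let ?ind = "\<lambda>x k. indicator {c * (\<Sum>i\<in>S. (cmod (x i))\<^sup>2)<..} ((cmod (x k))\<^sup>2) :: ennreal"
  define h where "h x = (\<Prod>i\<in>UNIV. gauss (x i)) * ?ind x k"
    for x :: "'n \<Rightarrow> complex"
  have "(\<lambda>x. \<Prod>i\<in>UNIV. gauss (x i)) \<in> borel_measurable (?M UNIV)"
    by measurable
  moreover have "(\<lambda>x. ?ind x k) \<in> borel_measurable (?M UNIV)"
    by measurable
  ultimately have h: "h \<in> borel_measurable (?M (insert k ?I))"
    unfolding h_def by (simp add: insert_absorb)
  have "(\<integral>\<^sup>+x. ?ind (($) x) k \<partial>gaussian) =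
      (\<integral>\<^sup>+x. h x \<partial>?M (insert k ?I))"
    by (subst nn_integral_gaussian_PiM) (simp_all add: h_def [abs_def] insert_absorb)
  \<comment> \<open>Coordinate k is integrated first: given the others, its tail is
    \<open>exp (- ?s)\<close>, which splits into one factor for each index in
    \<open>S\<close>.\<close>
  also have "\<dots> = (\<integral>\<^sup>+x. (\<integral>\<^sup>+z. h (x(k := z)) \<partial>lborel) \<partial>?M ?I)"
    by (rule product_nn_integral_insert [OF _ _ h]) simp_all
  also have "\<dots> = (\<integral>\<^sup>+x. (\<Prod>i\<in>?I. gauss (x i) * ?e i (x i)) \<partial>?M ?I)"
  proof (rule nn_integral_cong)
    fix x :: "'n \<Rightarrow> complex"
    let ?s = "c * (\<Sum>i\<in>S. (cmod (x i))\<^sup>2)"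
    have "h (x(k := z)) = (\<Prod>i\<in>?I. gauss (x i)) * (gauss z * indicator {?s<..} ((cmod z)\<^sup>2))" for z
    proof -
      have "(\<Prod>i\<in>UNIV. gauss ((x(k := z)) i)) = gauss z * (\<Prod>i\<in>?I. gauss (x i))"
        by (subst prod.remove [of _ k]) auto
      moreover have "(\<Sum>i\<in>S. (cmod ((x(k := z)) i))\<^sup>2) = (\<Sum>i\<in>S. (cmod (x i))\<^sup>2)"
        using k by (intro sum.cong) auto
      ultimately show ?thesis by (simp add: h_def mult_ac)
    qed
    then have "(\<integral>\<^sup>+z. h (x(k := z)) \<partial>lborel) =
        (\<Prod>i\<in>?I. gauss (x i)) * (\<integral>\<^sup>+z. gauss z * indicator {?s<..} ((cmod z)\<^sup>2) \<partial>lborel)"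
      by (simp add: nn_integral_cmult)
    also have "(\<integral>\<^sup>+z. gauss z * indicator {?s<..} ((cmod z)\<^sup>2) \<partial>lborel) = ennreal (exp (- ?s))"
      using c by (intro nn_integral_gauss_tail mult_nonneg_nonneg sum_nonneg) auto
    also have "ennreal (exp (- ?s)) = (\<Prod>i\<in>S. ennreal (exp (- (c * (cmod (x i))\<^sup>2))))"
      by (simp add: prod_ennreal exp_sum [symmetric] sum_negf sum_distrib_left)
    also have "\<dots> = (\<Prod>i\<in>?I. ?e i (x i))"
      using k by (intro prod.mono_neutral_cong_left) auto
    finally show "(\<integral>\<^sup>+z. h (x(k := z)) \<partial>lborel) =
        (\<Prod>i\<in>?I. gauss (x i) * ?e i (x i))"
      by (simp only: prod.distrib)
  qed
  also have "\<dots> = (\<Prod>i\<in>?I. \<integral>\<^sup>+z. gauss z * ?e i z \<partial>lborel)"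
    by (rule product_nn_integral_prod) simp_all
  also have "\<dots> = (\<Prod>i\<in>?I. if i \<in> S then ennreal (1 / (1 + c)) else 1)"
    using nn_integral_gauss_exp [OF c] nn_integral_gauss_exp [of 0] by (intro prod.cong) auto
  also have "\<dots> = (\<Prod>i\<in>S. ennreal (1 / (1 + c)))"
    using k by (intro prod.mono_neutral_cong_right) auto
  also have "\<dots> = ennreal ((1 / (1 + c)) ^ card S)"
    using c by (simp add: ennreal_power)
  finally show ?thesis .
qed

text \<open>For Gaussian x and k in \<open>S\<close> this is a uniform unit vector in the span of
  \<open>S\<close>; the default value, taken on a null set, keeps the norm equal to 1
  everywhere.\<close>

definition direction :: "'n \<Rightarrow> 'n set \<Rightarrow> complex^'n \<Rightarrow> complex^'n" where
  "direction k S x = (if proj S x = 0 then axis k 1 else (1 / norm (proj S x)) *\<^sub>R proj S x)"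

lemma borel_measurable_direction [measurable]: "direction k S \<in> borel_measurable borel"
  unfolding direction_def by measurable

lemma norm_direction: "norm (direction k S x) = 1"
  by (simp add: direction_def)

lemma direction_outside: "k \<in> S \<Longrightarrow> i \<notin> S \<Longrightarrow> direction k S x $ i = 0"
  by (auto simp: direction_def axis_def)

lemma gaussian_AE_nonzero:
  fixes S :: "'n::finite set"
  assumes "k \<in> S"
  shows "AE x in gaussian. proj S (x :: complex^'n) \<noteq> 0"
proof -
  interpret prob_space "gaussian :: (complex^'n) measure" by (rule prob_space_gaussian)
  \<comment> \<open>The instance of \<open>gaussian_ratio_tail\<close> with empty index set and c =
    0: coordinate k alone is almost surely nonzero.\<close>
  have "(\<lambda>x :: complex^'n. indicator {0 * (\<Sum>i\<in>{}. (cmod (x $ i))\<^sup>2)<..} ((cmod (x $ k))\<^sup>2) :: ennreal) =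
      indicator {x. 0 < (cmod (x $ k))\<^sup>2}"
    by (auto simp: indicator_def)
  then have "emeasure gaussian {x :: complex^'n. 0 < (cmod (x $ k))\<^sup>2} =
      (\<integral>\<^sup>+x. indicator {0 * (\<Sum>i\<in>{}. (cmod (x $ i))\<^sup>2)<..} ((cmod (x $ k))\<^sup>2) \<partial>gaussian)"
    by (simp only:) (rule nn_integral_indicator [symmetric], simp)
  also have "\<dots> = 1"
    by (subst gaussian_ratio_tail) simp_all
  finally have "emeasure gaussian {x :: complex^'n. 0 < (cmod (x $ k))\<^sup>2} = 1" .
  then have "AE x in gaussian. (x :: complex^'n) \<in> {x. 0 < (cmod (x $ k))\<^sup>2}"
    by (subst AE_in_set_eq_1) (simp_all add: measure_def)
  then show ?thesis
    by eventually_elim (use assms in \<open>auto simp: vec_eq_iff\<close>)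
qed

text \<open>A unit vector \<open>direction k S x\<close> is column k of a reflector in
  \<open>fixing S\<close>, so by right invariance column k of \<open>V\<close> may be replaced by
  \<open>V\<close> applied to that vector, for every x. After averaging over Gaussian x and
  exchanging integrals, the Gaussian law absorbs \<open>V\<close>, which commutes with normalised
  projection almost everywhere.\<close>

lemma column_entry_law:
  fixes f :: "complex \<Rightarrow> ennreal"
  assumes \<mu>: "left_invariant (fixing S) \<mu>" and k: "k \<in> S" and f [measurable]: "f \<in> borel_measurable borel"
  shows "(\<integral>\<^sup>+V. f (V $ k $ k) \<partial>\<mu>) = (\<integral>\<^sup>+x. f (direction k S x $ k) \<partial>gaussian)"
proof -
  let ?D = "direction k S"
  have \<mu>': "right_invariant (fixing S) \<mu>"
    using \<mu> by (simp add: left_invariant_iff_right_invariant)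
  have "prob_on (fixing S) \<mu>" using \<mu> by (rule left_invariant_prob_on)
  note p = prob_onD [OF this] and [measurable_cong] = prob_onD(2) [OF this]
  interpret \<mu>: prob_space \<mu> by (rule p)
  interpret \<gamma>: prob_space "gaussian :: (complex^'a) measure" by (rule prob_space_gaussian)
  interpret pair_sigma_finite \<mu> "gaussian :: (complex^'a) measure" ..
  have "(\<integral>\<^sup>+V. f (V $ k $ k) \<partial>\<mu>) = (\<integral>\<^sup>+V. f ((V *v ?D x) $ k) \<partial>\<mu>)" for x
  proof -
    let ?R = "reflector k (?D x)"
    have "?R \<in> fixing S"
      using k by (intro reflector_fixing norm_direction direction_outside)
    then have "(\<integral>\<^sup>+V. f (V $ k $ k) \<partial>\<mu>) = (\<integral>\<^sup>+V. f ((V ** ?R) $ k $ k) \<partial>\<mu>)"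
      using right_invariant_nn_integral [OF \<mu>', of ?R "\<lambda>V. f (V $ k $ k)"] by simp
    moreover have "(V ** ?R) $ k $ k = (V *v ?D x) $ k" for V
      using matrix_vector_mult_axis [of "V ** ?R" k k]
      by (simp add: matrix_vector_mul_assoc [symmetric] reflector_axis norm_direction)
    ultimately show ?thesis by simp
  qed
  then have "(\<integral>\<^sup>+V. f (V $ k $ k) \<partial>\<mu>) = (\<integral>\<^sup>+x. \<integral>\<^sup>+V. f ((V *v ?D x) $ k) \<partial>\<mu> \<partial>gaussian)"
    by (simp add: \<gamma>.emeasure_space_1)
  also have "\<dots> = (\<integral>\<^sup>+V. \<integral>\<^sup>+x. f ((V *v ?D x) $ k) \<partial>gaussian \<partial>\<mu>)"
    by (rule Fubini') measurable
  also have "\<dots> = (\<integral>\<^sup>+V. (\<integral>\<^sup>+x. f (?D x $ k) \<partial>gaussian) \<partial>\<mu>)"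
  proof (rule nn_integral_cong_AE)
    show "AE V in \<mu>. (\<integral>\<^sup>+x. f ((V *v ?D x) $ k) \<partial>gaussian) =
                     (\<integral>\<^sup>+x. f (?D x $ k) \<partial>gaussian)"
      using p(3)
    proof eventually_elim
      case (elim V)
      have "V *v ?D x = ?D (V *v x)" if "proj S x \<noteq> 0" for x
      proof -
        have n: "norm (proj S (V *v x)) = norm (proj S x)"
          by (simp add: fixing_proj [OF elim, symmetric] unitary_norm fixing_unitary [OF elim])
        have "V *v ?D x = (1 / norm (proj S x)) *\<^sub>R (V *v proj S x)"
        proof -
          have d: "?D x = (1 / norm (proj S x)) *\<^sub>R proj S x"
            using that by (simp add: direction_def)
          show ?thesis
            unfolding d by (simp add: vec_eq_iff matrix_vector_mult_def scaleR_sum_right)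
        qed
        then show ?thesis
          using that n by (auto simp: direction_def fixing_proj [OF elim])
      qed
      then have "(\<integral>\<^sup>+x. f ((V *v ?D x) $ k) \<partial>gaussian) =
          (\<integral>\<^sup>+x. f (?D (V *v x) $ k) \<partial>gaussian)"
        using gaussian_AE_nonzero [OF k] by (intro nn_integral_cong_AE) (auto elim!: eventually_mono)
      also have "\<dots> = (\<integral>\<^sup>+x. f (?D x $ k) \<partial>gaussian)"
        by (rule gaussian_unitary_invariant [OF fixing_unitary [OF elim]]) measurable
      finally show ?case .
    qed
  qed
  also have "\<dots> = (\<integral>\<^sup>+x. f (?D x $ k) \<partial>gaussian)"
    by (simp add: \<mu>.emeasure_space_1)
  finally show ?thesis .
qed

text \<open>The entry has squared modulus a / (a + b), with a = |x_k|^2 and b the sum over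
  \<open>S\<close>. It exceeds s exactly if b s / (1 - s) < a, and for c = s / (1 - s) one has 1 /
  (1 + c) = 1 - s.\<close>

lemma column_entry_tail:
  fixes \<mu> :: "(complex^'n^'n) measure"
  assumes \<mu>: "left_invariant (fixing (insert k S)) \<mu>" and k: "k \<notin> S" and s: "0 \<le> s" "s < 1"
  shows "emeasure \<mu> {V. s < (cmod (V $ k $ k))\<^sup>2} = ennreal ((1 - s) ^ card S)"
proof -
  let ?D = "direction k (insert k S)"
  have "prob_on (fixing (insert k S)) \<mu>" using \<mu> by (rule left_invariant_prob_on)
  note [measurable_cong] = prob_onD(2) [OF this] and sets = prob_onD(2) [OF this]
  let ?c = "s / (1 - s)"
  have "(\<lambda>V :: complex^'n^'n. indicator {s<..} ((cmod (V $ k $ k))\<^sup>2) :: ennreal) = indicator {V. s < (cmod (V $ k $ k))\<^sup>2}"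
    by (auto simp: indicator_def)
  then have "emeasure \<mu> {V. s < (cmod (V $ k $ k))\<^sup>2} =
      (\<integral>\<^sup>+V. indicator {s<..} ((cmod (V $ k $ k))\<^sup>2) \<partial>\<mu>)"
    by (simp only:) (rule nn_integral_indicator [symmetric], simp add: sets)
  also have "\<dots> = (\<integral>\<^sup>+x. indicator {s<..} ((cmod (?D x $ k))\<^sup>2) \<partial>gaussian)"
    using column_entry_law [OF \<mu>, of k "\<lambda>z. indicator {s<..} ((cmod z)\<^sup>2)"] by simp
  also have "\<dots> = (\<integral>\<^sup>+x. indicator {?c * (\<Sum>i\<in>S. (cmod (x $ i))\<^sup>2)<..} ((cmod (x $ k))\<^sup>2) \<partial>gaussian)"
  proof (rule nn_integral_cong_AE)
    have eq: "s < (cmod (?D x $ k))\<^sup>2 \<longleftrightarrow>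
        ?c * (\<Sum>i\<in>S. (cmod (x $ i))\<^sup>2) < (cmod (x $ k))\<^sup>2" if nz: "proj (insert k S) x \<noteq> 0" for x
    proof -
      let ?n = "(norm (proj (insert k S) x))\<^sup>2" and ?t = "\<Sum>i\<in>S. (cmod (x $ i))\<^sup>2"
      have "0 < ?n" using nz by simp
      have "?n = (cmod (x $ k))\<^sup>2 + ?t"
        using k by (simp add: power2_norm_proj)
      have "(cmod (?D x $ k))\<^sup>2 = (cmod (x $ k))\<^sup>2 / ?n"
        using nz by (simp add: direction_def power_mult_distrib power_divide)
      then have "s < (cmod (?D x $ k))\<^sup>2 \<longleftrightarrow> s * ?n < (cmod (x $ k))\<^sup>2"
        using \<open>0 < ?n\<close> by (simp add: pos_less_divide_eq)
      also have "\<dots> \<longleftrightarrow> s * ?t < (1 - s) * (cmod (x $ k))\<^sup>2"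
        unfolding \<open>?n = _\<close> by (simp add: algebra_simps)
      also have "\<dots> \<longleftrightarrow> ?c * ?t < (cmod (x $ k))\<^sup>2"
        using s by (simp add: pos_divide_less_eq mult.commute)
      finally show ?thesis .
    qed
    show "AE x in gaussian. indicator {s<..} ((cmod (?D x $ k))\<^sup>2) =
        (indicator {?c * (\<Sum>i\<in>S. (cmod (x $ i))\<^sup>2)<..} ((cmod (x $ k))\<^sup>2) :: ennreal)"
      using gaussian_AE_nonzero [of k "insert k S"]
      by (rule AE_mp) (simp_all add: indicator_def eq)
  qed
  also have "\<dots> = ennreal ((1 / (1 + ?c)) ^ card S)"
    using s by (intro gaussian_ratio_tail k) simp
  also have "1 / (1 + ?c) = 1 - s"
    using s by (simp add: field_simps)
  finally show ?thesis .
qed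

section \<open>The recursion for the determinant\<close>

text \<open>Right multiplication deletes the columns outside \<open>S\<close>. For \<open>V\<close>
  in \<open>fixing S\<close> those are basis vectors, whose eigenvalue 1 would make
  \<open>det (mat 1 - V)\<close> vanish; once deleted they contribute only the eigenvalue 0.\<close>

definition coord_proj :: "'n set \<Rightarrow> complex^'n^'n" where
  "coord_proj S = (\<chi> i j. if i = j \<and> i \<in> S then 1 else 0)"

lemma mult_coord_proj: "(A ** coord_proj S) $ i $ j = (if j \<in> S then A $ i $ j else 0)"
proof -
  have "(A ** coord_proj S) $ i $ j = (\<Sum>l\<in>UNIV. (if l = j then 1 else 0) * (if l \<in> S then A $ i $ l else 0))"
    unfolding matrix_matrix_mult_def coord_proj_def by simp (intro sum.cong, auto)
  then show ?thesis by (simp add: sum_if_eq)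
qed

lemma coord_proj_mult_vector: "coord_proj S *v x = proj S x"
proof -
  have "(coord_proj S *v x) $ i = (\<Sum>l\<in>UNIV. (if i = l then 1 else 0) * (if l \<in> S then x $ l else 0))" for i
    unfolding matrix_vector_mult_def coord_proj_def by simp (intro sum.cong, auto)
  then show ?thesis by (simp add: vec_eq_iff sum_if_eq)
qed

lemma contractive_coord_proj: "contractive (coord_proj S)"
proof -
  have "(norm (proj S x))\<^sup>2 \<le> (norm x)\<^sup>2" for x
    unfolding power2_norm_proj unfolding power2_norm_vec by (intro sum_mono2) auto
  then show ?thesis
    by (simp add: contractive_def coord_proj_mult_vector power2_le_iff_abs_le)
qed

lemma contractive_restricted: "V \<in> unitary_group \<Longrightarrow> contractive (V ** coord_proj S)"
  by (intro contractive_mult unitary_contractive contractive_coord_proj)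

lemma vanishes_at_restricted:
  assumes "h \<in> fixing S" "k \<notin> S"
  shows "vanishes_at k (h ** coord_proj S)"
  using assms by (auto simp: vanishes_at_def mult_coord_proj fixing_row)

text \<open>Column k of \<open>h\<close> is the basis vector, so retaining it amounts to setting the
  entry at (k, k) to 1.\<close>

lemma block_extend_restricted:
  assumes "h \<in> fixing S" "k \<notin> S"
  shows "block_extend k (h ** coord_proj S) = h ** coord_proj (insert k S)"
  using assms by (auto simp: vec_eq_iff block_extend_def mult_coord_proj fixing_column)

section \<open>The two statistics and their recursion\<close>

text \<open>Cut off outside the closed set of contractions in order to be Borel on all matrices;
  truncated unitary matrices are contractions, so for them the cutoff is invisible.\<close>

definition arg_det :: "complex^'n^'n \<Rightarrow> real" where
  "arg_det A = (if contractive A then Im (log_det_one_minus A) else 0)"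

lemma borel_measurable_arg_det [measurable]: "arg_det \<in> borel_measurable borel"
proof -
  have [measurable]: "{A :: complex^'n^'n. contractive A} \<in> sets borel"
    by (rule borel_closed [OF closed_contractive])
  have "(\<lambda>A :: complex^'n^'n. indicator {A. contractive A} A *\<^sub>R Im (log_det_one_minus A)) \<in> borel_measurable borel"
    using borel_measurable_Im_log_det [where 'n = 'n] by (subst (asm) borel_measurable_restrict_space_iff) auto
  then show ?thesis
    by (rule measurable_cong [THEN iffD1, rotated]) (simp add: arg_det_def)
qed

lemma borel_measurable_det [measurable]: "(det :: complex^'n^'n \<Rightarrow> complex) \<in> borel_measurable borel"
  by (intro borel_measurable_continuous_onI continuous_on_det continuous_on_id)

definition stat :: "'n set \<Rightarrow> complex^'n^'n \<Rightarrow> real \<times> real" where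
  "stat S V = (arg_det (V ** coord_proj S), cmod (det (mat 1 - V ** coord_proj S)))"

lemma borel_measurable_stat [measurable]: "stat S \<in> borel_measurable borel"
  unfolding stat_def by measurable

lemma column_entry_le_1:
  assumes "V \<in> unitary_group"
  shows "cmod (V $ k $ k) \<le> 1"
  using Finite_Cartesian_Product.norm_nth_le [of "V *v axis k 1" k] unitary_norm [OF assms, of "axis k 1"]
  by (simp add: matrix_vector_mult_axis)

text \<open>By \<open>V = R ** h\<close>, truncating \<open>V\<close> to \<open>insert k S\<close>
  gives the reflector times the block extension of the truncated \<open>h\<close>, to which the
  identities for determinant and logarithm apply.\<close>

lemma stat_insert:
  assumes V: "V \<in> fixing (insert k S)" and k: "k \<notin> S"
    and nz: "V $ k $ k \<noteq> 1" "det (mat 1 - cofactor k V ** coord_proj S) \<noteq> 0"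
  shows "stat (insert k S) V =
      (half_arg (1 - V $ k $ k) + fst (stat S (cofactor k V)), cmod (1 - V $ k $ k) * snd (stat S (cofactor k V)))"
    and "det (mat 1 - V ** coord_proj (insert k S)) \<noteq> 0"
proof -
  let ?v = "V *v axis k 1" and ?h = "cofactor k V"
  let ?X = "?h ** coord_proj S"
  have h: "?h \<in> fixing S" by (rule cofactor_fixing [OF V])
  have v: "norm ?v = 1" "?v $ k = V $ k $ k"
    using fixing_axis_norm [OF V] by (simp_all add: matrix_vector_mult_axis)
  have eq: "V ** coord_proj (insert k S) = reflector k ?v ** block_extend k ?X"
    unfolding block_extend_restricted [OF h k]
    using reflector_cofactor [OF fixing_unitary [OF V], of k] by (simp add: matrix_mul_assoc)
  have van: "vanishes_at k ?X" by (rule vanishes_at_restricted [OF h k])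
  have cX: "contractive ?X" by (rule contractive_restricted [OF fixing_unitary [OF h]])
  have cV: "contractive (V ** coord_proj (insert k S))"
    by (rule contractive_restricted [OF fixing_unitary [OF V]])
  have X: "?X \<in> log_domain"
    using cX nz by (simp add: log_domain_def)
  have det: "det (mat 1 - V ** coord_proj (insert k S)) = (1 - V $ k $ k) * det (mat 1 - ?X)"
    unfolding eq using det_reflector_block [OF van] v by simp
  then show "det (mat 1 - V ** coord_proj (insert k S)) \<noteq> 0"
    using nz by simp
  have "log_det_one_minus (V ** coord_proj (insert k S)) = Ln (1 - V $ k $ k) + log_det_one_minus ?X"
    unfolding eq using log_det_reflector_block [OF v(1) _ X van] v nz by simp
  moreover have "Im (Ln (1 - V $ k $ k)) = half_arg (1 - V $ k $ k)"
    by (rule Im_Ln_eq_half_arg, rule Re_one_minus_pos)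
       (use column_entry_le_1 [OF fixing_unitary [OF V]] nz in auto)
  ultimately show "stat (insert k S) V =
      (half_arg (1 - V $ k $ k) + fst (stat S ?h), cmod (1 - V $ k $ k) * snd (stat S ?h))"
    using cX cV det by (simp add: stat_def arg_det_def norm_mult)
qed

section \<open>The law of one minus a diagonal entry\<close>

definition phase :: "'n \<Rightarrow> complex \<Rightarrow> complex^'n^'n" where
  "phase k c = (\<chi> i j. if i = j then if i = k then c else 1 else 0)"

lemma phase_fixing:
  assumes c: "cmod c = 1"
  shows "phase k c \<in> fixing (insert k S)" (is "?D \<in> _")
proof -
  have cc: "c * cnj c = 1"
    using c by (simp add: complex_norm_square [symmetric])
  have "(?D ** conj_transpose ?D) $ i $ j = mat 1 $ i $ j" for i j
  proof -
    have "(?D ** conj_transpose ?D) $ i $ j =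
      (\<Sum>l\<in>UNIV. (if i = l then 1 else 0) * (if l = j then 1 else 0))"
      unfolding matrix_matrix_mult_def
      by (simp only: phase_def conj_transpose_nth vec_lambda_beta) (intro sum.cong, use cc in auto)
    then show ?thesis by (simp add: sum_if_eq mat_def)
  qed
  then have "?D ** conj_transpose ?D = mat 1"
    by (simp add: vec_eq_iff)
  then have "?D \<in> unitary_group"
    unfolding unitary_group_def using matrix_left_right_inverse by blast
  moreover have "?D *v axis i 1 = axis i 1" if "i \<noteq> k" for i
    using that by (auto simp: vec_eq_iff matrix_vector_mult_axis) (auto simp: axis_def phase_def)
  ultimately show ?thesis
    by (auto simp: fixing_def)
qed

lemma phase_mult_entry:
  "(phase k c ** V) $ k $ k = c * V $ k $ k"
  for V :: "complex^'n^'n"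
proof -
  have "(phase k c ** V) $ k $ k =
      (\<Sum>l\<in>UNIV. (if k = l then 1 else 0) * (c * V $ l $ k))"
    unfolding matrix_matrix_mult_def phase_def by simp (intro sum.cong, auto)
  then show ?thesis by (simp add: sum_if_eq)
qed

text \<open>Left multiplication by \<open>phase k c\<close> preserves \<open>\<mu>\<close> and
  multiplies the diagonal entry by c.\<close>

lemma rotation_invariant_column_entry:
  assumes \<mu>: "left_invariant (fixing (insert k S)) \<mu>"
  shows "rotation_invariant (distr \<mu> borel (\<lambda>V. V $ k $ k))"
  unfolding rotation_invariant_def
proof (intro conjI allI impI)
  have pr: "prob_on (fixing (insert k S)) \<mu>" using \<mu> by (rule left_invariant_prob_on)
  note [measurable_cong] = prob_onD(2) [OF pr]
  show "prob_space (distr \<mu> borel (\<lambda>V. V $ k $ k))"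
    by (rule prob_space.prob_space_distr [OF prob_onD(1) [OF pr]]) measurable
  fix c :: complex assume "cmod c = 1"
  let ?D = "phase k c"
  have "?D \<in> fixing (insert k S)" by (rule phase_fixing) fact
  then have D: "distr \<mu> borel (\<lambda>V. ?D ** V) = \<mu>"
    using \<mu> by (simp add: left_invariant_def)
  have "distr (distr \<mu> borel (\<lambda>V. V $ k $ k)) borel (\<lambda>z. c * z) =
      distr (distr \<mu> borel (\<lambda>V. ?D ** V)) borel (\<lambda>V. V $ k $ k)"
    by (simp add: distr_distr o_def phase_mult_entry)
  then show "distr (distr \<mu> borel (\<lambda>V. V $ k $ k)) borel (\<lambda>z. c * z) = distr \<mu> borel (\<lambda>V. V $ k $ k)"
    unfolding D .
qed simp

text \<open>Index 1 is the convention of a point mass at 1, as parameters 1 and 0 do not define a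
  beta density.\<close>

definition beta_law :: "nat \<Rightarrow> real measure" where
  "beta_law j = (if j = 1 then return borel 1
     else density lborel (\<lambda>t. ennreal (beta_density (real j) (real j - 1) t)))"

definition cos_law :: "nat \<Rightarrow> real measure" where
  "cos_law j = density lborel (\<lambda>v. ennreal (cos_density (j - 1) v))"

lemma borel_measurable_cos_density [measurable]: "cos_density k \<in> borel_measurable borel"
  unfolding cos_density_def by measurable

lemma borel_measurable_beta_density [measurable]: "beta_density a b \<in> borel_measurable borel"
  unfolding beta_density_def by measurable

text \<open>If \<open>card S\<close> is positive, the tails identify the law of the entry as a
  \<open>disc_law\<close>; if it is 0, all tails below level 1 equal 1 and the entry is uniform on
  the circle. The almost sure part supplies a premise of \<open>stat_insert\<close>.\<close>

lemma column_entry_one_minus: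
  fixes f :: "real \<times> real \<Rightarrow> ennreal" and \<mu> :: "(complex^'n^'n) measure"
  assumes \<mu>: "left_invariant (fixing (insert k S)) \<mu>" and k: "k \<notin> S"
  shows "f \<in> borel_measurable borel \<Longrightarrow>
      (\<integral>\<^sup>+V. f (polar (1 - V $ k $ k)) \<partial>\<mu>) =
      (\<integral>\<^sup>+v. \<integral>\<^sup>+t. f (v, t * (2 * cos v)) \<partial>beta_law (Suc (card S)) \<partial>cos_law (Suc (card S)))"
    and "AE V in \<mu>. V $ k $ k \<noteq> 1"
proof -
  let ?E = "\<lambda>f. \<integral>\<^sup>+v. \<integral>\<^sup>+t. f (v, t * (2 * cos v)) \<partial>beta_law (Suc (card S)) \<partial>cos_law (Suc (card S))"
  define \<zeta> where "\<zeta> = distr \<mu> borel (\<lambda>V. V $ k $ k)"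
  have pr: "prob_on (fixing (insert k S)) \<mu>" using \<mu> by (rule left_invariant_prob_on)
  note [measurable_cong] = prob_onD(2) [OF pr]
  have \<zeta>: "rotation_invariant \<zeta>"
    unfolding \<zeta>_def by (rule rotation_invariant_column_entry [OF \<mu>])
  interpret \<zeta>: prob_space \<zeta> by (rule rotation_invariantD [OF \<zeta>])
  have [measurable_cong]: "sets \<zeta> = sets borel" and sp: "space \<zeta> = UNIV"
    by (simp_all add: \<zeta>_def)
  have le1: "AE z in \<zeta>. cmod z \<le> 1"
    unfolding \<zeta>_def using prob_onD(3) [OF pr]
    by (subst AE_distr_iff) (auto elim!: eventually_mono dest: fixing_unitary column_entry_le_1)
  have tail: "emeasure \<zeta> {z. s < (cmod z)\<^sup>2} = ennreal ((1 - s) ^ card S)" if s: "0 \<le> s" "s < 1" for s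
  proof -
    have "space \<mu> = UNIV"
      using prob_onD(2) [OF pr] by (metis sets_eq_imp_space_eq space_borel)
    then have "emeasure \<zeta> {z. s < (cmod z)\<^sup>2} = emeasure \<mu> {V. s < (cmod (V $ k $ k))\<^sup>2}"
      unfolding \<zeta>_def by (subst emeasure_distr) (auto intro!: arg_cong [where f = "emeasure \<mu>"])
    then show ?thesis
      by (simp add: column_entry_tail [OF \<mu> k s])
  qed
  have \<mu>\<zeta>: "(\<integral>\<^sup>+V. g (polar (1 - V $ k $ k)) \<partial>\<mu>) =
      (\<integral>\<^sup>+z. g (polar (1 - z)) \<partial>\<zeta>)"
    if [measurable]: "g \<in> borel_measurable borel" for g :: "real \<times> real \<Rightarrow> ennreal"
    unfolding \<zeta>_def by (subst nn_integral_distr) simp_all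
  have main: "(\<integral>\<^sup>+z. f (polar (1 - z)) \<partial>\<zeta>) =
    ?E f \<and>
    (AE z in \<zeta>. z \<noteq> 1)" if f [measurable]: "f \<in> borel_measurable borel" for f :: "real \<times> real \<Rightarrow> ennreal"
  proof (cases "card S")
    case 0
    \<comment> \<open>Almost surely the squared modulus exceeds countably many levels tending to 1,
      hence it is at least 1.\<close>
    have "emeasure \<zeta> {z. cmod z < 1} = 0"
    proof -
      have "AE z in \<zeta>. \<forall>n. radius n < (cmod z)\<^sup>2"
        unfolding AE_all_countable
      proof
        fix n
        have "measure \<zeta> {z. radius n < (cmod z)\<^sup>2} = 1"
          using tail [OF radius [of n]] 0 by (simp add: measure_def)
        then have "AE z in \<zeta>. z \<in> {z. radius n < (cmod z)\<^sup>2}"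
          by (subst \<zeta>.AE_in_set_eq_1) simp_all
        then show "AE z in \<zeta>. radius n < (cmod z)\<^sup>2" by simp
      qed
      then have "AE z in \<zeta>. \<not> cmod z < 1"
      proof eventually_elim
        case (elim z)
        have "1 \<le> (cmod z)\<^sup>2"
          by (rule LIMSEQ_le_const2 [OF radius_lim]) (use elim in \<open>auto intro: less_imp_le\<close>)
        then show ?case
          by (metis abs_norm_cancel abs_square_less_1 not_le)
      qed
      from emeasure_eq_0_AE [OF this] show ?thesis by (simp add: sp)
    qed
    then have "AE z in \<zeta>. \<not> cmod z < 1"
      by (subst AE_iff_measurable [of "{z. cmod z < 1}"]) (auto simp: sp)
    with le1 have circle: "AE z in \<zeta>. cmod z = 1"
      by eventually_elim simp
    have law: "(\<integral>\<^sup>+z. g (polar (1 - z)) \<partial>\<zeta>) =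
        (\<integral>\<^sup>+\<phi>. ennreal (cos_density 0 \<phi>) * g (\<phi>, 2 * cos \<phi>) \<partial>lborel)"
      if "g \<in> borel_measurable borel" for g :: "real \<times> real \<Rightarrow> ennreal"
      by (rule circle_law_one_minus [OF \<zeta> circle that])
    have [measurable]: "(\<lambda>p :: real \<times> real. indicator {0} (snd p) :: ennreal) \<in> borel_measurable borel"
      unfolding borel_prod [symmetric] by measurable
    \<comment> \<open>The event z = 1 says that \<open>1 - z\<close> has modulus 0, whereas 2
      cos(phi) is positive wherever \<open>cos_density 0\<close> is nonzero.\<close>
    have "(\<integral>\<^sup>+z. indicator {1} z \<partial>\<zeta>) = (\<integral>\<^sup>+z. (\<lambda>p. indicator {0} (snd p)) (polar (1 - z)) \<partial>\<zeta>)"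
      by (intro nn_integral_cong) (auto simp: indicator_def)
    also have "\<dots> = (\<integral>\<^sup>+\<phi>. ennreal (cos_density 0 \<phi>) * (\<lambda>p. indicator {0} (snd p)) (\<phi>, 2 * cos \<phi>) \<partial>lborel)"
      by (rule law) fact
    also have "\<dots> = (\<integral>\<^sup>+\<phi>. 0 \<partial>(lborel :: real measure))"
    proof (rule nn_integral_cong)
      fix \<phi> :: real
      have "cos \<phi> \<noteq> 0" if "\<phi> \<in> {- pi / 2 <..< pi / 2}"
        using that cos_gt_zero_pi [of \<phi>] by auto
      then show "ennreal (cos_density 0 \<phi>) * (\<lambda>p. indicator {0} (snd p)) (\<phi>, 2 * cos \<phi>) = 0"
        by (auto simp: cos_density_def indicator_def)
    qed
    finally have "emeasure \<zeta> {1} = 0" by (simp add: sp)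
    then have "AE z in \<zeta>. z \<noteq> 1"
      by (subst AE_iff_measurable [of "{1}"]) (auto simp: sp)
    moreover have "?E f =
        (\<integral>\<^sup>+\<phi>. ennreal (cos_density 0 \<phi>) * f (\<phi>, 2 * cos \<phi>) \<partial>lborel)"
      using 0 by (simp add: beta_law_def cos_law_def nn_integral_return nn_integral_density)
    ultimately show ?thesis
      by (simp add: law)
  next
    case (Suc m)
    then have law: "\<zeta> = disc_law m"
      using tail by (intro rotation_invariant_eq_disc_law [OF \<zeta> le1]) simp
    have ae: "AE z in disc_law m. z \<noteq> 1"
      using disc_law_AE(1) [of m] by eventually_elim auto
    have eq: "?E f =
        (\<integral>\<^sup>+\<phi>. \<integral>\<^sup>+t. ennreal (cos_density (m + 1) \<phi>) *
       ennreal (beta_density (real (m + 2)) (real (m + 2) - 1) t) * f (\<phi>, t * (2 * cos \<phi>)) \<partial>lborel \<partial>lborel)"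
    proof -
      have b: "beta_law (Suc (card S)) = density lborel (\<lambda>t. ennreal (beta_density (real (m + 2)) (real (m + 2) - 1) t))"
        using Suc by (simp add: beta_law_def)
      have c: "cos_law (Suc (card S)) = density lborel (\<lambda>v. ennreal (cos_density (m + 1) v))"
        using Suc by (simp add: cos_law_def)
      have "?E f =
        (\<integral>\<^sup>+\<phi>. ennreal (cos_density (m + 1) \<phi>) * (\<integral>\<^sup>+t.
          ennreal (beta_density (real (m + 2)) (real (m + 2) - 1) t) * f (\<phi>, t * (2 * cos \<phi>)) \<partial>lborel) \<partial>lborel)"
        unfolding b c by (simp add: nn_integral_density)
      then show ?thesis
        by (simp add: nn_integral_cmult mult.assoc)
    qed
    show ?thesis
      unfolding law eq using disc_law_one_minus [OF f, of m] ae by blast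
  qed
  show "(\<integral>\<^sup>+V. f (polar (1 - V $ k $ k)) \<partial>\<mu>) =
    ?E f"
    if "f \<in> borel_measurable borel"
    using \<mu>\<zeta> [OF that] main [OF that] by simp
  have "AE z in \<zeta>. z \<noteq> 1"
    using main [OF borel_measurable_const] by simp
  then show "AE V in \<mu>. V $ k $ k \<noteq> 1"
    unfolding \<zeta>_def by (subst (asm) AE_distr_iff) simp_all
qed

section \<open>The law of sum and product of independent factors\<close>

definition product_stat :: "nat \<Rightarrow> (nat \<Rightarrow> real) \<times> (nat \<Rightarrow> real) \<Rightarrow> real \<times> real" where
  "product_stat n p = (\<Sum>j = 1..n. fst p j, \<Prod>j = 1..n. snd p j * (2 * cos (fst p j)))"

definition product_law :: "(nat \<Rightarrow> real measure) \<Rightarrow> (nat \<Rightarrow> real measure) \<Rightarrow> nat \<Rightarrow> (real \<times> real) measure" where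
  "product_law A B n = distr (Pi\<^sub>M {1..n} A \<Otimes>\<^sub>M Pi\<^sub>M {1..n} B) borel (product_stat n)"

lemma sets_product_law [simp, measurable_cong]: "sets (product_law A B n) = sets borel"
  by (simp add: product_law_def)

lemma borel_measurable_fst_snd [measurable]:
  "fst \<in> borel_measurable (borel :: (real \<times> real) measure)"
  "snd \<in> borel_measurable (borel :: (real \<times> real) measure)"
  unfolding borel_prod [symmetric] by measurable

lemma borel_measurable_pair [measurable (raw)]:
  fixes g h :: "'a \<Rightarrow> real"
  shows "g \<in> borel_measurable M \<Longrightarrow> h \<in> borel_measurable M \<Longrightarrow> (\<lambda>x. (g x, h x)) \<in> borel_measurable M"
  unfolding borel_prod [symmetric] by measurable

lemma measurable_product_stat:
  assumes A: "\<And>j. sets (A j) = sets borel" and B: "\<And>j. sets (B j) = sets borel"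
  shows "product_stat n \<in> borel_measurable (Pi\<^sub>M {1..n} A \<Otimes>\<^sub>M Pi\<^sub>M {1..n} B)" (is "_ \<in> borel_measurable ?M")
proof -
  note [measurable_cong] = A B
  have [measurable]: "(\<lambda>p. fst p j) \<in> borel_measurable ?M"
    "(\<lambda>p. snd p j) \<in> borel_measurable ?M" if "j \<in> {1..n}" for j
    using that by measurable
  show ?thesis
    unfolding product_stat_def
    by (intro borel_measurable_pair borel_measurable_sum borel_measurable_prod borel_measurable_times
          borel_measurable_const measurable_compose [OF _ borel_measurable_cos]) auto
qed

lemma product_stat_Suc:
  "product_stat (Suc n) (w(Suc n := a), u(Suc n := b)) =
     (a + fst (product_stat n (w, u)), b * (2 * cos a) * snd (product_stat n (w, u)))"
proof -
  have "(\<Sum>j = 1..n. (w(Suc n := a)) j) = (\<Sum>j = 1..n. w j)"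
    by (intro sum.cong) auto
  moreover have "(\<Prod>j = 1..n. (u(Suc n := b)) j * (2 * cos ((w(Suc n := a)) j))) = (\<Prod>j = 1..n. u j * (2 * cos (w j)))"
    by (intro prod.cong) auto
  ultimately show ?thesis
    by (simp add: product_stat_def)
qed

text \<open>The factor laws are kept abstract because a probability measure is wanted at every
  index, and \<open>beta_law 0\<close> is none. In the application they are laws of the given random
  variables, padded outside the index range.\<close>

locale factor_laws =
  fixes A B :: "nat \<Rightarrow> real measure"
  assumes prob_A: "\<And>j. prob_space (A j)" and prob_B: "\<And>j. prob_space (B j)"
    and sets_A [measurable_cong]: "\<And>j. sets (A j) = sets borel"
    and sets_B [measurable_cong]: "\<And>j. sets (B j) = sets borel"
begin

lemma product_prob_spaces: "prob_space (Pi\<^sub>M I A)" "prob_space (Pi\<^sub>M I B)"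
  by (intro prob_space_PiM prob_A prob_B)+

lemma prob_space_product_law: "prob_space (product_law A B n)"
  unfolding product_law_def
  by (intro prob_space.prob_space_distr prob_space_pair product_prob_spaces
      measurable_product_stat sets_A sets_B)

lemma nn_integral_product_law:
  assumes f [measurable]: "f \<in> borel_measurable borel"
  shows "(\<integral>\<^sup>+p. f p \<partial>product_law A B n) =
    (\<integral>\<^sup>+w. \<integral>\<^sup>+u. f (product_stat n (w, u)) \<partial>Pi\<^sub>M {1..n} B \<partial>Pi\<^sub>M {1..n} A)"
proof -
  note [measurable] = measurable_product_stat [OF sets_A sets_B]
  interpret PA: prob_space "Pi\<^sub>M {1..n} A" by (rule product_prob_spaces)
  interpret PB: prob_space "Pi\<^sub>M {1..n} B" by (rule product_prob_spaces)
  have "(\<integral>\<^sup>+p. f p \<partial>product_law A B n) = (\<integral>\<^sup>+p. f (product_stat n p) \<partial>(Pi\<^sub>M {1..n} A \<Otimes>\<^sub>M Pi\<^sub>M {1..n} B))"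
    unfolding product_law_def by (rule nn_integral_distr) measurable
  also have "\<dots> = (\<integral>\<^sup>+w. \<integral>\<^sup>+u. f (product_stat n (w, u)) \<partial>Pi\<^sub>M {1..n} B \<partial>Pi\<^sub>M {1..n} A)"
    by (rule PB.nn_integral_fst [symmetric]) measurable
  finally show ?thesis .
qed

lemma product_law_0:
  assumes "f \<in> borel_measurable borel"
  shows "(\<integral>\<^sup>+p. f p \<partial>product_law A B 0) = f (0, 1)"
  using product_prob_spaces [of "{1..0}", THEN prob_space.emeasure_space_1]
  by (simp add: nn_integral_product_law [OF assms] product_stat_def)

text \<open>Coordinate \<open>Suc n\<close> is split off from both products, and an exchange of
  integrals brings the two new variables to the front, which is the shape of the recursion for
  \<open>stat\<close>.\<close>

lemma product_law_Suc:
  assumes f [measurable]: "f \<in> borel_measurable borel"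
  shows "(\<integral>\<^sup>+p. f p \<partial>product_law A B (Suc n)) =
    (\<integral>\<^sup>+a. \<integral>\<^sup>+b. \<integral>\<^sup>+p. f (a + fst p, b * (2 * cos a) * snd p) \<partial>product_law A B n
       \<partial>B (Suc n) \<partial>A (Suc n))"
proof -
  let ?f = "\<lambda>a b p. f (a + fst p, b * (2 * cos a) * snd p)"
  interpret A: product_sigma_finite A
    by (simp add: product_sigma_finite_def prob_space_imp_sigma_finite prob_A)
  interpret B: product_sigma_finite B
    by (simp add: product_sigma_finite_def prob_space_imp_sigma_finite prob_B)
  interpret PA: prob_space "Pi\<^sub>M {1..n} A" by (rule product_prob_spaces)
  interpret PB: prob_space "Pi\<^sub>M {1..n} B" by (rule product_prob_spaces)
  interpret PB': prob_space "Pi\<^sub>M {1..Suc n} B" by (rule product_prob_spaces)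
  interpret Bn: prob_space "B (Suc n)" by (rule prob_B)
  interpret pair_sigma_finite "Pi\<^sub>M {1..n} A" "B (Suc n)" ..
  have ins: "{1..Suc n} = insert (Suc n) {1..n}" by auto
  note ps [measurable] = measurable_product_stat [OF sets_A sets_B]
  have ps': "(\<lambda>(w, u). f (product_stat (Suc n) (w, u))) \<in> borel_measurable (Pi\<^sub>M {1..Suc n} A \<Otimes>\<^sub>M Pi\<^sub>M {1..Suc n} B)"
    using measurable_compose [OF measurable_product_stat [OF sets_A sets_B] f, of "Suc n"]
    by (simp only: case_prod_unfold prod.collapse)
  have "(\<integral>\<^sup>+p. f p \<partial>product_law A B (Suc n)) =
      (\<integral>\<^sup>+w. \<integral>\<^sup>+u. f (product_stat (Suc n) (w, u)) \<partial>Pi\<^sub>M {1..Suc n} B \<partial>Pi\<^sub>M {1..Suc n} A)"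
    by (rule nn_integral_product_law [OF f])
  also have "\<dots> = (\<integral>\<^sup>+a. \<integral>\<^sup>+w. \<integral>\<^sup>+u. f (product_stat (Suc n) (w(Suc n := a), u))
      \<partial>Pi\<^sub>M {1..Suc n} B \<partial>Pi\<^sub>M {1..n} A \<partial>A (Suc n))"
    using PB'.borel_measurable_nn_integral [OF ps'] unfolding ins
    by (intro A.product_nn_integral_insert_rev) simp_all
  also have "\<dots> = (\<integral>\<^sup>+a. \<integral>\<^sup>+w. \<integral>\<^sup>+b. \<integral>\<^sup>+u. f (product_stat (Suc n) (w(Suc n := a), u(Suc n := b)))
      \<partial>Pi\<^sub>M {1..n} B \<partial>B (Suc n) \<partial>Pi\<^sub>M {1..n} A \<partial>A (Suc n))"
  proof (intro nn_integral_cong)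
    fix a w assume a: "a \<in> space (A (Suc n))" and w: "w \<in> space (Pi\<^sub>M {1..n} A)"
    have "w(Suc n := a) \<in> space (Pi\<^sub>M {1..Suc n} A)"
      using a w by (auto simp: space_PiM PiE_iff extensional_def ins)
    from measurable_compose [OF measurable_Pair1' [OF this] measurable_product_stat [OF sets_A sets_B]]
    have "(\<lambda>u. product_stat (Suc n) (w(Suc n := a), u)) \<in> borel_measurable (Pi\<^sub>M {1..Suc n} B)" .
    from measurable_compose [OF this f]
    show "(\<integral>\<^sup>+u. f (product_stat (Suc n) (w(Suc n := a), u)) \<partial>Pi\<^sub>M {1..Suc n} B) =
      (\<integral>\<^sup>+b. \<integral>\<^sup>+u. f (product_stat (Suc n) (w(Suc n := a), u(Suc n := b))) \<partial>Pi\<^sub>M {1..n} B \<partial>B (Suc n))"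
      unfolding ins by (intro B.product_nn_integral_insert_rev) simp_all
  qed
  also have "\<dots> = (\<integral>\<^sup>+a. \<integral>\<^sup>+w. \<integral>\<^sup>+b. \<integral>\<^sup>+u.
      ?f a b (product_stat n (w, u))
      \<partial>Pi\<^sub>M {1..n} B \<partial>B (Suc n) \<partial>Pi\<^sub>M {1..n} A \<partial>A (Suc n))"
    by (simp only: product_stat_Suc)
  also have "\<dots> = (\<integral>\<^sup>+a. \<integral>\<^sup>+b. \<integral>\<^sup>+w. \<integral>\<^sup>+u.
      ?f a b (product_stat n (w, u))
      \<partial>Pi\<^sub>M {1..n} B \<partial>Pi\<^sub>M {1..n} A \<partial>B (Suc n) \<partial>A (Suc n))"
  proof (rule nn_integral_cong)
    fix a
    show "(\<integral>\<^sup>+w. \<integral>\<^sup>+b. \<integral>\<^sup>+u. ?f a b (product_stat n (w, u))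
      \<partial>Pi\<^sub>M {1..n} B \<partial>B (Suc n) \<partial>Pi\<^sub>M {1..n} A) =
      (\<integral>\<^sup>+b. \<integral>\<^sup>+w. \<integral>\<^sup>+u. ?f a b (product_stat n (w, u))
      \<partial>Pi\<^sub>M {1..n} B \<partial>Pi\<^sub>M {1..n} A \<partial>B (Suc n))"
      by (rule Fubini' [symmetric]) measurable
  qed
  also have "\<dots> = (\<integral>\<^sup>+a. \<integral>\<^sup>+b. \<integral>\<^sup>+p. f (a + fst p, b * (2 * cos a) * snd p) \<partial>product_law A B n
       \<partial>B (Suc n) \<partial>A (Suc n))"
  proof (intro nn_integral_cong)
    fix a b
    have "(\<lambda>p. f (a + fst p, b * (2 * cos a) * snd p)) \<in> borel_measurable borel"
      by measurable
    from nn_integral_product_law [OF this, of n]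
    show "(\<integral>\<^sup>+w. \<integral>\<^sup>+u. ?f a b (product_stat n (w, u))
      \<partial>Pi\<^sub>M {1..n} B \<partial>Pi\<^sub>M {1..n} A) = (\<integral>\<^sup>+p. f (a + fst p, b * (2 * cos a) * snd p) \<partial>product_law A B n)"
      by simp
  qed
  finally show ?thesis .
qed

text \<open>Induction on \<open>S\<close> with \<open>\<mu>\<close> arbitrary, since the cofactor
  has a law of its own. Nonvanishing of the determinant is carried along because
  \<open>stat_insert\<close> requires it of the cofactor.\<close>

lemma stat_law:
  fixes S :: "'n::finite set"
  assumes "\<And>j. 1 \<le> j \<Longrightarrow> j \<le> card S \<Longrightarrow> A j = cos_law j \<and> B j = beta_law j"
    and "left_invariant (fixing S) \<mu>"
  shows "(AE V in \<mu>. det (mat 1 - V ** coord_proj S) \<noteq> 0) \<and>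
    (\<forall>f \<in> borel_measurable borel. (\<integral>\<^sup>+V. f (stat S V) \<partial>\<mu>) = (\<integral>\<^sup>+p. f p \<partial>product_law A B (card S)))"
  using finite [of S] assms
proof (induction S arbitrary: \<mu> rule: finite_induct)
  case empty
  have "prob_on (fixing {}) \<mu>" using empty(2) by (simp add: left_invariant_def)
  note p = prob_onD [OF this]
  interpret prob_space \<mu> by (rule p)
  \<comment> \<open>The empty block is the zero matrix, with logarithm 0 and determinant 1.\<close>
  have zero: "V ** coord_proj {} = 0" for V :: "complex^'n^'n"
    by (simp add: vec_eq_iff mult_coord_proj)
  then have "stat {} V = (0, 1)" for V :: "complex^'n^'n"
    by (simp add: stat_def arg_det_def)
  then show ?case
    by (auto simp: zero product_law_0 emeasure_space_1)
next
  case (insert k S)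
  define \<kappa> where "\<kappa> = distr \<mu> borel (cofactor k)"
  have \<mu>: "left_invariant (fixing (insert k S)) \<mu>" by (rule insert.prems)
  have \<kappa>: "left_invariant (fixing S) \<kappa>"
    unfolding \<kappa>_def by (rule left_invariant_cofactor [OF \<mu> insert.hyps(2)])
  have pr: "prob_on (fixing (insert k S)) \<mu>" using \<mu> by (rule left_invariant_prob_on)
  note [measurable_cong] = prob_onD(2) [OF pr]
  have n: "card (insert k S) = Suc (card S)" using insert.hyps by simp
  have IH: "AE V in \<kappa>. det (mat 1 - V ** coord_proj S) \<noteq> 0"
    "\<And>f. f \<in> borel_measurable borel \<Longrightarrow> (\<integral>\<^sup>+V. f (stat S V) \<partial>\<kappa>) = (\<integral>\<^sup>+p. f p \<partial>product_law A B (card S))"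
    using insert.IH [OF _ \<kappa>] insert.prems(1) by (auto simp: n)
  have det_cofactor: "AE V in \<mu>. det (mat 1 - cofactor k V ** coord_proj S) \<noteq> 0"
    using IH(1) unfolding \<kappa>_def by (subst (asm) AE_distr_iff) simp_all
  have ae: "AE V in \<mu>. det (mat 1 - V ** coord_proj (insert k S)) \<noteq> 0 \<and>
      stat (insert k S) V = (half_arg (1 - V $ k $ k) + fst (stat S (cofactor k V)),
        cmod (1 - V $ k $ k) * snd (stat S (cofactor k V)))"
    using prob_onD(3) [OF pr] det_cofactor column_entry_one_minus(2) [OF \<mu> insert.hyps(2)]
    by eventually_elim (use stat_insert insert.hyps(2) in blast)
  have "(\<integral>\<^sup>+V. f (stat (insert k S) V) \<partial>\<mu>) = (\<integral>\<^sup>+p. f p \<partial>product_law A B (card (insert k S)))"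
    if f [measurable]: "f \<in> borel_measurable borel" for f
  proof -
    interpret T: prob_space "product_law A B (card S)" by (rule prob_space_product_law)
    let ?g = "\<lambda>v h. f (half_arg (1 - v $ k) + fst (stat S h), cmod (1 - v $ k) * snd (stat S h))"
    \<comment> \<open>The smaller block is integrated out first, by independence of the column; the
      remaining integrand depends on \<open>V\<close> only through the polar coordinates of
      \<open>1 - V $ k $ k\<close>.\<close>
    define F where "F q = (\<integral>\<^sup>+p. f (fst q + fst p, snd q * snd p) \<partial>product_law A B (card S))" for q :: "real \<times> real"
    have F [measurable]: "F \<in> borel_measurable borel"
      unfolding F_def by measurable
    have "(\<integral>\<^sup>+V. f (stat (insert k S) V) \<partial>\<mu>) =
        (\<integral>\<^sup>+V. ?g (V *v axis k 1) (cofactor k V) \<partial>\<mu>)"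
    proof (rule nn_integral_cong_AE)
      show "AE V in \<mu>. f (stat (insert k S) V) =
          ?g (V *v axis k 1) (cofactor k V)"
        using ae by eventually_elim (simp add: matrix_vector_mult_axis)
    qed
    also have "\<dots> = (\<integral>\<^sup>+V. \<integral>\<^sup>+h. ?g (V *v axis k 1) h \<partial>\<kappa> \<partial>\<mu>)"
      unfolding \<kappa>_def
      by (rule cofactor_independent [OF \<mu> insert.hyps(2),
            of ?g])
         measurable
    also have "\<dots> = (\<integral>\<^sup>+V. F (polar (1 - V $ k $ k)) \<partial>\<mu>)"
    proof (rule nn_integral_cong)
      fix V :: "complex^'n^'n"
      show "(\<integral>\<^sup>+h. ?g (V *v axis k 1) h \<partial>\<kappa>) = F (polar (1 - V $ k $ k))"
        unfolding matrix_vector_mult_axis F_def fst_conv snd_conv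
        by (rule IH(2) [of "\<lambda>p. f (half_arg (1 - V $ k $ k) + fst p, cmod (1 - V $ k $ k) * snd p)"]) measurable
    qed
    also have "\<dots> = (\<integral>\<^sup>+v. \<integral>\<^sup>+t. F (v, t * (2 * cos v)) \<partial>beta_law (Suc (card S)) \<partial>cos_law (Suc (card S)))"
      by (rule column_entry_one_minus(1) [OF \<mu> insert.hyps(2) F])
    also have "\<dots> = (\<integral>\<^sup>+p. f p \<partial>product_law A B (card (insert k S)))"
      using insert.prems(1) [of "Suc (card S)"] unfolding n product_law_Suc [OF f] F_def by (simp add: n)
    finally show ?thesis .
  qed
  with ae show ?case by (auto elim!: eventually_mono)
qed

end

section \<open>From the given random variables to the two laws\<close>

text \<open>Haar measure lives on the sigma-algebra of the group. Its image under the inclusion is a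
  measure on all matrices, where translations by group elements still act.\<close>

lemma haar_unitary_left_invariant:
  fixes \<mu> :: "(complex^'n^'n) measure"
  assumes haar: "haar_unitary \<mu>"
  shows "(\<lambda>x. x) \<in> borel_measurable \<mu>" "space \<mu> = unitary_group"
    and "left_invariant (fixing UNIV) (distr \<mu> borel (\<lambda>x. x))"
proof -
  have sets: "sets \<mu> = sets (restrict_space borel unitary_group)"
    using haar by (simp add: haar_unitary_def)
  show id: "(\<lambda>x. x) \<in> borel_measurable \<mu>"
    by (subst measurable_cong_sets [OF sets refl]) (rule measurable_restrict_space1, simp)
  show sp: "space \<mu> = unitary_group"
    using sets_eq_imp_space_eq [OF sets] by (simp add: space_restrict_space)
  have [measurable]: "(unitary_group :: (complex^'n^'n) set) \<in> sets borel"
    using fixing_borel [of "UNIV :: 'n set"] by simp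
  have "AE x in distr \<mu> borel (\<lambda>x. x). x \<in> unitary_group"
    using id by (subst AE_distr_iff) (auto simp: sp)
  moreover have "prob_space (distr \<mu> borel (\<lambda>x. x))"
    using haar id by (intro prob_space.prob_space_distr) (auto simp: haar_unitary_def)
  moreover have "distr (distr \<mu> borel (\<lambda>x. x)) borel (\<lambda>x. g ** x) = distr \<mu> borel (\<lambda>x. x)"
    if g: "g \<in> unitary_group" for g
  proof -
    have "(\<lambda>x. g ** x) \<in> measurable (restrict_space borel unitary_group) (restrict_space borel unitary_group)"
      using g by (intro measurable_restrict_space2 measurable_restrict_space1)
        (auto simp: space_restrict_space unitary_mult)
    then have mg: "(\<lambda>x. g ** x) \<in> measurable \<mu> \<mu>"
      by (simp cong: measurable_cong_sets add: measurable_cong_sets [OF sets sets])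
    have "distr (distr \<mu> borel (\<lambda>x. x)) borel (\<lambda>x. g ** x) = distr \<mu> borel (\<lambda>x. g ** x)"
      using id by (subst distr_distr) (simp_all add: o_def)
    also have "\<dots> = distr (distr \<mu> \<mu> (\<lambda>x. g ** x)) borel (\<lambda>x. x)"
      using id mg by (subst distr_distr) (simp_all add: o_def)
    also have "distr \<mu> \<mu> (\<lambda>x. g ** x) = \<mu>"
      using haar g by (simp add: haar_unitary_def)
    finally show ?thesis .
  qed
  ultimately show "left_invariant (fixing UNIV) (distr \<mu> borel (\<lambda>x. x))"
    by (simp add: left_invariant_def prob_on_def)
qed

lemma stat_UNIV:
  assumes "V \<in> unitary_group"
  shows "stat UNIV V = (Im (log_det_one_minus V), cmod (det (mat 1 - V)))"
proof -
  have "V ** coord_proj UNIV = V"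
    by (simp add: vec_eq_iff mult_coord_proj)
  then show ?thesis
    using assms by (simp add: stat_def arg_det_def unitary_contractive)
qed

theorem theorem3p2:
  fixes P :: "'w measure" and V :: "'w \<Rightarrow> complex^'n^'n" and \<mu> :: "(complex^'n^'n) measure"
    and Q :: "'v measure" and \<beta> W :: "nat \<Rightarrow> 'v \<Rightarrow> real"
  assumes P: "prob_space P"
    and haar: "haar_unitary \<mu>"
    and V_rv: "V \<in> measurable P \<mu>"
    and V_law: "distr P \<mu> V = \<mu>"
    and Q: "prob_space Q"
    and \<beta>_indep: "prob_space.indep_vars Q (\<lambda>_. borel) \<beta> {1..CARD('n)}"
    and \<beta>_one: "AE \<omega> in Q. \<beta> 1 \<omega> = 1"
    and \<beta>_law: "\<And>j. j \<in> {2..CARD('n)} \<Longrightarrow>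
          distributed Q lborel (\<beta> j) (\<lambda>t. ennreal (beta_density (real j) (real j - 1) t))"
    and W_indep: "prob_space.indep_vars Q (\<lambda>_. borel) W {1..CARD('n)}"
    and W_law: "\<And>j. j \<in> {1..CARD('n)} \<Longrightarrow>
          distributed Q lborel (W j) (\<lambda>v. ennreal (cos_density (j - 1) v))"
    and W_\<beta>_indep: "prob_space.indep_var Q
          (Pi\<^sub>M {1..CARD('n)} (\<lambda>_. borel)) (\<lambda>\<omega>. \<lambda>j\<in>{1..CARD('n)}. W j \<omega>)
          (Pi\<^sub>M {1..CARD('n)} (\<lambda>_. borel)) (\<lambda>\<omega>. \<lambda>j\<in>{1..CARD('n)}. \<beta> j \<omega>)"
  shows "distr P (borel :: (real \<times> real) measure)
           (\<lambda>\<omega>. (Im (log_det_one_minus (V \<omega>)), cmod (det (mat 1 - V \<omega>)))) =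
         distr Q (borel :: (real \<times> real) measure)
           (\<lambda>\<omega>. (\<Sum>j = 1..CARD('n). W j \<omega>, \<Prod>j = 1..CARD('n). \<beta> j \<omega> * (2 * cos (W j \<omega>))))"
proof -
  let ?N = "CARD('n)" and ?I = "{1..CARD('n)}"
  interpret Q: prob_space Q by (rule Q)
  \<comment> \<open>The point masses only pad the families, so that \<open>factor_laws\<close> holds
    at every index.\<close>
  define A where "A j = (if j \<in> ?I then distr Q borel (W j) else return borel 0)" for j
  define B where "B j = (if j \<in> ?I then distr Q borel (\<beta> j) else return borel 0)" for j
  have W_rv [measurable]: "W j \<in> borel_measurable Q" if "j \<in> ?I" for j
    using W_indep that by (auto simp: Q.indep_vars_def)
  have \<beta>_rv [measurable]: "\<beta> j \<in> borel_measurable Q" if "j \<in> ?I" for j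
    using \<beta>_indep that by (auto simp: Q.indep_vars_def)
  interpret factor_laws A B
  proof (rule factor_laws.intro)
    fix j
    show "prob_space (A j)" "prob_space (B j)"
      by (auto simp: A_def B_def intro!: Q.prob_space_distr W_rv \<beta>_rv prob_space_return)
    show "sets (A j) = sets borel" "sets (B j) = sets borel"
      by (simp_all add: A_def B_def)
  qed
  have ne: "?I \<noteq> {}" by (simp add: Suc_le_eq)
  have laws: "A j = cos_law j \<and> B j = beta_law j" if j: "1 \<le> j" "j \<le> card (UNIV :: 'n set)" for j
  proof
    \<comment> \<open>\<open>distributed\<close> refers to \<open>lborel\<close> and the factor laws
      to \<open>borel\<close>; both have the same measurable sets.\<close>
    have "distr Q borel X = distr Q lborel X" for X :: "'v \<Rightarrow> real"
      by (rule distr_cong) simp_all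
    note to_lborel = this
    show "A j = cos_law j"
      using W_law [of j] j by (simp add: A_def to_lborel cos_law_def distributed_def)
    show "B j = beta_law j"
    proof (cases "j = 1")
      case True
      have "distr Q borel (\<beta> 1) = distr Q borel (\<lambda>_. 1)"
        by (rule distr_cong_AE) (use \<beta>_one \<beta>_rv [of 1] j in auto)
      then show ?thesis
        using True j by (simp add: B_def beta_law_def Q.distr_const)
    next
      case False
      then show ?thesis
        using \<beta>_law [of j] j by (simp add: B_def to_lborel beta_law_def distributed_def)
    qed
  qed
  note haar' = haar_unitary_left_invariant [OF haar]
  have V_unitary: "V \<omega> \<in> unitary_group" if "\<omega> \<in> space P" for \<omega>
    using measurable_space [OF V_rv that] by (simp add: haar')
  have stat_\<mu>: "stat UNIV \<in> borel_measurable \<mu>"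
    using measurable_compose [OF haar'(1) borel_measurable_stat] .
  have "distr P borel (\<lambda>\<omega>. (Im (log_det_one_minus (V \<omega>)), cmod (det (mat 1 - V \<omega>)))) =
      distr P borel (\<lambda>\<omega>. stat UNIV (V \<omega>))"
    by (rule distr_cong) (simp_all add: stat_UNIV V_unitary)
  also have "\<dots> = distr (distr P \<mu> V) borel (stat UNIV)"
    by (simp add: distr_distr [OF stat_\<mu> V_rv] o_def)
  also have "\<dots> = distr \<mu> borel (stat UNIV)"
    by (simp only: V_law)
  also have "\<dots> = distr (distr \<mu> borel (\<lambda>x. x)) borel (stat UNIV)"
    by (simp add: distr_distr [OF borel_measurable_stat haar'(1)] o_def)
  also have "\<dots> = product_law A B ?N" (is "?M = _")
  proof (rule measure_eqI)
    fix X assume "X \<in> sets ?M"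
    then have X [measurable]: "X \<in> sets borel" by simp
    have "emeasure ?M X =
        (\<integral>\<^sup>+p. indicator X p \<partial>?M)"
      by simp
    also have "\<dots> = (\<integral>\<^sup>+V. indicator X (stat UNIV V) \<partial>distr \<mu> borel (\<lambda>x. x))"
      by (rule nn_integral_distr) simp_all
    also have "\<dots> = (\<integral>\<^sup>+p. indicator X p \<partial>product_law A B ?N)"
      using stat_law [OF laws haar'(3)] by (metis borel_measurable_indicator X)
    also have "\<dots> = emeasure (product_law A B ?N) X"
      by simp
    finally show "emeasure ?M X = emeasure (product_law A B ?N) X" .
  qed simp
  \<comment> \<open>Independence within \<open>W\<close>, within \<open>\<beta>\<close> and between
    the two families turns the product measure into the joint law of the restricted
    families.\<close>
  also have "\<dots> = distr Q borel (\<lambda>\<omega>. product_stat ?N (\<lambda>j\<in>?I. W j \<omega>, \<lambda>j\<in>?I. \<beta> j \<omega>))"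
  proof -
    have PA: "Pi\<^sub>M ?I A = distr Q (Pi\<^sub>M ?I (\<lambda>_. borel)) (\<lambda>\<omega>. \<lambda>j\<in>?I. W j \<omega>)"
    proof -
      have "Pi\<^sub>M ?I A = Pi\<^sub>M ?I (\<lambda>j. distr Q borel (W j))"
        by (rule PiM_cong) (simp_all add: A_def)
      then show ?thesis
        using W_indep Q.indep_vars_iff_distr_eq_PiM' [OF ne, where X = W and M' = "\<lambda>_. borel"] W_rv by simp
    qed
    have PB: "Pi\<^sub>M ?I B = distr Q (Pi\<^sub>M ?I (\<lambda>_. borel)) (\<lambda>\<omega>. \<lambda>j\<in>?I. \<beta> j \<omega>)"
    proof -
      have "Pi\<^sub>M ?I B = Pi\<^sub>M ?I (\<lambda>j. distr Q borel (\<beta> j))"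
        by (rule PiM_cong) (simp_all add: B_def)
      then show ?thesis
        using \<beta>_indep Q.indep_vars_iff_distr_eq_PiM' [OF ne, where X = \<beta> and M' = "\<lambda>_. borel"] \<beta>_rv by simp
    qed
    have joint: "Pi\<^sub>M ?I A \<Otimes>\<^sub>M Pi\<^sub>M ?I B = distr Q (Pi\<^sub>M ?I (\<lambda>_. borel) \<Otimes>\<^sub>M Pi\<^sub>M ?I (\<lambda>_. borel))
        (\<lambda>\<omega>. (\<lambda>j\<in>?I. W j \<omega>, \<lambda>j\<in>?I. \<beta> j \<omega>))"
      using W_\<beta>_indep unfolding PA PB Q.indep_var_distribution_eq by simp
    have rv: "(\<lambda>\<omega>. (\<lambda>j\<in>?I. W j \<omega>, \<lambda>j\<in>?I. \<beta> j \<omega>)) \<in>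
        measurable Q (Pi\<^sub>M ?I (\<lambda>_. borel) \<Otimes>\<^sub>M Pi\<^sub>M ?I (\<lambda>_. borel))"
      using W_\<beta>_indep unfolding Q.indep_var_distribution_eq by (intro measurable_Pair) auto
    show ?thesis
      unfolding product_law_def joint
      by (subst distr_distr [OF measurable_product_stat rv]) (simp_all only: o_def)
  qed
  also have "\<dots> = distr Q borel
      (\<lambda>\<omega>. (\<Sum>j = 1..CARD('n). W j \<omega>, \<Prod>j = 1..CARD('n). \<beta> j \<omega> * (2 * cos (W j \<omega>))))"
    by (simp add: product_stat_def)
  finally show ?thesis .
qed

end
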